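(* Let $T>0$, $k\in\mathbb{N}$, $n\in\mathbb{N}^*$ and let $(\omega_j)_{j\in\mathbb{N}}$ be a strictly increasing sequence of $[0,+\infty)$ such that $\omega_0=0$ and such that there exist $\varepsilon>0$, $N_0\in\mathbb{N}$ and $c>0$ with $\omega_{j+1}-\omega_j\ge cj^{\varepsilon}$ for all $j\ge N_0$. There exist a constant $C>0$ and a continuous linear map $\mathcal{L}^T_k:\mathbb{R}^n\times h^{2k}_{\omega,r}(\mathbb{N},\mathbb{C})\to H^k_0((0,T),\mathbb{R})$ such that for every $d=\big((d_{-q})_{q=1,\dots,n},(d_j)_{j\in\mathbb{N}}\big)\in\mathbb{R}^n\times h^{2k}_{\omega,r}(\mathbb{N},\mathbb{C})$, the control $u:=\mathcal{L}^T_k(d)\in H^k_0((0,T),\mathbb{R})$ satisfies the moment problem $$\forall j\in\mathbb{N},\ \int_0^Tu(t)e^{i\omega_jt}dt=d_j\qquad\text{and}\qquad\forall q=1,\dots,n,\ \int_0^Tt^qu(t)dt=d_{-q},$$ with the size estimates $$\|u\|_{H^m_0(0,T)}\le C\left(\sum_{j=-n}^{+\infty}\left|(\delta_{j,0}+\omega_j^m)d_j\right|^2\right)^{1/2},\qquad\forall m=0,\dots,k.$$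
   Context: $\mathbb{N}=\{0,1,2,\dots\}$, $\mathbb{N}^*=\{1,2,\dots\}$. For $m\in\mathbb{N}$, $h^{2m}_{\omega,r}(\mathbb{N},\mathbb{C})$ is the real vector space of $(d_j)_{j\in\mathbb{N}}\in\ell^2(\mathbb{N},\mathbb{C})$ with $d_0\in\mathbb{R}$ and $\|d\|^2_{h^{2m}_\omega}:=\sum_{j=0}^{+\infty}|(\delta_{j,0}+\omega_j^m)d_j|^2<+\infty$, with this norm ($\delta$ is the Kronecker symbol, $0^0=1$). For $j\in\mathbb{Z}$, $j<0$, $\omega_j:=-\omega_{-j}$. $H^m_0(0,T)$ is the closure of $C_c^\infty(0,T)$ in $H^m(0,T)$ with norm $\|u\|_{H^m_0(0,T)}=\|u^{(m)}\|_{L^2(0,T)}$; for $m=0$ it is $L^2(0,T)$. Linear means $\mathbb{R}$-linear. *)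

theory Defs
  imports "HOL-Analysis.Analysis"
begin

section \<open>Sobolev spaces on \<open>(0,T)\<close>\<close>

text \<open>
  Elements of \<open>L\<^sup>2(0,T)\<close> and of the Sobolev spaces are classes of functions modulo equality almost
  everywhere. They are represented here by functions on \<open>\<real>\<close> of which only the values on \<open>(0,T)\<close>
  matter; equality in these spaces is almost everywhere equality on \<open>(0,T)\<close>, and the norms are
  invariant under it.
\<close>

abbreviation leb :: "real \<Rightarrow> real measure" where
  "leb T \<equiv> lebesgue_on {0<..<T}"

definition L2_space :: "real \<Rightarrow> (real \<Rightarrow> real) set" where
  "L2_space T = {u. u \<in> borel_measurable (leb T) \<and> integrable (leb T) (\<lambda>t. (u t)\<^sup>2)}"

definition L2_norm :: "real \<Rightarrow> (real \<Rightarrow> real) \<Rightarrow> real" where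
  "L2_norm T u = sqrt (\<integral>t. (u t)\<^sup>2 \<partial>leb T)"

text \<open>\<open>C\<^sub>c\<^sup>\<infinity>(0,T)\<close>, each function being extended by zero to \<open>\<real>\<close>.\<close>

definition test_fun :: "real \<Rightarrow> (real \<Rightarrow> real) set" where
  "test_fun T = {\<phi>. (\<forall>j x. (deriv ^^ j) \<phi> differentiable (at x)) \<and>
     compact (closure {x. \<phi> x \<noteq> 0}) \<and> closure {x. \<phi> x \<noteq> 0} \<subseteq> {0<..<T}}"

definition is_weak_deriv :: "real \<Rightarrow> nat \<Rightarrow> (real \<Rightarrow> real) \<Rightarrow> (real \<Rightarrow> real) \<Rightarrow> bool" where
  "is_weak_deriv T j u v \<longleftrightarrow> u \<in> L2_space T \<and> v \<in> L2_space T \<and>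
     (\<forall>\<phi>\<in>test_fun T. (\<integral>t. u t * (deriv ^^ j) \<phi> t \<partial>leb T) = (-1) ^ j * (\<integral>t. v t * \<phi> t \<partial>leb T))"

text \<open>The weak derivative \<open>u\<^sup>(\<^sup>j\<^sup>)\<close>; it is unique up to almost everywhere equality on \<open>(0,T)\<close>.\<close>

definition weak_deriv :: "real \<Rightarrow> nat \<Rightarrow> (real \<Rightarrow> real) \<Rightarrow> real \<Rightarrow> real" where
  "weak_deriv T j u = (SOME v. is_weak_deriv T j u v)"

definition H_space :: "nat \<Rightarrow> real \<Rightarrow> (real \<Rightarrow> real) set" where
  "H_space m T = {u \<in> L2_space T. \<forall>j\<le>m. \<exists>v. is_weak_deriv T j u v}"

definition H_norm :: "nat \<Rightarrow> real \<Rightarrow> (real \<Rightarrow> real) \<Rightarrow> real" where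
  "H_norm m T u = sqrt (\<Sum>j\<le>m. (L2_norm T (weak_deriv T j u))\<^sup>2)"

text \<open>The closure of \<open>C\<^sub>c\<^sup>\<infinity>(0,T)\<close> in \<open>H\<^sup>m(0,T)\<close>; for \<open>m = 0\<close> this is all of \<open>L\<^sup>2(0,T)\<close>, by density.\<close>

definition H0 :: "nat \<Rightarrow> real \<Rightarrow> (real \<Rightarrow> real) set" where
  "H0 m T = {u \<in> H_space m T. \<forall>e>0. \<exists>\<phi>\<in>test_fun T. H_norm m T (\<lambda>t. u t - \<phi> t) < e}"

definition H0_norm :: "nat \<Rightarrow> real \<Rightarrow> (real \<Rightarrow> real) \<Rightarrow> real" where
  "H0_norm m T u = L2_norm T (weak_deriv T m u)"


section \<open>The space of moments \<open>\<real>\<^sup>n \<times> h\<^sup>2\<^sup>m\<^sub>\<omega>\<^sub>,\<^sub>r(\<nat>,\<complex>)\<close>\<close>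

definition h_norm :: "nat \<Rightarrow> (nat \<Rightarrow> real) \<Rightarrow> (nat \<Rightarrow> complex) \<Rightarrow> real" where
  "h_norm m \<omega> d = sqrt (\<Sum>j. (cmod (of_real (of_bool (j = 0) + \<omega> j ^ m) * d j))\<^sup>2)"

text \<open>The index \<open>m\<close> stands for the superscript \<open>2m\<close>.\<close>

definition h_space :: "nat \<Rightarrow> (nat \<Rightarrow> real) \<Rightarrow> (nat \<Rightarrow> complex) set" where
  "h_space m \<omega> = {d. summable (\<lambda>j. (cmod (d j))\<^sup>2) \<and> d 0 \<in> \<real> \<and>
     summable (\<lambda>j. (cmod (of_real (of_bool (j = 0) + \<omega> j ^ m) * d j))\<^sup>2)}"

text \<open>
  A vector \<open>(a\<^sub>1, \<dots>, a\<^sub>n)\<close> of \<open>\<real>\<^sup>n\<close> is a function on the natural numbers that vanishes outside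
  \<open>{1..n}\<close>. In the pair \<open>(a, d)\<close>, the entry \<open>a q\<close> is the datum written \<open>d\<^bsub>-q\<^esub>\<close> in the literature.
\<close>

definition Rn :: "nat \<Rightarrow> (nat \<Rightarrow> real) set" where
  "Rn n = {a. \<forall>q. q \<notin> {1..n} \<longrightarrow> a q = 0}"

type_synonym moments = "(nat \<Rightarrow> real) \<times> (nat \<Rightarrow> complex)"

definition moment_space :: "nat \<Rightarrow> nat \<Rightarrow> (nat \<Rightarrow> real) \<Rightarrow> moments set" where
  "moment_space n m \<omega> = Rn n \<times> h_space m \<omega>"

definition moment_norm :: "nat \<Rightarrow> nat \<Rightarrow> (nat \<Rightarrow> real) \<Rightarrow> moments \<Rightarrow> real" where
  "moment_norm n m \<omega> x = sqrt ((\<Sum>q=1..n. (fst x q)\<^sup>2) + (h_norm m \<omega> (snd x))\<^sup>2)"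

definition moment_add :: "moments \<Rightarrow> moments \<Rightarrow> moments" where
  "moment_add x y = (\<lambda>q. fst x q + fst y q, \<lambda>j. snd x j + snd y j)"

definition moment_diff :: "moments \<Rightarrow> moments \<Rightarrow> moments" where
  "moment_diff x y = (\<lambda>q. fst x q - fst y q, \<lambda>j. snd x j - snd y j)"

definition moment_scale :: "real \<Rightarrow> moments \<Rightarrow> moments" where
  "moment_scale r x = (\<lambda>q. r * fst x q, \<lambda>j. of_real r * snd x j)"

definition omega_ext :: "(nat \<Rightarrow> real) \<Rightarrow> int \<Rightarrow> real" where
  "omega_ext \<omega> j = (if j < 0 then - \<omega> (nat (- j)) else \<omega> (nat j))"

text \<open>The single sequence \<open>(d\<^sub>j)\<close>, \<open>j \<ge> -n\<close>, made from both components.\<close>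

definition moment_seq :: "moments \<Rightarrow> int \<Rightarrow> complex" where
  "moment_seq x j = (if j < 0 then of_real (fst x (nat (- j))) else snd x (nat j))"


section \<open>Continuous linear maps into \<open>H\<^sup>k\<^sub>0((0,T),\<real>)\<close>\<close>

definition linear_H0 ::
    "nat \<Rightarrow> nat \<Rightarrow> (nat \<Rightarrow> real) \<Rightarrow> real \<Rightarrow> (moments \<Rightarrow> real \<Rightarrow> real) \<Rightarrow> bool" where
  "linear_H0 n k \<omega> T L \<longleftrightarrow>
     (\<forall>x\<in>moment_space n k \<omega>. L x \<in> H0 k T) \<and>
     (\<forall>x\<in>moment_space n k \<omega>. \<forall>y\<in>moment_space n k \<omega>.
        AE t in leb T. L (moment_add x y) t = L x t + L y t) \<and>
     (\<forall>r. \<forall>x\<in>moment_space n k \<omega>. AE t in leb T. L (moment_scale r x) t = r * L x t)"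

definition continuous_H0 ::
    "nat \<Rightarrow> nat \<Rightarrow> (nat \<Rightarrow> real) \<Rightarrow> real \<Rightarrow> (moments \<Rightarrow> real \<Rightarrow> real) \<Rightarrow> bool" where
  "continuous_H0 n k \<omega> T L \<longleftrightarrow>
     (\<forall>x\<in>moment_space n k \<omega>. \<forall>e>0. \<exists>\<delta>>0. \<forall>y\<in>moment_space n k \<omega>.
        moment_norm n k \<omega> (moment_diff y x) < \<delta> \<longrightarrow> H0_norm k T (\<lambda>t. L y t - L x t) < e)"

end

theory Submission
  imports Defs "HOL-Computational_Algebra.Polynomial"
begin

text \<open>
  Extend the frequencies to an odd family \<open>\<nu>\<^sub>j\<close>, \<open>j \<in> \<int>\<close>, and the data by complex conjugation. A real
  control with the required moments is the real part of a complex one with the extended moments.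

  Let \<open>\<chi>\<close> be a bump on \<open>(0,T)\<close> with integral \<open>1\<close>. The moment of \<open>\<chi>(t) exp(- \<i> \<nu>\<^sub>j t)\<close> at \<open>\<nu>\<^sub>l\<close> is the
  Fourier transform of \<open>\<chi>\<close> at \<open>\<nu>\<^sub>l - \<nu>\<^sub>j\<close>: it is \<open>1\<close> for \<open>l = j\<close>, and since the gaps of the frequencies
  tend to infinity, the other entries are small as soon as finitely many frequencies are discarded.
  So on the remaining high frequencies the matrix of moments is the identity plus a matrix that
  satisfies Schur's test with bound \<open>1/2\<close>, and a Neumann series solves the moment problem there
  (\<open>perturbed_identity_solvable\<close>). The same bound holds after conjugation with the weights
  \<open>(1 + \<bar>\<nu>\<^sub>j\<bar> / R)\<^sup>p\<close> when \<open>R\<close> is large (\<open>schur_half_gram_kernel\<close>), so the one solution is controlled in all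
  weighted spaces, that is, in all Sobolev norms. It is essential that only \<open>R\<close> depends on \<open>p\<close>, and the
  number of discarded frequencies does not.

  The low frequencies and the powers of \<open>t\<close> are decoupled from the high ones by differential operators.
  The operator \<open>d/dt + \<i>\<mu>\<close> multiplies the moment at \<open>z\<close> by \<open>\<i>(\<mu> - z)\<close>. Applying it once for each
  discarded frequency \<open>\<mu>\<close>, and \<open>n + 1\<close> times with \<open>\<mu> = 0\<close>, produces functions without low-frequency
  moments and without moments against \<open>1, t, \<dots>, t\<^sup>n\<close>. This costs as many derivatives as there are factors,
  but the moment at \<open>\<nu>\<^sub>j\<close> also gains that many powers of \<open>\<nu>\<^sub>j\<close>, and dividing by them compensates for the
  loss (\<open>gram_solver\<close>). Omitting suitable factors gives functions dual to the low moments
  (\<open>low_dual_family\<close>); what these contribute at the high frequencies decays fast and is subtracted from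
  the high-frequency data before solving (\<open>moment_sections\<close>).

  The resulting series has smooth partial sums with compact support in \<open>(0,T)\<close>. A Bessel inequality
  (\<open>bessel_family_shift_list\<close>) bounds their derivatives by weighted \<open>\<ell>\<^sup>2\<close> norms of the coefficients, so they
  form a Cauchy sequence in \<open>H\<^sup>k\<close>. By completeness of \<open>L\<^sup>2\<close> and uniqueness of weak derivatives, the limit
  lies in \<open>H\<^sup>k\<^sub>0\<close> and inherits the bounds (\<open>H0_limit\<close>); moments pass to the limit because they are integrals
  against bounded continuous functions. Since the coefficients depend linearly on the data, so does the
  limit, up to equality almost everywhere.
\<close>

section \<open>Jets and bump functions\<close>

text \<open>
  A smooth function together with all its derivatives: component \<open>m\<close> is the \<open>m\<close>-th derivative. Working
  with the whole sequence lets operators act on all derivatives at once, and it treats real and complex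
  values alike.
\<close>

definition jet :: "(nat \<Rightarrow> real \<Rightarrow> 'a::real_normed_vector) \<Rightarrow> bool" where
  "jet f \<longleftrightarrow> (\<forall>m t. (f m has_vector_derivative f (Suc m) t) (at t))"

lemma jetD: "jet f \<Longrightarrow> (f m has_vector_derivative f (Suc m) t) (at t)"
  by (simp add: jet_def)

lemma jet_continuous: "jet f \<Longrightarrow> continuous_on A (f m)"
  by (meson continuous_at_imp_continuous_on has_vector_derivative_continuous jetD)

lemma jet_deriv_funpow:
  fixes f :: "nat \<Rightarrow> real \<Rightarrow> real"
  assumes "jet f"
  shows "(deriv ^^ j) (f m) = f (m + j)"
proof (induction j)
  case (Suc j)
  have "deriv (f (m + j)) = f (Suc (m + j))"
    using jetD[OF assms, of "m + j"]
    by (intro ext DERIV_imp_deriv) (simp add: has_real_derivative_iff_has_vector_derivative)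
  then show ?case using Suc by simp
qed simp

text \<open>
  The \<open>m\<close>-th derivative of \<open>f\<^sub>r g\<^sub>s\<close>. Keeping the two shifts as arguments replaces the binomial
  coefficients of the Leibniz rule by the rule for a single derivative.
\<close>

primrec product_jet :: "(nat \<Rightarrow> real \<Rightarrow> 'a::real_normed_algebra) \<Rightarrow> (nat \<Rightarrow> real \<Rightarrow> 'a) \<Rightarrow>
    nat \<Rightarrow> nat \<Rightarrow> nat \<Rightarrow> real \<Rightarrow> 'a" where
  "product_jet f g 0 = (\<lambda>r s t. f r t * g s t)"
| "product_jet f g (Suc m) = (\<lambda>r s t. product_jet f g m (Suc r) s t + product_jet f g m r (Suc s) t)"

lemma jet_product:
  assumes "jet f" "jet g"
  shows "jet (\<lambda>m. product_jet f g m r s)"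
proof -
  have "(product_jet f g m r s has_vector_derivative product_jet f g (Suc m) r s t) (at t)" for m t
  proof (induction m arbitrary: r s)
    case 0
    show ?case
      using has_vector_derivative_mult[OF jetD[OF assms(1), of r t] jetD[OF assms(2), of s t]]
      by (simp add: add.commute)
  next
    case (Suc m)
    show ?case
      using has_vector_derivative_add[OF Suc[of "Suc r" s] Suc[of r "Suc s"]] by simp
  qed
  then show ?thesis by (simp add: jet_def)
qed

lemma product_jet_eq_0:
  assumes "(\<forall>m. f m t = 0) \<or> (\<forall>m. g m t = 0)"
  shows "product_jet f g m r s t = 0"
  using assms by (induction m arbitrary: r s) auto

lemma jet_affine:
  assumes "jet f"
  shows "jet (\<lambda>m t. \<alpha> ^ m *\<^sub>R f m (\<alpha> * t + \<beta>))"
  unfolding jet_def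
proof (intro allI)
  fix m t
  have "((\<lambda>t. \<alpha> * t + \<beta>) has_vector_derivative \<alpha>) (at t)"
    by (auto intro!: derivative_eq_intros)
  from vector_diff_chain_at[OF this jetD[OF assms, of m "\<alpha> * t + \<beta>"]]
  have "((\<lambda>t. f m (\<alpha> * t + \<beta>)) has_vector_derivative \<alpha> *\<^sub>R f (Suc m) (\<alpha> * t + \<beta>)) (at t)"
    by (simp add: o_def)
  from has_vector_derivative_scaleR[OF DERIV_const this, of "\<alpha> ^ m"]
  show "((\<lambda>t. \<alpha> ^ m *\<^sub>R f m (\<alpha> * t + \<beta>)) has_vector_derivative
      \<alpha> ^ Suc m *\<^sub>R f (Suc m) (\<alpha> * t + \<beta>)) (at t)"
    by (simp add: mult.commute)
qed

text \<open>
  The classical smooth function that is not analytic at \<open>0\<close>.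
\<close>

definition flat :: "real \<Rightarrow> real" where
  "flat x = (if x > 0 then exp (- (1 / x)) else 0)"

text \<open>
  For \<open>x > 0\<close> the \<open>m\<close>-th derivative of \<open>exp (- 1 / x)\<close> is \<open>p\<^sub>m(1 / x) exp (- 1 / x)\<close> with these
  polynomials \<open>p\<^sub>m\<close>.
\<close>

primrec flat_poly :: "nat \<Rightarrow> real poly" where
  "flat_poly 0 = 1"
| "flat_poly (Suc m) = [:0, 0, 1:] * (flat_poly m - pderiv (flat_poly m))"

text \<open>
  The additional power of \<open>y\<close> makes the induction on the polynomial go through, because a step
  replaces \<open>p\<close> by \<open>a + y p\<close>.
\<close>

lemma poly_div_exp_tendsto_0:
  fixes p :: "real poly"
  shows "((\<lambda>y. y ^ k * poly p y / exp y) \<longlongrightarrow> 0) at_top"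
proof (induction p arbitrary: k)
  case (pCons a p)
  have "((\<lambda>y. a * (y ^ k / exp y) + y ^ Suc k * poly p y / exp y) \<longlongrightarrow> a * 0 + 0) at_top"
    by (intro tendsto_intros pCons tendsto_power_div_exp_0)
  then show ?case
    by (rule filterlim_cong[THEN iffD1, rotated -1]) (auto simp: field_simps)
qed auto

text \<open>
  Away from the origin this is calculus; at the origin the difference quotient from the right is a
  polynomial in \<open>1 / x\<close> times \<open>exp (- 1 / x)\<close>, and the exponential wins.
\<close>

lemma jet_flat:
  obtains f where "jet f" "f 0 = flat" "\<And>m x. x \<le> 0 \<Longrightarrow> f m x = 0"
proof
  define f where "f m x = (if x > 0 then poly (flat_poly m) (1 / x) * exp (- (1 / x)) else 0)"
    for m :: nat and x :: real
  show "f 0 = flat" by (auto simp: f_def flat_def)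
  show "f m x = 0" if "x \<le> 0" for m x using that by (simp add: f_def)
  have "(f m has_real_derivative f (Suc m) t) (at t)" for m t
  proof -
    consider "t > 0" | "t < 0" | "t = 0" by linarith
    then show ?thesis
    proof cases
      case 1
      have "((\<lambda>x. poly (flat_poly m) (1 / x) * exp (- (1 / x))) has_real_derivative f (Suc m) t) (at t)"
        using 1 by (auto intro!: derivative_eq_intros DERIV_chain2[OF poly_DERIV]
            simp: f_def divide_simps power2_eq_square algebra_simps)
      then show ?thesis
        by (rule has_field_derivative_transform_within_open[where S="{0<..}"])
           (use 1 in \<open>auto simp: f_def\<close>)
    next
      case 2
      have "((\<lambda>x. 0) has_real_derivative f (Suc m) t) (at t)"
        using 2 by (simp add: f_def)
      then show ?thesis
        by (rule has_field_derivative_transform_within_open[where S="{..<0}"])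
           (use 2 in \<open>auto simp: f_def\<close>)
    next
      case 3
      have "((\<lambda>x. inverse x * poly (flat_poly m) (inverse x) / exp (inverse x)) \<longlongrightarrow> 0) (at_right 0)"
        using filterlim_compose[OF poly_div_exp_tendsto_0[of 1 "flat_poly m"]
            filterlim_inverse_at_top_right] by simp
      then have "((\<lambda>x. f m x / x) \<longlongrightarrow> 0) (at_right 0)"
        by (rule Lim_transform_eventually)
           (auto simp: f_def eventually_at_filter exp_minus divide_simps)
      moreover have "((\<lambda>x. f m x / x) \<longlongrightarrow> 0) (at_left 0)"
        by (rule Lim_transform_eventually[OF tendsto_const])
           (auto simp: f_def eventually_at_filter)
      ultimately have "((\<lambda>x. f m x / x) \<longlongrightarrow> 0) (at 0)"
        by (simp add: filterlim_at_split)
      then show ?thesis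
        using 3 by (simp add: has_field_derivative_iff f_def)
    qed
  qed
  then show "jet f"
    by (simp add: jet_def has_real_derivative_iff_has_vector_derivative)
qed

text \<open>
  The scale \<open>c\<close> sets the steepness of the two flanks. A fixed \<open>c\<close> gives a bump, and \<open>c \<rightarrow> 0\<close> gives smooth
  approximations of the indicator of an interval.
\<close>

lemma bump_jet:
  fixes a b c :: real
  assumes "c > 0"
  obtains X where "jet X" "\<And>t. X 0 t = flat ((t - a) / c) * flat ((b - t) / c)"
    "\<And>m t. t \<notin> {a..b} \<Longrightarrow> X m t = 0"
proof -
  obtain f where f: "jet f" "f 0 = flat" "\<And>m x. x \<le> 0 \<Longrightarrow> f m x = 0" by (rule jet_flat) blast
  define g where "g m t = (1 / c) ^ m *\<^sub>R f m (1 / c * t + (- a / c))" for m t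
  define h where "h m t = (- 1 / c) ^ m *\<^sub>R f m (- 1 / c * t + b / c)" for m t
  have g: "jet g" and h: "jet h"
    unfolding g_def h_def by (intro jet_affine f)+
  show ?thesis
  proof
    show "jet (\<lambda>m. product_jet g h m 0 0)" by (intro jet_product g h)
    show "product_jet g h 0 0 0 t = flat ((t - a) / c) * flat ((b - t) / c)" for t
      by (simp add: g_def h_def f(2) diff_divide_distrib)
    show "product_jet g h m 0 0 t = 0" if "t \<notin> {a..b}" for m t
    proof (rule product_jet_eq_0)
      from that have "t < a \<or> b < t" by auto
      then show "(\<forall>m. g m t = 0) \<or> (\<forall>m. h m t = 0)"
      proof
        assume "t < a"
        then have "1 / c * t + - a / c \<le> 0" using assms by (simp add: field_simps)
        then have "g m t = 0" for m unfolding g_def using f(3) by simp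
        then show ?thesis by blast
      next
        assume "b < t"
        then have "- 1 / c * t + b / c \<le> 0" using assms by (simp add: field_simps)
        then have "h m t = 0" for m unfolding h_def using f(3) by simp
        then show ?thesis by blast
      qed
    qed
  qed
qed

lemma flat_nonneg: "0 \<le> flat x" and flat_le_1: "flat x \<le> 1" and flat_pos: "0 < x \<Longrightarrow> 0 < flat x"
  by (auto simp: flat_def)

text \<open>
  The jets of the test functions on \<open>(0,T)\<close>. One interval \<open>[a,b]\<close> serves all derivatives.
\<close>

definition supported_jet :: "real \<Rightarrow> (nat \<Rightarrow> real \<Rightarrow> 'a::real_normed_vector) \<Rightarrow> bool" where
  "supported_jet T f \<longleftrightarrow> jet f \<and> (\<exists>a b. 0 < a \<and> b < T \<and> (\<forall>m t. t \<notin> {a..b} \<longrightarrow> f m t = 0))"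

lemma supported_jet_jet: "supported_jet T f \<Longrightarrow> jet f"
  by (simp add: supported_jet_def)

lemma supported_jet_eq_0: "supported_jet T f \<Longrightarrow> t \<notin> {0<..<T} \<Longrightarrow> f m t = 0"
  unfolding supported_jet_def by fastforce

lemma supported_jet_0: "T > 0 \<Longrightarrow> supported_jet T (\<lambda>m t. 0)"
  unfolding supported_jet_def jet_def
  by (auto intro!: exI[of _ "T/2"])

lemma supported_jet_map:
  assumes "supported_jet T f" "bounded_linear L"
  shows "supported_jet T (\<lambda>m t. L (f m t))"
  using assms bounded_linear.has_vector_derivative[OF assms(2)]
  unfolding supported_jet_def jet_def
  by (metis linear_0 bounded_linear.linear)

lemma supported_jet_add:
  assumes "supported_jet T f" "supported_jet T g"
  shows "supported_jet T (\<lambda>m t. f m t + g m t)"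
proof -
  obtain a b where f: "0 < a" "b < T" "\<forall>m t. t \<notin> {a..b} \<longrightarrow> f m t = 0"
    using assms(1) unfolding supported_jet_def by auto
  obtain c d where g: "0 < c" "d < T" "\<forall>m t. t \<notin> {c..d} \<longrightarrow> g m t = 0"
    using assms(2) unfolding supported_jet_def by auto
  have "jet (\<lambda>m t. f m t + g m t)"
    using assms unfolding supported_jet_def jet_def by (auto intro!: derivative_intros)
  moreover have "0 < min a c" "max b d < T" using f g by auto
  moreover have "\<forall>m t. t \<notin> {min a c..max b d} \<longrightarrow> f m t + g m t = 0"
  proof (intro allI impI)
    fix m t assume "t \<notin> {min a c..max b d}"
    then have "t \<notin> {a..b}" "t \<notin> {c..d}" by auto
    then show "f m t + g m t = 0" using f(3) g(3) by simp
  qed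
  ultimately show ?thesis unfolding supported_jet_def by blast
qed

lemma supported_jet_sum:
  assumes "T > 0" "\<And>i. i \<in> F \<Longrightarrow> supported_jet T (f i)"
  shows "supported_jet T (\<lambda>m t. \<Sum>i\<in>F. f i m t)"
  using assms(2)
  by (induction F rule: infinite_finite_induct) (auto intro!: supported_jet_add supported_jet_0 assms(1))

lemma supported_jet_mult_left:
  fixes f :: "nat \<Rightarrow> real \<Rightarrow> 'a::real_normed_algebra"
  shows "supported_jet T f \<Longrightarrow> supported_jet T (\<lambda>m t. c * f m t)"
  by (rule supported_jet_map[OF _ bounded_linear_mult_right])

lemma supported_jet_Suc: "supported_jet T f \<Longrightarrow> supported_jet T (\<lambda>m. f (Suc m))"
  unfolding supported_jet_def jet_def by blast

lemma supported_jet_test_fun: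
  fixes f :: "nat \<Rightarrow> real \<Rightarrow> real"
  assumes "supported_jet T f"
  shows "f m \<in> test_fun T"
proof -
  have j: "jet f" by (rule supported_jet_jet[OF assms])
  obtain a b where f: "0 < a" "b < T" "\<forall>m t. t \<notin> {a..b} \<longrightarrow> f m t = 0"
    using assms(1) unfolding supported_jet_def by auto
  have sub: "closure {x. f m x \<noteq> 0} \<subseteq> {a..b}"
    by (rule closure_minimal) (use f in blast, simp)
  have "(deriv ^^ j) (f m) differentiable (at x)" for j x
    unfolding jet_deriv_funpow[OF j]
    using jetD[OF j, of "m + j" x] by (auto simp: has_vector_derivative_def differentiable_def)
  moreover have "compact (closure {x. f m x \<noteq> 0})"
    unfolding compact_eq_bounded_closed
    using bounded_subset[OF bounded_closed_interval sub] by simp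
  ultimately show ?thesis
    unfolding test_fun_def using sub f(1,2) by fastforce
qed

text \<open>
  All derivatives vanish outside the closed support of \<open>\<phi>\<close>, because its complement is open; compactness
  of the support gives the interval.
\<close>

lemma test_fun_supported_jet:
  assumes T: "T > 0" and \<phi>: "\<phi> \<in> test_fun T"
  shows "supported_jet T (\<lambda>m. (deriv ^^ m) \<phi>)"
proof -
  let ?S = "closure {x. \<phi> x \<noteq> 0}"
  have d: "(deriv ^^ j) \<phi> differentiable (at x)" for j x using \<phi> by (auto simp: test_fun_def)
  have S: "compact ?S" "?S \<subseteq> {0<..<T}" using \<phi> by (auto simp: test_fun_def)
  have j: "jet (\<lambda>m. (deriv ^^ m) \<phi>)"
    unfolding jet_def
  proof (intro allI)
    fix m t
    have "(deriv ^^ m) \<phi> field_differentiable (at t)"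
      using d[of m t] by (simp add: field_differentiable_def real_differentiable_def)
    then show "((deriv ^^ m) \<phi> has_vector_derivative (deriv ^^ Suc m) \<phi> t) (at t)"
      by (simp add: DERIV_deriv_iff_field_differentiable
          flip: has_real_derivative_iff_has_vector_derivative)
  qed
  have z: "(deriv ^^ m) \<phi> x = 0" if "x \<notin> ?S" for m x
    using that
  proof (induction m arbitrary: x)
    case 0
    then show ?case using closure_subset[of "{x. \<phi> x \<noteq> 0}"] by auto
  next
    case (Suc m)
    have "((\<lambda>x. 0) has_real_derivative 0) (at x)" by simp
    then have "((deriv ^^ m) \<phi> has_real_derivative 0) (at x)"
      by (rule has_field_derivative_transform_within_open[where S="- ?S"])
         (use Suc in auto)
    then show ?case by (simp add: DERIV_imp_deriv)
  qed
  obtain a b where ab: "0 < a" "b < T" "?S \<subseteq> {a..b}"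
  proof (cases "?S = {}")
    case True
    then show ?thesis using that[of "T/2" "T/2"] T by auto
  next
    case False
    obtain a where a: "a \<in> ?S" "\<forall>x\<in>?S. a \<le> x" using compact_attains_inf[OF S(1) False] by auto
    obtain b where b: "b \<in> ?S" "\<forall>x\<in>?S. x \<le> b" using compact_attains_sup[OF S(1) False] by auto
    have "a \<in> {0<..<T}" "b \<in> {0<..<T}" using a b S(2) by blast+
    moreover have "?S \<subseteq> {a..b}" using a(2) b(2) by (intro subsetI) simp
    ultimately
    show ?thesis using that[of a b] by simp
  qed
  then show ?thesis unfolding supported_jet_def using j z by blast
qed

section \<open>Integration on \<open>(0,T)\<close>\<close>

lemma integrable_leb_continuous:
  fixes f :: "real \<Rightarrow> 'b::euclidean_space"
  assumes "continuous_on UNIV f"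
  shows "integrable (leb T) f"
proof (rule absolutely_integrable_imp_integrable)
  have "f absolutely_integrable_on {0..T}"
    by (intro absolutely_integrable_continuous_real continuous_on_subset[OF assms]) auto
  then show "f absolutely_integrable_on {0<..<T}"
    by (rule set_integrable_subset) auto
qed auto

lemma integral_leb_derivative:
  fixes F :: "real \<Rightarrow> 'b::euclidean_space"
  assumes "T > 0" and d: "\<And>t. (F has_vector_derivative f t) (at t)" and "continuous_on UNIV f"
    and "F 0 = 0" "F T = 0"
  shows "(\<integral>t. f t \<partial>leb T) = 0"
proof -
  have "(\<integral>t. f t \<partial>leb T) = integral {0<..<T} f"
    by (rule lebesgue_integral_eq_integral) (auto intro: integrable_leb_continuous assms)
  also have "\<dots> = integral {0..T} f"
    by (simp add: integral_open_interval_real)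
  also have "(f has_integral (F T - F 0)) {0..T}"
    by (rule fundamental_theorem_of_calculus)
       (use assms(1) has_vector_derivative_at_within[OF d] in auto)
  then have "integral {0..T} f = 0" using assms by (simp add: integral_unique)
  finally show ?thesis .
qed

text \<open>
  There are no boundary terms because \<open>f\<close> vanishes near the ends; \<open>g\<close> is an exponential, a power of \<open>t\<close>
  or a derivative of a test function in the applications.
\<close>

lemma integral_by_parts:
  fixes f :: "nat \<Rightarrow> real \<Rightarrow> 'b::{euclidean_space, real_normed_algebra}"
  assumes "T > 0" "supported_jet T f" and d: "\<And>t. (g has_vector_derivative g' t) (at t)"
    and c: "continuous_on UNIV g'"
  shows "(\<integral>t. f (Suc m) t * g t \<partial>leb T) = - (\<integral>t. f m t * g' t \<partial>leb T)"
proof -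
  note j = supported_jet_jet[OF assms(2)]
  have g: "continuous_on UNIV g"
    by (meson d continuous_at_imp_continuous_on has_vector_derivative_continuous)
  have "(\<integral>t. (f m t * g' t + f (Suc m) t * g t) \<partial>leb T) = 0"
    by (rule integral_leb_derivative[where F="\<lambda>t. f m t * g t"])
       (use assms(1) has_vector_derivative_mult[OF jetD[OF j] d] in
        \<open>auto intro!: continuous_intros c g jet_continuous[OF j] simp: supported_jet_eq_0[OF assms(2)]\<close>)
  moreover have "integrable (leb T) (\<lambda>t. f m t * g' t)" "integrable (leb T) (\<lambda>t. f (Suc m) t * g t)"
    by (auto intro!: integrable_leb_continuous continuous_intros c g jet_continuous[OF j])
  ultimately show ?thesis by (simp add: add_eq_0_iff2)
qed

lemma integral_by_parts_funpow:
  fixes f g :: "nat \<Rightarrow> real \<Rightarrow> 'b::{euclidean_space, real_normed_algebra_1}"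
  assumes "T > 0" "supported_jet T f" "jet g"
  shows "(\<integral>t. f m t * g (n + j) t \<partial>leb T) = (- 1) ^ j * (\<integral>t. f (m + j) t * g n t \<partial>leb T)"
proof (induction j arbitrary: n)
  case (Suc j)
  have "(\<integral>t. f (Suc (m + j)) t * g n t \<partial>leb T) = - (\<integral>t. f (m + j) t * g (Suc n) t \<partial>leb T)"
    using assms by (intro integral_by_parts) (auto intro: jetD jet_continuous)
  with Suc[of "Suc n"] show ?case by simp
qed simp

section \<open>Square integrable functions\<close>

text \<open>
  The square of the \<open>L\<^sup>2\<close> norm. Estimates of sums use \<open>(a + b)\<^sup>2 \<le> 2 a\<^sup>2 + 2 b\<^sup>2\<close> instead of Minkowski's
  inequality, which affects only constants.
\<close>

definition sq_norm :: "real \<Rightarrow> (real \<Rightarrow> 'a::real_normed_vector) \<Rightarrow> real" where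
  "sq_norm T u = (\<integral>t. (norm (u t))\<^sup>2 \<partial>leb T)"

lemma L2_norm_sq_norm: "L2_norm T u = sqrt (sq_norm T u)"
  by (simp add: L2_norm_def sq_norm_def)

lemma sq_norm_nonneg: "0 \<le> sq_norm T u"
  by (simp add: sq_norm_def)

lemma finite_measure_leb: "finite_measure (leb T)"
  by (rule finite_measure_lebesgue_on) auto

lemma measure_leb: "T \<ge> 0 \<Longrightarrow> measure (leb T) {0<..<T} = T"
  by (simp add: measure_restrict_space)

lemma integrable_sum_squares_bound:
  fixes u v :: "'a \<Rightarrow> real"
  assumes [measurable]: "u \<in> borel_measurable M" "v \<in> borel_measurable M"
    and "integrable M (\<lambda>t. (u t)\<^sup>2)" "integrable M (\<lambda>t. (v t)\<^sup>2)"
  shows "integrable M (\<lambda>t. (u t + v t)\<^sup>2)"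
proof (rule Bochner_Integration.integrable_bound)
  show "integrable M (\<lambda>t. 2 * (u t)\<^sup>2 + 2 * (v t)\<^sup>2)" using assms by auto
  show "AE x in M. norm ((u x + v x)\<^sup>2) \<le> norm (2 * (u x)\<^sup>2 + 2 * (v x)\<^sup>2)"
  proof (rule AE_I2)
    fix x
    have "0 \<le> (u x - v x)\<^sup>2" by simp
    then have "(u x + v x)\<^sup>2 \<le> 2 * (u x)\<^sup>2 + 2 * (v x)\<^sup>2"
      by (simp add: power2_eq_square algebra_simps)
    then show "norm ((u x + v x)\<^sup>2) \<le> norm (2 * (u x)\<^sup>2 + 2 * (v x)\<^sup>2)"
      by simp
  qed
qed measurable

lemma L2_space_add: "u \<in> L2_space T \<Longrightarrow> v \<in> L2_space T \<Longrightarrow> (\<lambda>t. u t + v t) \<in> L2_space T"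
  by (auto simp: L2_space_def intro: integrable_sum_squares_bound)

lemma L2_space_scale: "u \<in> L2_space T \<Longrightarrow> (\<lambda>t. c * u t) \<in> L2_space T"
  by (auto simp: L2_space_def power_mult_distrib)

lemma L2_space_diff: "u \<in> L2_space T \<Longrightarrow> v \<in> L2_space T \<Longrightarrow> (\<lambda>t. u t - v t) \<in> L2_space T"
  using L2_space_add[of u T "\<lambda>t. - 1 * v t"] L2_space_scale[of v T "-1"] by simp

lemma L2_space_integrable: "u \<in> L2_space T \<Longrightarrow> integrable (leb T) u"
  unfolding L2_space_def
  by (auto intro: finite_measure.square_integrable_imp_integrable[OF finite_measure_leb])

lemma L2_space_measurable: "u \<in> L2_space T \<Longrightarrow> u \<in> borel_measurable (leb T)"
  by (simp add: L2_space_def)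

lemma L2_space_mult_integrable:
  assumes "u \<in> L2_space T" "v \<in> L2_space T"
  shows "integrable (leb T) (\<lambda>t. u t * v t)"
proof (rule Bochner_Integration.integrable_bound)
  show "integrable (leb T) (\<lambda>t. (u t)\<^sup>2 + (v t)\<^sup>2)" using assms by (simp add: L2_space_def)
  show "(\<lambda>t. u t * v t) \<in> borel_measurable (leb T)"
    using assms by (intro borel_measurable_times) (simp_all add: L2_space_def)
  have "\<bar>x * y\<bar> \<le> x\<^sup>2 + y\<^sup>2" for x y :: real
  proof -
    have "2 * \<bar>x * y\<bar> \<le> x\<^sup>2 + y\<^sup>2"
      using zero_le_power2[of "\<bar>x\<bar> - \<bar>y\<bar>"] by (simp add: power2_diff abs_mult)
    then show ?thesis using abs_ge_zero[of "x * y"] by linarith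
  qed
  then show "AE t in leb T. norm (u t * v t) \<le> norm ((u t)\<^sup>2 + (v t)\<^sup>2)" by simp
qed

lemma L2_space_sq_integrable: "u \<in> L2_space T \<Longrightarrow> integrable (leb T) (\<lambda>t. (norm (u t))\<^sup>2)"
  by (simp add: L2_space_def)

lemma L2_space_continuous:
  assumes "continuous_on UNIV u"
  shows "u \<in> L2_space T"
  unfolding L2_space_def
  using integrable_leb_continuous[OF assms, of T]
  by (auto intro!: integrable_leb_continuous continuous_intros assms)

lemma norm_add_sq: "(norm (x + y :: 'a::real_normed_vector))\<^sup>2 \<le> 2 * (norm x)\<^sup>2 + 2 * (norm y)\<^sup>2"
proof -
  have "(norm (x + y))\<^sup>2 \<le> (norm x + norm y)\<^sup>2" by (intro power_mono norm_triangle_ineq) auto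
  also have "\<dots> \<le> 2 * (norm x)\<^sup>2 + 2 * (norm y)\<^sup>2"
    using zero_le_power2[of "norm x - norm y"] by (simp add: power2_eq_square algebra_simps)
  finally show ?thesis .
qed

lemma sq_norm_add:
  assumes "u \<in> L2_space T" "v \<in> L2_space T"
  shows "sq_norm T (\<lambda>t. u t + v t) \<le> 2 * sq_norm T u + 2 * sq_norm T v"
proof -
  have "sq_norm T (\<lambda>t. u t + v t) \<le> (\<integral>t. (2 * (norm (u t))\<^sup>2 + 2 * (norm (v t))\<^sup>2) \<partial>leb T)"
    unfolding sq_norm_def
    by (intro integral_mono norm_add_sq)
       (use assms L2_space_add[OF assms] in \<open>auto simp: L2_space_def\<close>)
  also have "\<dots> = 2 * sq_norm T u + 2 * sq_norm T v"
    using assms by (simp add: sq_norm_def L2_space_def)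
  finally show ?thesis .
qed

lemma sq_norm_minus_commute: "sq_norm T (\<lambda>t. u t - v t) = sq_norm T (\<lambda>t. v t - u t)"
  by (simp add: sq_norm_def norm_minus_commute)

lemma sq_norm_diff_triangle:
  assumes "u \<in> L2_space T" "v \<in> L2_space T" "w \<in> L2_space T"
  shows "sq_norm T (\<lambda>t. u t - w t) \<le> 2 * sq_norm T (\<lambda>t. u t - v t) + 2 * sq_norm T (\<lambda>t. v t - w t)"
  using sq_norm_add[OF L2_space_diff[OF assms(1,2)] L2_space_diff[OF assms(2,3)]] by simp

text \<open>
  Cauchy-Schwarz against the constant \<open>1\<close>: if \<open>c\<close> is the mean of \<open>\<bar>u\<bar>\<close>, then the integral of
  \<open>(\<bar>u\<bar> - c)\<^sup>2\<close> is nonnegative.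
\<close>

lemma integral_abs_le_sq_norm:
  assumes "T > 0" "u \<in> L2_space T"
  shows "(\<integral>t. \<bar>u t\<bar> \<partial>leb T)\<^sup>2 \<le> T * sq_norm T u"
proof -
  define c where "c = (\<integral>t. \<bar>u t\<bar> \<partial>leb T) / T"
  have i: "integrable (leb T) (\<lambda>t. \<bar>u t\<bar>)" using L2_space_integrable[OF assms(2)] by simp
  have k: "integrable (leb T) (\<lambda>t. c\<^sup>2)" by (rule integrable_leb_continuous) simp
  have "0 \<le> (\<integral>t. (\<bar>u t\<bar> - c)\<^sup>2 \<partial>leb T)" by simp
  also have "\<dots> = (\<integral>t. ((norm (u t))\<^sup>2 - 2 * c * \<bar>u t\<bar>) + c\<^sup>2 \<partial>leb T)"
    by (simp add: power2_diff algebra_simps)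
  also have "\<dots> = (\<integral>t. ((norm (u t))\<^sup>2 - 2 * c * \<bar>u t\<bar>) \<partial>leb T) + (\<integral>t. c\<^sup>2 \<partial>leb T)"
    by (intro Bochner_Integration.integral_add Bochner_Integration.integrable_diff
        L2_space_sq_integrable assms integrable_mult_right i k)
  also have "(\<integral>t. ((norm (u t))\<^sup>2 - 2 * c * \<bar>u t\<bar>) \<partial>leb T)
      = sq_norm T u - 2 * c * (\<integral>t. \<bar>u t\<bar> \<partial>leb T)"
    unfolding sq_norm_def
    by (subst Bochner_Integration.integral_diff)
       (auto intro!: L2_space_sq_integrable assms integrable_mult_right i simp del: real_norm_def)
  also have "(\<integral>t. c\<^sup>2 \<partial>leb T) = c\<^sup>2 * T"
    using assms by (simp add: measure_leb)
  finally have "0 \<le> sq_norm T u - 2 * c * (c * T) + c\<^sup>2 * T"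
    using assms(1) by (simp add: c_def)
  then have "c\<^sup>2 * T \<le> sq_norm T u" by (simp add: power2_eq_square algebra_simps)
  then have "T * (c\<^sup>2 * T) \<le> T * sq_norm T u" using assms(1) by simp
  then show ?thesis using assms(1) by (simp add: c_def power2_eq_square field_simps)
qed

text \<open>
  Moments, and both sides of the identity that defines a weak derivative, are integrals against fixed
  continuous functions, so they pass to \<open>L\<^sup>2\<close> limits.
\<close>

lemma integral_L2_tendsto:
  fixes f :: "real \<Rightarrow> 'b::euclidean_space"
  assumes "T > 0" "\<And>n. s n \<in> L2_space T" "u \<in> L2_space T" "continuous_on UNIV f"
    and lim: "(\<lambda>n. sq_norm T (\<lambda>t. s n t - u t)) \<longlonglongrightarrow> 0"
  shows "(\<lambda>n. \<integral>t. s n t *\<^sub>R f t \<partial>leb T) \<longlonglongrightarrow> (\<integral>t. u t *\<^sub>R f t \<partial>leb T)"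
proof -
  obtain B where B: "B > 0" "\<And>t. t \<in> {0..T} \<Longrightarrow> norm (f t) \<le> B"
  proof -
    have "compact (f ` {0..T})"
      by (intro compact_continuous_image continuous_on_subset[OF assms(4)]) auto
    then obtain B where "B > 0" "\<forall>x\<in>f ` {0..T}. norm x \<le> B"
      by (meson bounded_pos compact_imp_bounded)
    then show ?thesis using that[of B] by simp
  qed
  have fm: "f \<in> borel_measurable (leb T)"
    by (rule borel_measurable_integrable[OF integrable_leb_continuous[OF assms(4)]])
  have int: "integrable (leb T) (\<lambda>t. w t *\<^sub>R f t)" if w: "w \<in> L2_space T" for w
  proof (rule Bochner_Integration.integrable_bound)
    show "integrable (leb T) (\<lambda>t. B * w t)" using L2_space_integrable[OF w] by simp
    show "(\<lambda>t. w t *\<^sub>R f t) \<in> borel_measurable (leb T)"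
      by (intro borel_measurable_scaleR L2_space_measurable w fm)
    show "AE t in leb T. norm (w t *\<^sub>R f t) \<le> norm (B * w t)"
    proof (rule AE_I2)
      fix t assume "t \<in> space (leb T)"
      then have "\<bar>w t\<bar> * norm (f t) \<le> \<bar>w t\<bar> * B" using B(2)[of t] by (intro mult_left_mono) auto
      then show "norm (w t *\<^sub>R f t) \<le> norm (B * w t)" using B(1) by (simp add: abs_mult mult.commute)
    qed
  qed
  have bound: "norm (\<integral>t. w t *\<^sub>R f t \<partial>leb T) \<le> B * sqrt (T * sq_norm T w)"
    if w: "w \<in> L2_space T" for w
  proof -
    have "norm (\<integral>t. w t *\<^sub>R f t \<partial>leb T) \<le> (\<integral>t. norm (w t *\<^sub>R f t) \<partial>leb T)"
      by (rule integral_norm_bound)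
    also have "\<dots> \<le> (\<integral>t. B * \<bar>w t\<bar> \<partial>leb T)"
    proof (rule integral_mono)
      show "integrable (leb T) (\<lambda>t. norm (w t *\<^sub>R f t))" by (intro integrable_norm int w)
      show "integrable (leb T) (\<lambda>t. B * \<bar>w t\<bar>)"
        by (intro integrable_mult_right integrable_abs L2_space_integrable w)
      fix t assume "t \<in> space (leb T)"
      then have "\<bar>w t\<bar> * norm (f t) \<le> \<bar>w t\<bar> * B" using B(2)[of t] by (intro mult_left_mono) auto
      then show "norm (w t *\<^sub>R f t) \<le> B * \<bar>w t\<bar>" by (simp add: mult.commute)
    qed
    also have "\<dots> = B * (\<integral>t. \<bar>w t\<bar> \<partial>leb T)" by simp
    also have "\<dots> \<le> B * sqrt (T * sq_norm T w)"
      by (rule mult_left_mono[OF real_le_rsqrt[OF integral_abs_le_sq_norm[OF assms(1) w]]])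
         (use B in simp)
    finally show ?thesis .
  qed
  have "(\<lambda>n. B * sqrt (T * sq_norm T (\<lambda>t. s n t - u t))) \<longlonglongrightarrow> B * sqrt (T * 0)"
    by (intro tendsto_intros lim)
  then have lim0: "(\<lambda>n. B * sqrt (T * sq_norm T (\<lambda>t. s n t - u t))) \<longlonglongrightarrow> 0" by simp
  have "norm ((\<integral>t. s n t *\<^sub>R f t \<partial>leb T) - (\<integral>t. u t *\<^sub>R f t \<partial>leb T))
        \<le> B * sqrt (T * sq_norm T (\<lambda>t. s n t - u t))" for n
    using bound[OF L2_space_diff[OF assms(2)[of n] assms(3)]]
    unfolding scaleR_diff_left Bochner_Integration.integral_diff[OF int[OF assms(2)] int[OF assms(3)]] .
  then have "(\<lambda>n. (\<integral>t. s n t *\<^sub>R f t \<partial>leb T) - (\<integral>t. u t *\<^sub>R f t \<partial>leb T)) \<longlonglongrightarrow> 0"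
    by (rule Lim_null_comparison[OF always_eventually[OF allI] lim0])
  then show ?thesis by (rule LIM_zero_cancel)
qed

lemma sq_norm_limit_unique:
  assumes "\<And>n. s n \<in> L2_space T" "u \<in> L2_space T" "v \<in> L2_space T"
    and "(\<lambda>n. sq_norm T (\<lambda>t. s n t - u t)) \<longlonglongrightarrow> 0"
    and "(\<lambda>n. sq_norm T (\<lambda>t. s n t - v t)) \<longlonglongrightarrow> 0"
  shows "AE t in leb T. u t = v t"
proof -
  have "(\<lambda>n. 2 * sq_norm T (\<lambda>t. s n t - u t) + 2 * sq_norm T (\<lambda>t. s n t - v t)) \<longlonglongrightarrow> 2 * 0 + 2 * 0"
    by (intro tendsto_intros assms)
  then have "sq_norm T (\<lambda>t. u t - v t) \<le> 2 * 0 + 2 * 0"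
    using sq_norm_diff_triangle[OF assms(2,1,3)]
    by (intro LIMSEQ_le_const) (auto simp: sq_norm_minus_commute[of T u])
  then have "(\<integral>t. (norm (u t - v t))\<^sup>2 \<partial>leb T) = 0"
    using sq_norm_nonneg[of T "\<lambda>t. u t - v t"] unfolding sq_norm_def by linarith
  then show ?thesis
    by (subst (asm) integral_nonneg_eq_0_iff_AE)
       (use L2_space_sq_integrable[OF L2_space_diff[OF assms(2,3)]] in auto)
qed

text \<open>
  Along a subsequence whose increments \<open>d\<^sub>i\<close> have squared norm below \<open>4\<^sup>-\<^sup>i\<close>, the series of the
  \<open>2\<^sup>i d\<^sub>i\<^sup>2\<close> is integrable, hence finite almost everywhere. As \<open>\<bar>d\<^sub>i\<bar> \<le> 2\<^sup>-\<^sup>i + 2\<^sup>i d\<^sub>i\<^sup>2\<close>, the subsequence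
  converges almost everywhere, and Fatou's lemma shows that its pointwise limit is an \<open>L\<^sup>2\<close> limit.
\<close>

lemma L2_complete:
  fixes s :: "nat \<Rightarrow> real \<Rightarrow> real"
  assumes s: "\<And>n. s n \<in> L2_space T"
    and cauchy: "\<And>e. e > 0 \<Longrightarrow> \<exists>M. \<forall>m\<ge>M. \<forall>n\<ge>M. sq_norm T (\<lambda>t. s m t - s n t) < e"
  obtains u where "u \<in> L2_space T" "(\<lambda>n. sq_norm T (\<lambda>t. s n t - u t)) \<longlonglongrightarrow> 0"
proof -
  note [measurable] = L2_space_measurable[OF s]
  have "\<forall>i. \<exists>M. \<forall>m\<ge>M. \<forall>n\<ge>M. sq_norm T (\<lambda>t. s m t - s n t) < 1 / 4 ^ i"
    using cauchy by simp
  then obtain R where R: "\<And>i m n. m \<ge> R i \<Longrightarrow> n \<ge> R i \<Longrightarrow> sq_norm T (\<lambda>t. s m t - s n t) < 1 / 4 ^ i"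
    by metis
  \<comment> \<open>Adding up the thresholds makes \<open>r\<close> increase past each of them, also at the next index.\<close>
  define r where "r i = i + (\<Sum>j\<le>i. R j)" for i
  have rR: "r i \<ge> R i" and rS: "r (Suc i) \<ge> R i" and ri: "r i \<ge> i" for i
    unfolding r_def using member_le_sum[of i "{..i}" R] member_le_sum[of i "{..Suc i}" R] by auto
  define d where "d i t = s (r (Suc i)) t - s (r i) t" for i t
  have [measurable]: "d i \<in> borel_measurable (leb T)" for i unfolding d_def by measurable
  have dL: "d i \<in> L2_space T" for i unfolding d_def by (intro L2_space_diff s)
  have "(\<integral>\<^sup>+t. (\<Sum>i. ennreal (2 ^ i * (d i t)\<^sup>2)) \<partial>leb T) = (\<Sum>i. \<integral>\<^sup>+t. ennreal (2 ^ i * (d i t)\<^sup>2) \<partial>leb T)"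
    by (rule nn_integral_suminf) measurable
  also have "\<dots> \<le> (\<Sum>i. ennreal ((1 / 2) ^ i))"
  proof (intro suminf_le summableI)
    fix i
    have "(\<integral>\<^sup>+t. ennreal (2 ^ i * (d i t)\<^sup>2) \<partial>leb T) = ennreal (2 ^ i * sq_norm T (d i))"
      using dL[of i] by (subst nn_integral_eq_integral) (auto simp: L2_space_def sq_norm_def)
    also have "\<dots> \<le> ennreal (2 ^ i * (1 / 4 ^ i))"
      using R[OF rS rR, of i] unfolding d_def[abs_def]
      by (intro ennreal_leI mult_left_mono) auto
    also have "(2 ^ i * (1 / 4 ^ i)) = (1 / 2 :: real) ^ i"
      using power_mult_distrib[of "2::real" 2 i] by (simp add: power_divide)
    finally show "(\<integral>\<^sup>+t. ennreal (2 ^ i * (d i t)\<^sup>2) \<partial>leb T) \<le> ennreal ((1 / 2) ^ i)" .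
  qed
  also have "\<dots> < \<infinity>"
    by (subst suminf_ennreal2) (auto simp: summable_geometric)
  finally have "AE t in leb T. (\<Sum>i. ennreal (2 ^ i * (d i t)\<^sup>2)) \<noteq> \<infinity>"
    by (intro nn_integral_noteq_infinite) auto
  then have conv: "AE t in leb T. convergent (\<lambda>i. s (r i) t)"
  proof eventually_elim
    case (elim t)
    have sm: "summable (\<lambda>i. 2 ^ i * (d i t)\<^sup>2)"
      by (rule summable_suminf_not_top) (use elim in auto)
    have "summable (\<lambda>i. d i t)"
    proof (rule summable_comparison_test)
      show "summable (\<lambda>i. (1 / 2) ^ i + 2 ^ i * (d i t)\<^sup>2)"
        by (intro summable_add sm summable_geometric) auto
      have "norm (d i t) \<le> (1 / 2) ^ i + 2 ^ i * (d i t)\<^sup>2" for i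
      proof -
        have "0 \<le> (1 / 2) ^ i * (1 - 2 ^ i * \<bar>d i t\<bar>)\<^sup>2" by simp
        also have "\<dots> = (1 / 2) ^ i - 2 * \<bar>d i t\<bar> + 2 ^ i * (d i t)\<^sup>2"
          by (simp add: power2_eq_square algebra_simps power_one_over)
        finally show ?thesis by simp
      qed
      then show "\<exists>N. \<forall>i\<ge>N. norm (d i t) \<le> (1 / 2) ^ i + 2 ^ i * (d i t)\<^sup>2" by blast
    qed
    then have "convergent (\<lambda>n. \<Sum>i<n. d i t)" by (simp add: summable_iff_convergent)
    moreover have "(\<Sum>i<n. d i t) = s (r n) t - s (r 0) t" for n
      unfolding d_def by (rule sum_lessThan_telescope)
    ultimately have "convergent (\<lambda>n. s (r n) t - s (r 0) t)" by simp
    from convergent_add[OF this convergent_const[of "s (r 0) t"]] show ?case by simp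
  qed
  define u where "u t = lim (\<lambda>i. s (r i) t)" for t
  have [measurable]: "u \<in> borel_measurable (leb T)" unfolding u_def by measurable
  have lim: "AE t in leb T. (\<lambda>i. s (r i) t) \<longlonglongrightarrow> u t"
    using conv unfolding u_def by eventually_elim (simp add: convergent_LIMSEQ_iff)
  \<comment> \<open>The limit in \<open>i\<close> of the distance between \<open>s n\<close> and \<open>s (r i)\<close>.\<close>
  have fatou: "(\<integral>\<^sup>+t. ennreal ((s n t - u t)\<^sup>2) \<partial>leb T) \<le> ennreal (1 / 4 ^ j)" if "n \<ge> R j" for n j
  proof -
    have "AE t in leb T. ennreal ((s n t - u t)\<^sup>2) = liminf (\<lambda>i. ennreal ((s n t - s (r i) t)\<^sup>2))"
      using lim
    proof eventually_elim
      case (elim t)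
      have "(\<lambda>i. ennreal ((s n t - s (r i) t)\<^sup>2)) \<longlonglongrightarrow> ennreal ((s n t - u t)\<^sup>2)"
        by (intro tendsto_ennrealI tendsto_intros elim)
      then show ?case by (rule lim_imp_Liminf[OF sequentially_bot, symmetric])
    qed
    then have "(\<integral>\<^sup>+t. ennreal ((s n t - u t)\<^sup>2) \<partial>leb T)
        = (\<integral>\<^sup>+t. liminf (\<lambda>i. ennreal ((s n t - s (r i) t)\<^sup>2)) \<partial>leb T)"
      by (rule nn_integral_cong_AE)
    also have "\<dots> \<le> liminf (\<lambda>i. \<integral>\<^sup>+t. ennreal ((s n t - s (r i) t)\<^sup>2) \<partial>leb T)"
      by (rule nn_integral_liminf) measurable
    also have "\<dots> \<le> ennreal (1 / 4 ^ j)"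
    proof (rule Liminf_le, simp)
      show "\<forall>\<^sub>F i in sequentially. (\<integral>\<^sup>+t. ennreal ((s n t - s (r i) t)\<^sup>2) \<partial>leb T) \<le> ennreal (1 / 4 ^ j)"
        using eventually_ge_at_top[of "R j"]
      proof eventually_elim
        case (elim i)
        then have "r i \<ge> R j" using ri[of i] by simp
        then show ?case
          using L2_space_diff[OF s s, of n "r i"] R[OF that, of "r i"]
          by (subst nn_integral_eq_integral) (auto simp: L2_space_def sq_norm_def)
      qed
    qed
    finally show ?thesis .
  qed
  have diffL: "(\<lambda>t. s n t - u t) \<in> L2_space T" if "n \<ge> R j" for n j
    unfolding L2_space_def
    using le_less_trans[OF fatou[OF that] ennreal_less_top] by (simp add: integrable_iff_bounded)
  have uL: "u \<in> L2_space T"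
    using L2_space_diff[OF s diffL[of 0 "R 0"], of "R 0"] by simp
  have le: "sq_norm T (\<lambda>t. s n t - u t) \<le> 1 / 4 ^ j" if "n \<ge> R j" for n j
  proof -
    have "ennreal (sq_norm T (\<lambda>t. s n t - u t)) = (\<integral>\<^sup>+t. ennreal ((s n t - u t)\<^sup>2) \<partial>leb T)"
      using L2_space_diff[OF s uL, of n]
      by (subst nn_integral_eq_integral) (auto simp: L2_space_def sq_norm_def)
    then have "ennreal (sq_norm T (\<lambda>t. s n t - u t)) \<le> ennreal (1 / 4 ^ j)"
      using fatou[OF that] by simp
    then show ?thesis by (subst (asm) ennreal_le_iff) auto
  qed
  have "(\<lambda>n. sq_norm T (\<lambda>t. s n t - u t)) \<longlonglongrightarrow> 0"
  proof (rule LIMSEQ_I)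
    fix e :: real assume "e > 0"
    then obtain j where "(1 / 4) ^ j < e" using real_arch_pow_inv[of e "1/4"] by auto
    then have "norm (sq_norm T (\<lambda>t. s n t - u t) - 0) < e" if "n \<ge> R j" for n
      using le[OF that] sq_norm_nonneg[of T "\<lambda>t. s n t - u t"] by (simp add: power_one_over)
    then show "\<exists>M. \<forall>n\<ge>M. norm (sq_norm T (\<lambda>t. s n t - u t) - 0) < e" by blast
  qed
  with uL show thesis by (rule that)
qed

section \<open>Weak derivatives and \<open>H\<^sup>k\<^sub>0\<close>\<close>

lemma flat_tendsto_1: "(flat \<longlongrightarrow> 1) at_top"
proof -
  have "((\<lambda>x::real. exp (- (1 / x))) \<longlongrightarrow> exp (- 0)) at_top"
    by (intro tendsto_intros tendsto_divide_0[OF tendsto_const filterlim_at_top_imp_at_infinity]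
        filterlim_ident)
  moreover have "\<forall>\<^sub>F x in at_top. exp (- (1 / x)) = flat x"
    using eventually_gt_at_top[of 0] by eventually_elim (simp add: flat_def)
  ultimately show ?thesis by (simp add: Lim_transform_eventually)
qed

lemma sets_lebI: "A \<in> sets lebesgue \<Longrightarrow> A \<subseteq> {0<..<T} \<Longrightarrow> A \<in> sets (leb T)"
  by (simp add: sets_restrict_space_iff)

text \<open>
  Steep bumps supported in \<open>[a + 1/(n+1), b - 1/(n+1)]\<close> are test functions even if \<open>a = 0\<close> or \<open>b = T\<close>.
  They stay between \<open>0\<close> and \<open>1\<close> and converge to the indicator of \<open>(a,b)\<close>, so dominated convergence
  applies.
\<close>

lemma integral_interval_eq_0:
  assumes T: "T > 0" and w: "w \<in> L2_space T"
    and 0: "\<And>\<phi>. \<phi> \<in> test_fun T \<Longrightarrow> (\<integral>t. w t * \<phi> t \<partial>leb T) = 0"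
    and ab: "0 \<le> a" "b \<le> T"
  shows "(\<integral>t. w t * indicator {a<..<b} t \<partial>leb T) = 0"
proof -
  define \<phi> where "\<phi> n t = flat ((t - (a + 1 / Suc n)) / (1 / Suc n)) * flat (((b - 1 / Suc n) - t) / (1 / Suc n))"
    for n :: nat and t
  have \<phi>: "\<phi> n \<in> test_fun T" for n
  proof -
    obtain X where X: "jet X" "\<And>t. X 0 t = \<phi> n t"
      "\<And>m t. t \<notin> {a + 1 / Suc n..b - 1 / Suc n} \<Longrightarrow> X m t = 0"
      unfolding \<phi>_def by (rule bump_jet[of "1 / Suc n" "a + 1 / Suc n" "b - 1 / Suc n"]) simp_all
    have "supported_jet T X" unfolding supported_jet_def
    proof (intro conjI exI)
      have "0 < 1 / real (Suc n)" by simp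
      then show "0 < a + 1 / Suc n" "b - 1 / Suc n < T" using ab by linarith+
    qed (use X in auto)
    then have "X 0 \<in> test_fun T" by (rule supported_jet_test_fun)
    moreover have "X 0 = \<phi> n" using X(2) by blast
    ultimately show ?thesis by simp
  qed
  have \<phi>01: "0 \<le> \<phi> n t" "\<phi> n t \<le> 1" for n t
    unfolding \<phi>_def by (auto intro!: mult_nonneg_nonneg mult_le_one flat_nonneg flat_le_1)
  have lim: "(\<lambda>n. \<phi> n t) \<longlonglongrightarrow> indicator {a<..<b} t" for t
  proof (cases "t \<in> {a<..<b}")
    case True
    have *: "filterlim (\<lambda>n. c * real (Suc n) - 1) at_top sequentially" if "c > 0" for c :: real
    proof -
      have "filterlim (\<lambda>n. c * real (Suc n)) at_top sequentially"
        by (rule filterlim_tendsto_pos_mult_at_top[OF tendsto_const that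
            filterlim_compose[OF filterlim_real_sequentially filterlim_Suc]])
      from filterlim_tendsto_add_at_top[OF tendsto_const[of "-1"] this]
      show ?thesis by (simp add: algebra_simps)
    qed
    have "(\<lambda>n. flat ((t - a) * real (Suc n) - 1) * flat ((b - t) * real (Suc n) - 1)) \<longlonglongrightarrow> 1 * 1"
      using True by (intro tendsto_mult filterlim_compose[OF flat_tendsto_1 *]) auto
    moreover have "\<phi> n t = flat ((t - a) * real (Suc n) - 1) * flat ((b - t) * real (Suc n) - 1)" for n
    proof -
      have "(t - (a + 1 / N)) / (1 / N) = (t - a) * N - 1" "((b - 1 / N) - t) / (1 / N) = (b - t) * N - 1"
        if "N > 0" for N :: real
        using that by (simp_all add: field_simps)
      from this[of "real (Suc n)"] show ?thesis unfolding \<phi>_def by simp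
    qed
    ultimately show ?thesis using True by simp
  next
    case False
    have "\<phi> n t = 0" for n
    proof -
      have "t \<le> a \<or> b \<le> t" using False by auto
      then have "(t - (a + 1 / Suc n)) / (1 / Suc n) \<le> 0 \<or> ((b - 1 / Suc n) - t) / (1 / Suc n) \<le> 0"
      proof
        assume "t \<le> a"
        then have "t - (a + 1 / Suc n) \<le> 0" by (simp add: add_increasing2)
        then show ?thesis by (intro disjI1 divide_nonpos_nonneg) auto
      next
        assume "b \<le> t"
        then have "(b - 1 / Suc n) - t \<le> 0" by (simp add: add_increasing2 diff_le_eq)
        then show ?thesis by (intro disjI2 divide_nonpos_nonneg) auto
      qed
      then show ?thesis unfolding \<phi>_def flat_def by auto
    qed
    then show ?thesis using False by simp
  qed
  have \<phi>m: "\<phi> n \<in> borel_measurable (leb T)" for n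
    using jet_continuous[OF supported_jet_jet[OF test_fun_supported_jet[OF T \<phi>]], of UNIV 0 n]
    by (intro borel_measurable_integrable[OF integrable_leb_continuous]) simp
  have wm: "w \<in> borel_measurable (leb T)" by (rule L2_space_measurable[OF w])
  have "(\<lambda>n. \<integral>t. w t * \<phi> n t \<partial>leb T) \<longlonglongrightarrow> (\<integral>t. w t * indicator {a<..<b} t \<partial>leb T)"
  proof (rule integral_dominated_convergence)
    show "integrable (leb T) (\<lambda>t. \<bar>w t\<bar>)" using L2_space_integrable[OF w] by simp
    show "AE t in leb T. (\<lambda>n. w t * \<phi> n t) \<longlonglongrightarrow> w t * indicator {a<..<b} t"
      by (intro AE_I2 tendsto_mult tendsto_const lim)
    show "AE t in leb T. norm (w t * \<phi> n t) \<le> \<bar>w t\<bar>" for n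
      using \<phi>01[of n] by (intro AE_I2) (simp add: abs_mult mult_left_le)
    show "(\<lambda>t. w t * \<phi> n t) \<in> borel_measurable (leb T)" for n
      by (intro borel_measurable_times wm \<phi>m)
    show "(\<lambda>t. w t * indicator {a<..<b} t) \<in> borel_measurable (leb T)"
    proof (intro borel_measurable_times wm borel_measurable_indicator')
      show "{t \<in> space (leb T). t \<in> {a<..<b}} \<in> sets (leb T)"
      proof -
        have "{t \<in> space (leb T). t \<in> {a<..<b}} = {max 0 a<..<min b T}" by auto
        moreover have "{max 0 a<..<min b T} \<subseteq> {0<..<T}" by auto
        ultimately show ?thesis using sets_lebI by simp
      qed
    qed
  qed
  with 0[OF \<phi>] show ?thesis by (simp add: LIMSEQ_const_iff)
qed

text \<open>
  The integrals of \<open>w\<close> over all intervals vanish, and by Lebesgue's differentiation theorem \<open>w\<close> is almost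
  everywhere the limit of its means over short intervals.
\<close>

lemma fundamental_lemma_calculus_of_variations:
  assumes T: "T > 0" and w: "w \<in> L2_space T"
    and 0: "\<And>\<phi>. \<phi> \<in> test_fun T \<Longrightarrow> (\<integral>t. w t * \<phi> t \<partial>leb T) = 0"
  shows "AE t in leb T. w t = 0"
proof -
  define g where "g t = (if t \<in> {0<..<T} then w t else 0)" for t
  have wi: "integrable (leb T) w" by (rule L2_space_integrable[OF w])
  have "w integrable_on {0<..<T}" by (rule integrable_on_lebesgue_on[OF wi]) auto
  then have gU: "g integrable_on UNIV" unfolding g_def by (simp only: integrable_restrict_UNIV)
  have gi: "g integrable_on cbox x y" for x y
    by (rule integrable_on_subcbox[OF gU]) auto
  have g0: "integral (cbox x y) g = 0" for x y
  proof -
    define a b where "a = max x 0" and "b = min y T"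
    have "integral (cbox x y) g = integral ({0<..<T} \<inter> {x..y}) w"
      unfolding g_def box_real by (rule Henstock_Kurzweil_Integration.integral_restrict_Int)
    also have "\<dots> = integral {a<..<b} w"
    proof (rule integral_subset_negligible[symmetric])
      show "{a<..<b} \<subseteq> {0<..<T} \<inter> {x..y}" by (auto simp: a_def b_def)
      show "negligible ({0<..<T} \<inter> {x..y} - {a<..<b})"
        by (rule negligible_subset[of "{a, b}"]) (auto simp: a_def b_def max_def min_def)
    qed
    also have "\<dots> = integral ({0<..<T} \<inter> {a<..<b}) w"
      by (rule arg_cong[where f="\<lambda>S. integral S w"]) (auto simp: a_def b_def)
    also have "\<dots> = integral {0<..<T} (\<lambda>t. if t \<in> {a<..<b} then w t else 0)"
      by (simp only: Henstock_Kurzweil_Integration.integral_restrict_Int Int_commute)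
    also have "\<dots> = integral {0<..<T} (\<lambda>t. w t * indicator {a<..<b} t)"
      by (intro integral_cong) (auto simp: indicator_def)
    also have "\<dots> = (\<integral>t. w t * indicator {a<..<b} t \<partial>leb T)"
    proof (rule lebesgue_integral_eq_integral[symmetric])
      have "{a<..<b} \<in> sets (leb T)" by (rule sets_lebI) (auto simp: a_def b_def)
      then show "integrable (leb T) (\<lambda>t. w t * indicator {a<..<b} t)"
        by (rule integrable_real_mult_indicator[OF _ wi])
    qed simp
    also have "\<dots> = 0"
      by (rule integral_interval_eq_0[OF T w 0]) (auto simp: a_def b_def)
    finally show ?thesis .
  qed
  obtain N where N: "negligible N" and k: "\<And>x e. \<lbrakk>x \<notin> N; 0 < e\<rbrakk>
      \<Longrightarrow> \<exists>d>0. \<forall>h. 0 < h \<and> h < d \<longrightarrow>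
          norm (integral (cbox x (x + h *\<^sub>R One)) g /\<^sub>R h ^ DIM(real) - g x) < e"
    by (rule integrable_ccontinuous_explicit[OF gi]) (rule that)
  have gN: "g x = 0" if xN: "x \<notin> N" for x
  proof (rule ccontr)
    assume "g x \<noteq> 0"
    then obtain d where d: "d > 0" "\<And>h. 0 < h \<Longrightarrow> h < d \<Longrightarrow>
        norm (integral (cbox x (x + h *\<^sub>R One)) g /\<^sub>R h ^ DIM(real) - g x) < norm (g x)"
      using k[OF xN, of "norm (g x)"] by auto
    from d(2)[of "d / 2"] d(1) show False unfolding g0 by simp
  qed
  have "AE t in lebesgue. t \<notin> N" using N
    by (simp add: AE_not_in negligible_iff_null_sets)
  then have "AE t in lebesgue. t \<in> {0<..<T} \<longrightarrow> w t = 0"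
  proof eventually_elim
    case (elim t)
    then show ?case using gN[of t] by (auto simp: g_def split: if_splits)
  qed
  then show ?thesis by (simp add: AE_restrict_space_iff)
qed

lemma is_weak_deriv_unique:
  assumes "T > 0" "is_weak_deriv T j u v" "is_weak_deriv T j u v'"
  shows "AE t in leb T. v t = v' t"
proof -
  have vL: "v \<in> L2_space T" "v' \<in> L2_space T" using assms by (auto simp: is_weak_deriv_def)
  have "AE t in leb T. v t - v' t = 0"
  proof (rule fundamental_lemma_calculus_of_variations[OF assms(1) L2_space_diff[OF vL]])
    fix \<phi> assume \<phi>: "\<phi> \<in> test_fun T"
    have c: "continuous_on UNIV \<phi>"
      using jet_continuous[OF supported_jet_jet[OF test_fun_supported_jet[OF assms(1) \<phi>]], of UNIV 0]
      by simp
    have i: "integrable (leb T) (\<lambda>t. w t * \<phi> t)" if "w \<in> L2_space T" for w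
      using L2_space_mult_integrable[OF that L2_space_continuous[OF c]] .
    have "(-1) ^ j * (\<integral>t. v t * \<phi> t \<partial>leb T) = (-1) ^ j * (\<integral>t. v' t * \<phi> t \<partial>leb T)"
      using assms(2,3) \<phi> by (auto simp: is_weak_deriv_def)
    then show "(\<integral>t. (v t - v' t) * \<phi> t \<partial>leb T) = 0"
      using i[OF vL(1)] i[OF vL(2)] by (simp add: left_diff_distrib)
  qed
  then show ?thesis by simp
qed

text \<open>
  Uniqueness makes the norm independent of the choice in the definition of the weak derivative.
\<close>

lemma L2_norm_weak_deriv:
  assumes "T > 0" "is_weak_deriv T j u v"
  shows "L2_norm T (weak_deriv T j u) = sqrt (sq_norm T v)"
proof -
  have w: "is_weak_deriv T j u (weak_deriv T j u)"
    unfolding weak_deriv_def by (rule someI[where P="is_weak_deriv T j u", OF assms(2)])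
  have "AE t in leb T. weak_deriv T j u t = v t"
    by (rule is_weak_deriv_unique[OF assms(1) w assms(2)])
  then have "sq_norm T (weak_deriv T j u) = sq_norm T v"
    unfolding sq_norm_def
    by (intro integral_cong_AE borel_measurable_integrable[OF L2_space_sq_integrable])
       (use w assms(2) in \<open>auto simp: is_weak_deriv_def\<close>)
  then show ?thesis by (simp add: L2_norm_sq_norm)
qed

lemma is_weak_deriv_jet:
  assumes "T > 0" "supported_jet T f"
  shows "is_weak_deriv T j (f 0) (f j)"
  unfolding is_weak_deriv_def
proof (intro conjI ballI)
  show "f 0 \<in> L2_space T" "f j \<in> L2_space T"
    by (intro L2_space_continuous jet_continuous supported_jet_jet[OF assms(2)])+
  fix \<phi> assume "\<phi> \<in> test_fun T"
  then have "supported_jet T (\<lambda>m. (deriv ^^ m) \<phi>)" by (rule test_fun_supported_jet[OF assms(1)])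
  from integral_by_parts_funpow[OF assms supported_jet_jet[OF this], of 0 0 j]
  show "(\<integral>t. f 0 t * (deriv ^^ j) \<phi> t \<partial>leb T) = (- 1) ^ j * (\<integral>t. f j t * \<phi> t \<partial>leb T)" by simp
qed

lemma is_weak_deriv_limit:
  assumes "T > 0" "\<And>n. is_weak_deriv T j (s n) (s' n)" "u \<in> L2_space T" "v \<in> L2_space T"
    and "(\<lambda>n. sq_norm T (\<lambda>t. s n t - u t)) \<longlonglongrightarrow> 0"
    and "(\<lambda>n. sq_norm T (\<lambda>t. s' n t - v t)) \<longlonglongrightarrow> 0"
  shows "is_weak_deriv T j u v"
  unfolding is_weak_deriv_def
proof (intro conjI ballI assms(3,4))
  fix \<phi> assume \<phi>: "\<phi> \<in> test_fun T"
  have L: "s n \<in> L2_space T" "s' n \<in> L2_space T" for n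
    using assms(2)[of n] by (auto simp: is_weak_deriv_def)
  have c: "continuous_on UNIV ((deriv ^^ m) \<phi>)" for m
    by (rule jet_continuous[OF supported_jet_jet[OF test_fun_supported_jet[OF assms(1) \<phi>]]])
  have 1: "(\<lambda>n. \<integral>t. s n t * (deriv ^^ j) \<phi> t \<partial>leb T) \<longlonglongrightarrow> (\<integral>t. u t * (deriv ^^ j) \<phi> t \<partial>leb T)"
    using integral_L2_tendsto[OF assms(1) L(1) assms(3) c[of j] assms(5)] by simp
  have "(\<lambda>n. (-1) ^ j * (\<integral>t. s' n t * \<phi> t \<partial>leb T)) \<longlonglongrightarrow> (-1) ^ j * (\<integral>t. v t * \<phi> t \<partial>leb T)"
    using integral_L2_tendsto[OF assms(1) L(2) assms(4) c[of 0] assms(6)]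
    by (intro tendsto_intros) simp
  moreover have "(\<integral>t. s n t * (deriv ^^ j) \<phi> t \<partial>leb T) = (-1) ^ j * (\<integral>t. s' n t * \<phi> t \<partial>leb T)" for n
    using assms(2) \<phi> by (auto simp: is_weak_deriv_def)
  ultimately show "(\<integral>t. u t * (deriv ^^ j) \<phi> t \<partial>leb T) = (- 1) ^ j * (\<integral>t. v t * \<phi> t \<partial>leb T)"
    using LIMSEQ_unique[OF 1] by simp
qed

lemma is_weak_deriv_diff:
  assumes "T > 0" "is_weak_deriv T j u v" "is_weak_deriv T j u' v'"
  shows "is_weak_deriv T j (\<lambda>t. u t - u' t) (\<lambda>t. v t - v' t)"
  unfolding is_weak_deriv_def
proof (intro conjI ballI)
  have L: "u \<in> L2_space T" "u' \<in> L2_space T" "v \<in> L2_space T" "v' \<in> L2_space T"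
    using assms by (auto simp: is_weak_deriv_def)
  then show "(\<lambda>t. u t - u' t) \<in> L2_space T" "(\<lambda>t. v t - v' t) \<in> L2_space T"
    by (auto intro: L2_space_diff)
  fix \<phi> assume \<phi>: "\<phi> \<in> test_fun T"
  have c: "(deriv ^^ m) \<phi> \<in> L2_space T" for m
    by (rule L2_space_continuous[OF jet_continuous[OF supported_jet_jet[OF
        test_fun_supported_jet[OF assms(1) \<phi>]]]])
  note i = L2_space_mult_integrable[OF L(1) c[of j]] L2_space_mult_integrable[OF L(2) c[of j]]
    L2_space_mult_integrable[OF L(3) c[of 0]] L2_space_mult_integrable[OF L(4) c[of 0]]
  show "(\<integral>t. (u t - u' t) * (deriv ^^ j) \<phi> t \<partial>leb T) = (- 1) ^ j * (\<integral>t. (v t - v' t) * \<phi> t \<partial>leb T)"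
    using assms(2,3) \<phi> i by (simp add: left_diff_distrib is_weak_deriv_def right_diff_distrib)
qed

text \<open>
  Each derivative of the test functions converges in \<open>L\<^sup>2\<close>, and its limit is the corresponding weak
  derivative of \<open>u\<close>; so the convergence to \<open>u\<close> takes place in \<open>H\<^sup>k\<close>. The factor \<open>2\<close> comes from
  \<open>(a + b)\<^sup>2 \<le> 2 a\<^sup>2 + 2 b\<^sup>2\<close>, where the term that tends to \<open>0\<close> disappears.
\<close>

lemma H0_limit:
  fixes s :: "nat \<Rightarrow> nat \<Rightarrow> real \<Rightarrow> real"
  assumes T: "T > 0" and s: "\<And>N. supported_jet T (s N)"
    and cauchy: "\<And>m e. m \<le> k \<Longrightarrow> e > 0 \<Longrightarrow>
      \<exists>M. \<forall>N\<ge>M. \<forall>N'\<ge>M. sq_norm T (\<lambda>t. s N m t - s N' m t) < e"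
    and u: "u \<in> L2_space T" and lim: "(\<lambda>N. sq_norm T (\<lambda>t. s N 0 t - u t)) \<longlonglongrightarrow> 0"
  shows "u \<in> H0 k T"
    and "\<And>m B. m \<le> k \<Longrightarrow> (\<And>N. sq_norm T (s N m) \<le> B) \<Longrightarrow> H0_norm m T u \<le> sqrt (2 * B)"
proof -
  have sL: "s N m \<in> L2_space T" for N m
    by (intro L2_space_continuous jet_continuous supported_jet_jet[OF s])
  have "\<exists>v. v \<in> L2_space T \<and> (\<lambda>N. sq_norm T (\<lambda>t. s N m t - v t)) \<longlonglongrightarrow> 0" if "m \<le> k" for m
    using L2_complete[of "\<lambda>N. s N m" T, OF sL cauchy[OF that]] by metis
  then obtain v where v: "\<And>m. m \<le> k \<Longrightarrow> v m \<in> L2_space T"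
    "\<And>m. m \<le> k \<Longrightarrow> (\<lambda>N. sq_norm T (\<lambda>t. s N m t - v m t)) \<longlonglongrightarrow> 0" by metis
  have wd: "is_weak_deriv T m u (v m)" if "m \<le> k" for m
    by (rule is_weak_deriv_limit[OF T is_weak_deriv_jet[OF T s] u v(1)[OF that] lim v(2)[OF that]])
  have wdd: "is_weak_deriv T m (\<lambda>t. u t - s N 0 t) (\<lambda>t. v m t - s N m t)" if "m \<le> k" for m N
    by (rule is_weak_deriv_diff[OF T wd[OF that] is_weak_deriv_jet[OF T s]])
  have Hd: "H_norm k T (\<lambda>t. u t - s N 0 t) = sqrt (\<Sum>m\<le>k. sq_norm T (\<lambda>t. s N m t - v m t))" for N
    unfolding H_norm_def
    by (intro arg_cong[where f=sqrt] sum.cong refl)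
       (simp add: L2_norm_weak_deriv[OF T wdd] sq_norm_nonneg sq_norm_minus_commute)
  have "(\<lambda>N. sqrt (\<Sum>m\<le>k. sq_norm T (\<lambda>t. s N m t - v m t))) \<longlonglongrightarrow> sqrt (\<Sum>m\<le>k. 0)"
    by (intro tendsto_intros v(2)) auto
  then have Hlim: "(\<lambda>N. H_norm k T (\<lambda>t. u t - s N 0 t)) \<longlonglongrightarrow> 0" by (simp add: Hd)
  show "u \<in> H0 k T"
    unfolding H0_def H_space_def
  proof (intro CollectI conjI allI impI u)
    show "\<exists>v. is_weak_deriv T j u v" if "j \<le> k" for j using wd[OF that] by blast
    fix e :: real assume "e > 0"
    then obtain N where "H_norm k T (\<lambda>t. u t - s N 0 t) < e"
      using order_tendstoD(2)[OF Hlim, of e] by (auto simp: eventually_sequentially)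
    then show "\<exists>\<phi>\<in>test_fun T. H_norm k T (\<lambda>t. u t - \<phi> t) < e"
      using supported_jet_test_fun[OF s] by blast
  qed
  fix m B assume m: "m \<le> k" and B: "\<And>N. sq_norm T (s N m) \<le> B"
  have "sq_norm T (v m) \<le> 2 * sq_norm T (\<lambda>t. s N m t - v m t) + 2 * B" for N
    using sq_norm_add[OF L2_space_diff[OF v(1)[OF m] sL[of N m]] sL[of N m]] B[of N]
    by (simp add: sq_norm_minus_commute[of T "v m"])
  moreover have "(\<lambda>N. 2 * sq_norm T (\<lambda>t. s N m t - v m t) + 2 * B) \<longlonglongrightarrow> 2 * 0 + 2 * B"
    by (intro tendsto_intros v(2) m)
  ultimately have "sq_norm T (v m) \<le> 2 * 0 + 2 * B"
    by (intro LIMSEQ_le_const) auto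
  then show "H0_norm m T u \<le> sqrt (2 * B)"
    unfolding H0_norm_def L2_norm_weak_deriv[OF T wd[OF m]] by simp
qed

lemma H0_norm_cong_AE:
  assumes "u \<in> L2_space T" "v \<in> L2_space T" "AE t in leb T. u t = v t"
  shows "H0_norm m T u = H0_norm m T v"
proof -
  have "is_weak_deriv T m u w \<longleftrightarrow> is_weak_deriv T m v w" for w
  proof -
    have "(\<integral>t. u t * (deriv ^^ m) \<phi> t \<partial>leb T) = (\<integral>t. v t * (deriv ^^ m) \<phi> t \<partial>leb T)"
      if \<phi>: "\<phi> \<in> test_fun T" for \<phi>
    proof (cases "T > 0")
      case True
      have c: "(deriv ^^ m) \<phi> \<in> L2_space T"
        by (rule L2_space_continuous[OF jet_continuous[OF supported_jet_jet[OF
            test_fun_supported_jet[OF True \<phi>]]]])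
      show ?thesis
      proof (rule integral_cong_AE)
        show "AE t in leb T. u t * (deriv ^^ m) \<phi> t = v t * (deriv ^^ m) \<phi> t"
          using assms(3) by eventually_elim simp
      qed (intro borel_measurable_times L2_space_measurable assms c)+
    next
      case False
      then have "{0<..<T} = {}" by simp
      then show ?thesis by simp
    qed
    then show ?thesis using assms by (simp add: is_weak_deriv_def)
  qed
  then have "is_weak_deriv T m u = is_weak_deriv T m v" by blast
  then show ?thesis by (simp add: H0_norm_def weak_deriv_def)
qed

section \<open>Fourier moments of jets\<close>

definition fourier :: "real \<Rightarrow> (real \<Rightarrow> complex) \<Rightarrow> real \<Rightarrow> complex" where
  "fourier T f z = (\<integral>t. f t * exp (\<i> * of_real (z * t)) \<partial>leb T)"

definition power_moment :: "real \<Rightarrow> (real \<Rightarrow> complex) \<Rightarrow> nat \<Rightarrow> complex" where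
  "power_moment T f q = (\<integral>t. f t * of_real (t ^ q) \<partial>leb T)"

text \<open>
  The jet of \<open>f' + \<i>\<mu>f\<close>. Integration by parts turns this operator into multiplication of the Fourier
  moment at \<open>z\<close> by \<open>\<i>(\<mu> - z)\<close>, so it deletes the moment at \<open>\<mu>\<close>.
\<close>

definition shift_jet :: "real \<Rightarrow> (nat \<Rightarrow> real \<Rightarrow> complex) \<Rightarrow> nat \<Rightarrow> real \<Rightarrow> complex" where
  "shift_jet \<mu> f m t = f (Suc m) t + \<i> * of_real \<mu> * f m t"

text \<open>
  The jet of \<open>exp (- \<i>\<nu>t) f(t)\<close>: the derivative of \<open>exp (- \<i>\<nu>t) g(t)\<close> is \<open>exp (- \<i>\<nu>t)\<close> times the shift of
  \<open>g\<close> by \<open>- \<nu>\<close>.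
\<close>

definition modulate_jet :: "real \<Rightarrow> (nat \<Rightarrow> real \<Rightarrow> complex) \<Rightarrow> nat \<Rightarrow> real \<Rightarrow> complex" where
  "modulate_jet \<nu> f m t = exp (- \<i> * of_real (\<nu> * t)) * (shift_jet (- \<nu>) ^^ m) f 0 t"

lemma exp_has_vector_derivative:
  "((\<lambda>t. exp (c * of_real t)) has_vector_derivative c * exp (c * of_real t)) (at t)"
  for c :: complex
proof -
  have "((\<lambda>z. exp (c * z)) has_field_derivative c * exp (c * of_real t)) (at (of_real t))"
    by (auto intro!: derivative_eq_intros)
  then show ?thesis by (rule has_vector_derivative_real_field)
qed

lemma supported_jet_shift:
  assumes "supported_jet T f"
  shows "supported_jet T (shift_jet \<mu> f)"
proof -
  have "supported_jet T (\<lambda>m t. f (Suc m) t + (\<i> * of_real \<mu>) * f m t)"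
    by (intro supported_jet_add supported_jet_Suc supported_jet_mult_left assms)
  then show ?thesis by (simp add: shift_jet_def[abs_def])
qed

lemma supported_jet_shift_funpow:
  "supported_jet T f \<Longrightarrow> supported_jet T ((shift_jet \<mu> ^^ n) f)"
  by (induction n) (auto intro: supported_jet_shift)

lemma shift_jet_eq_0: "(\<And>m. f m t = 0) \<Longrightarrow> (shift_jet \<mu> ^^ n) f m t = 0"
  by (induction n arbitrary: m) (auto simp: shift_jet_def)

lemma supported_jet_modulate:
  assumes "supported_jet T f"
  shows "supported_jet T (modulate_jet \<nu> f)"
proof -
  obtain a b where ab: "0 < a" "b < T" "\<forall>m t. t \<notin> {a..b} \<longrightarrow> f m t = 0"
    using assms unfolding supported_jet_def by auto
  have "modulate_jet \<nu> f m t = 0" if "t \<notin> {a..b}" for m t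
    unfolding modulate_jet_def using shift_jet_eq_0[of f t] ab(3) that by simp
  moreover have "jet (modulate_jet \<nu> f)"
    unfolding jet_def
  proof (intro allI)
    fix m t
    define g where "g = (shift_jet (- \<nu>) ^^ m) f"
    have g: "jet g" unfolding g_def by (rule supported_jet_jet[OF supported_jet_shift_funpow[OF assms]])
    have "((\<lambda>t. exp (- \<i> * of_real \<nu> * of_real t) * g 0 t) has_vector_derivative
        (exp (- \<i> * of_real \<nu> * of_real t) * g (Suc 0) t + - \<i> * of_real \<nu> * exp (- \<i> * of_real \<nu> * of_real t) * g 0 t)) (at t)"
      by (rule has_vector_derivative_mult[OF exp_has_vector_derivative jetD[OF g]])
    then show "(modulate_jet \<nu> f m has_vector_derivative modulate_jet \<nu> f (Suc m) t) (at t)"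
      by (simp add: modulate_jet_def[abs_def] g_def[symmetric] shift_jet_def algebra_simps)
  qed
  ultimately show ?thesis unfolding supported_jet_def using ab by blast
qed

lemma fourier_shift:
  assumes "T > 0" "supported_jet T f"
  shows "fourier T (shift_jet \<mu> f m) z = \<i> * of_real (\<mu> - z) * fourier T (f m) z"
proof -
  have c: "continuous_on UNIV (f m)" for m by (intro jet_continuous supported_jet_jet[OF assms(2)])
  have i: "integrable (leb T) (\<lambda>t. f m t * exp (\<i> * of_real (z * t)))" for m
    by (intro integrable_leb_continuous continuous_intros c)
  have "(\<integral>t. f (Suc m) t * exp (\<i> * of_real z * of_real t) \<partial>leb T)
      = - (\<integral>t. f m t * (\<i> * of_real z * exp (\<i> * of_real z * of_real t)) \<partial>leb T)"
    by (rule integral_by_parts[OF assms exp_has_vector_derivative]) (intro continuous_intros)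
  also have "\<dots> = - (\<i> * of_real z * fourier T (f m) z)"
    unfolding fourier_def by (simp add: ac_simps flip: integral_mult_right_zero)
  finally have "(\<integral>t. f (Suc m) t * exp (\<i> * of_real (z * t)) \<partial>leb T) = - (\<i> * of_real z * fourier T (f m) z)"
    by (simp add: ac_simps)
  moreover have "fourier T (shift_jet \<mu> f m) z = (\<integral>t. f (Suc m) t * exp (\<i> * of_real (z * t)) \<partial>leb T)
      + \<i> * of_real \<mu> * fourier T (f m) z"
    unfolding fourier_def shift_jet_def
    using i[of m] i[of "Suc m"] by (simp add: distrib_right mult.assoc)
  ultimately show ?thesis by (simp add: algebra_simps)
qed

lemma fourier_modulate:
  "fourier T (modulate_jet \<nu> f 0) z = fourier T (f 0) (z - \<nu>)"
proof -
  have "exp (- \<i> * of_real (\<nu> * t)) * f 0 t * exp (\<i> * of_real (z * t)) = f 0 t * exp (\<i> * of_real ((z - \<nu>) * t))" for t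
  proof -
    have "exp (- \<i> * of_real (\<nu> * t)) * exp (\<i> * of_real (z * t)) = exp (\<i> * of_real ((z - \<nu>) * t))"
      by (simp add: algebra_simps flip: exp_add)
    then show ?thesis by (simp only: ac_simps)
  qed
  then show ?thesis by (simp only: fourier_def modulate_jet_def funpow_0)
qed

text \<open>
  Every power of \<open>1 + \<bar>z\<bar>\<close> is paid for by one integration by parts, which replaces \<open>f\<close> by its derivative;
  hence the induction on \<open>p\<close> runs over all derivatives simultaneously.
\<close>

lemma fourier_decay:
  assumes "T > 0" "supported_jet T f"
  obtains C where "C \<ge> 0" "\<And>z. (1 + \<bar>z\<bar>) ^ p * norm (fourier T (f m) z) \<le> C"
proof -
  have "\<exists>C\<ge>0. \<forall>z. (1 + \<bar>z\<bar>) ^ p * norm (fourier T (f m) z) \<le> C"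
  proof (induction p arbitrary: m)
    case 0
    have "norm (fourier T (f m) z) \<le> (\<integral>t. norm (f m t) \<partial>leb T)" for z
    proof -
      have "norm (fourier T (f m) z) \<le> (\<integral>t. norm (f m t * exp (\<i> * of_real (z * t))) \<partial>leb T)"
        unfolding fourier_def by (rule integral_norm_bound)
      then show ?thesis by (simp add: norm_mult)
    qed
    then show ?case by (intro exI[of _ "\<integral>t. norm (f m t) \<partial>leb T"]) simp
  next
    case (Suc p)
    obtain C where C: "C \<ge> 0" "\<And>z. (1 + \<bar>z\<bar>) ^ p * norm (fourier T (f m) z) \<le> C" using Suc by blast
    obtain D where D: "D \<ge> 0" "\<And>z. (1 + \<bar>z\<bar>) ^ p * norm (fourier T (f (Suc m)) z) \<le> D" using Suc by blast
    have "(1 + \<bar>z\<bar>) ^ Suc p * norm (fourier T (f m) z) \<le> C + D" for z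
    proof -
      have "fourier T (f (Suc m)) z = \<i> * of_real (0 - z) * fourier T (f m) z"
        using fourier_shift[OF assms, of 0 m z] by (simp add: shift_jet_def[abs_def])
      then have "norm (fourier T (f (Suc m)) z) = \<bar>z\<bar> * norm (fourier T (f m) z)"
        by (simp add: norm_mult)
      then show ?thesis using C(2)[of z] D(2)[of z] by (simp add: algebra_simps)
    qed
    then show ?case using C D by (intro exI[of _ "C + D"]) simp
  qed
  then show ?thesis using that by blast
qed

lemma power_moment_shift:
  assumes "T > 0" "supported_jet T f"
  shows "power_moment T (shift_jet \<mu> f m) q
    = \<i> * of_real \<mu> * power_moment T (f m) q - of_nat q * power_moment T (f m) (q - 1)"
proof -
  have c: "continuous_on UNIV (f m)" for m by (intro jet_continuous supported_jet_jet[OF assms(2)])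
  have i: "integrable (leb T) (\<lambda>t. f m t * of_real (t ^ q))" for m
    by (intro integrable_leb_continuous continuous_intros c)
  have d: "((\<lambda>t. of_real (t ^ q)) has_vector_derivative (of_nat q * of_real (t ^ (q - 1)) :: complex)) (at t)" for t
  proof -
    have "((\<lambda>z. z ^ q) has_field_derivative of_nat q * of_real t ^ (q - 1)) (at (of_real t :: complex))"
      by (auto intro!: derivative_eq_intros)
    from has_vector_derivative_real_field[OF this] show ?thesis by simp
  qed
  have "(\<integral>t. f (Suc m) t * of_real (t ^ q) \<partial>leb T)
      = - (\<integral>t. f m t * (of_nat q * of_real (t ^ (q - 1))) \<partial>leb T)"
    by (rule integral_by_parts[OF assms d]) (intro continuous_intros)
  also have "\<dots> = - (of_nat q * power_moment T (f m) (q - 1))"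
    unfolding power_moment_def by (simp add: ac_simps flip: integral_mult_right_zero)
  finally have "(\<integral>t. f (Suc m) t * of_real (t ^ q) \<partial>leb T) = - (of_nat q * power_moment T (f m) (q - 1))" .
  moreover have "power_moment T (shift_jet \<mu> f m) q = (\<integral>t. f (Suc m) t * of_real (t ^ q) \<partial>leb T)
      + \<i> * of_real \<mu> * power_moment T (f m) q"
    unfolding power_moment_def shift_jet_def
    using i[of m] i[of "Suc m"] by (simp add: distrib_right mult.assoc)
  ultimately show ?thesis by (simp add: algebra_simps)
qed

lemma power_moment_0: "power_moment T f 0 = fourier T f 0"
  by (simp add: power_moment_def fourier_def)

lemma normalized_bump:
  assumes "T > 0"
  obtains X where "supported_jet T X" "fourier T (X 0) 0 = 1"
proof -
  obtain Z where Z: "jet Z" "\<And>t. Z 0 t = flat ((t - T / 3) / 1) * flat ((2 * T / 3 - t) / 1)"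
    "\<And>m t. t \<notin> {T / 3..2 * T / 3} \<Longrightarrow> Z m t = 0"
    by (rule bump_jet[of 1 "T / 3" "2 * T / 3"]) simp_all
  have sZ: "supported_jet T Z"
    unfolding supported_jet_def
  proof (intro conjI exI)
    show "0 < T / 3" "2 * T / 3 < T" using assms by simp_all
  qed (use Z in auto)
  have Zc: "continuous_on UNIV (Z 0)" by (rule jet_continuous[OF Z(1)])
  have i: "integrable (leb T) (Z 0)" by (rule integrable_leb_continuous[OF Zc])
  have Z0: "0 \<le> Z 0 t" for t by (simp add: Z(2) flat_nonneg)
  define c where "c = (\<integral>t. Z 0 t \<partial>leb T)"
  have "c \<noteq> 0"
  proof
    assume "c = 0"
    then have "AE t in leb T. Z 0 t = 0"
      unfolding c_def using integral_nonneg_eq_0_iff_AE[OF i] Z0 by auto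
    then have "AE t in lebesgue. t \<in> {0<..<T} \<longrightarrow> Z 0 t = 0" by (simp add: AE_restrict_space_iff)
    then have "AE t in lebesgue. t \<notin> {T / 3<..<2 * T / 3}"
    proof eventually_elim
      case (elim t)
      show ?case
      proof
        assume t: "t \<in> {T / 3<..<2 * T / 3}"
        then have "0 < Z 0 t" unfolding Z(2) by (intro mult_pos_pos flat_pos) auto
        moreover have "t \<in> {0<..<T}" using t assms by auto
        ultimately show False using elim by auto
      qed
    qed
    then have "{T / 3<..<2 * T / 3} \<in> null_sets lebesgue"
      by (subst AE_iff_null_sets) auto
    then have "emeasure lebesgue {T / 3<..<2 * T / 3} = 0" by auto
    then show False using assms by simp
  qed
  define X where "X m t = complex_of_real (1 / c * Z m t)" for m t
  show thesis
  proof (rule that)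
    show "supported_jet T X"
      unfolding X_def by (rule supported_jet_map[OF supported_jet_mult_left[OF sZ] bounded_linear_of_real])
    have "fourier T (X 0) 0 = (\<integral>t. complex_of_real (1 / c * Z 0 t) \<partial>leb T)" by (simp add: fourier_def X_def)
    also have "\<dots> = complex_of_real (1 / c * c)" unfolding integral_complex_of_real c_def by simp
    finally show "fourier T (X 0) 0 = 1" using \<open>c \<noteq> 0\<close> by simp
  qed
qed

section \<open>Annihilating finitely many moments\<close>

abbreviation shift_list :: "real list \<Rightarrow> (nat \<Rightarrow> real \<Rightarrow> complex) \<Rightarrow> nat \<Rightarrow> real \<Rightarrow> complex" where
  "shift_list \<mu>s f \<equiv> foldr shift_jet \<mu>s f"

text \<open>
  The factor by which \<open>shift_list \<mu>s\<close> multiplies the Fourier moment at \<open>z\<close>.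
\<close>

definition symbol :: "real list \<Rightarrow> real \<Rightarrow> complex" where
  "symbol \<mu>s z = (\<Prod>\<mu>\<leftarrow>\<mu>s. \<i> * of_real (\<mu> - z))"

lemma supported_jet_shift_list: "supported_jet T f \<Longrightarrow> supported_jet T (shift_list \<mu>s f)"
  by (induction \<mu>s) (auto intro: supported_jet_shift)

lemma fourier_shift_list:
  assumes "T > 0" "supported_jet T f"
  shows "fourier T (shift_list \<mu>s f m) z = symbol \<mu>s z * fourier T (f m) z"
  by (induction \<mu>s) (simp_all add: symbol_def fourier_shift[OF assms(1) supported_jet_shift_list[OF assms(2)]])

lemma symbol_eq_0_iff: "symbol \<mu>s z = 0 \<longleftrightarrow> z \<in> set \<mu>s"
  by (induction \<mu>s) (auto simp: symbol_def)

text \<open>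
  The roots lie in \<open>[-a,a]\<close> and \<open>z\<close> outside \<open>(-b,b)\<close>. Since \<open>x \<mapsto> (x - a) / (1 + x)\<close> increases, each factor
  is at least the fixed fraction \<open>(b - a) / (1 + b)\<close> of \<open>1 + \<bar>z\<bar>\<close>.
\<close>

lemma symbol_lower_bound:
  assumes "\<And>\<mu>. \<mu> \<in> set \<mu>s \<Longrightarrow> \<bar>\<mu>\<bar> \<le> a" "0 \<le> a" "a < b" "b \<le> \<bar>z\<bar>"
  shows "((b - a) / (1 + b) * (1 + \<bar>z\<bar>)) ^ length \<mu>s \<le> norm (symbol \<mu>s z)"
  using assms(1)
proof (induction \<mu>s)
  case (Cons \<mu> \<mu>s)
  have "(b - a) * (1 + \<bar>z\<bar>) \<le> (\<bar>z\<bar> - a) * (1 + b)"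
  proof -
    have "(b - \<bar>z\<bar>) * (1 + a) \<le> 0" using assms by (intro mult_nonpos_nonneg) auto
    then show ?thesis by (simp add: algebra_simps)
  qed
  then have "(b - a) / (1 + b) * (1 + \<bar>z\<bar>) \<le> \<bar>z\<bar> - a"
    using assms by (simp add: divide_le_eq)
  also have "\<dots> \<le> \<bar>\<mu> - z\<bar>" using Cons.prems[of \<mu>] by auto
  finally have *: "(b - a) / (1 + b) * (1 + \<bar>z\<bar>) \<le> \<bar>\<mu> - z\<bar>" .
  have n: "0 \<le> (b - a) / (1 + b) * (1 + \<bar>z\<bar>)" using assms by simp
  have "((b - a) / (1 + b) * (1 + \<bar>z\<bar>)) ^ Suc (length \<mu>s) \<le> \<bar>\<mu> - z\<bar> * norm (symbol \<mu>s z)"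
    unfolding power_Suc using Cons n by (intro mult_mono *) auto
  also have "\<dots> = norm (symbol (\<mu> # \<mu>s) z)"
    unfolding symbol_def list.map prod_list.Cons norm_mult norm_of_real by simp
  finally show ?case by simp
qed (simp add: symbol_def)

text \<open>
  A shift combines the moment of order \<open>q\<close> with the one of order \<open>q - 1\<close>, so the vanishing of all moments
  below \<open>r\<close> is preserved.
\<close>

lemma power_moment_shift_list_eq_0:
  assumes "T > 0" "supported_jet T f" "\<And>p. p < r \<Longrightarrow> power_moment T (f 0) p = 0" "q < r"
  shows "power_moment T (shift_list \<mu>s f 0) q = 0"
  using assms(4)
proof (induction \<mu>s arbitrary: q)
  case (Cons \<mu> \<mu>s)
  then show ?case
    using power_moment_shift[OF assms(1) supported_jet_shift_list[OF assms(2)], of \<mu> \<mu>s 0 q]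
    by simp
qed (use assms in auto)

text \<open>
  When the lower moments vanish, the moment of order \<open>r\<close> is the first one to survive, and it behaves like
  the Fourier moment at \<open>0\<close>.
\<close>

lemma power_moment_shift_list:
  assumes "T > 0" "supported_jet T f" "\<And>p. p < r \<Longrightarrow> power_moment T (f 0) p = 0"
  shows "power_moment T (shift_list \<mu>s f 0) r = symbol \<mu>s 0 * power_moment T (f 0) r"
proof (induction \<mu>s)
  case (Cons \<mu> \<mu>s)
  have "of_nat r * power_moment T (shift_list \<mu>s f 0) (r - 1) = 0"
    using power_moment_shift_list_eq_0[OF assms, where q="r - 1" and \<mu>s=\<mu>s] by (cases r) auto
  then show ?case
    using power_moment_shift[OF assms(1) supported_jet_shift_list[OF assms(2)], of \<mu> \<mu>s 0 r] Cons
    by (simp add: symbol_def)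
qed (simp add: symbol_def)

text \<open>
  Each derivative of \<open>f\<close> lowers the degree of the power of \<open>t\<close> by one.
\<close>

lemma power_moment_shift_zeros:
  assumes "T > 0" "supported_jet T f"
  shows "q < r \<Longrightarrow> power_moment T ((shift_jet 0 ^^ r) f 0) q = 0"
    and "power_moment T ((shift_jet 0 ^^ r) f 0) r = (-1) ^ r * fact r * fourier T (f 0) 0"
proof -
  note s = power_moment_shift[OF assms(1) supported_jet_shift_funpow[OF assms(2)], of 0 _ _ 0]
  show "power_moment T ((shift_jet 0 ^^ r) f 0) q = 0" if "q < r"
    using that
  proof (induction r arbitrary: q)
    case (Suc r)
    show ?case
    proof (cases "q = 0")
      case False
      then have "q - 1 < r" using Suc.prems by simp
      then show ?thesis using Suc.IH by (simp add: s)
    qed (simp add: s)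
  qed simp
  show "power_moment T ((shift_jet 0 ^^ r) f 0) r = (-1) ^ r * fact r * fourier T (f 0) 0"
    by (induction r) (simp_all add: s power_moment_0 algebra_simps)
qed

section \<open>Small perturbations of the identity in weighted \<open>\<ell>\<^sup>2\<close>\<close>

text \<open>
  \<open>S\<close> bounds the \<open>\<ell>\<^sup>2\<close> norm of \<open>y\<close> with weight \<open>\<rho>\<close>. Bounding finite sums expresses summability and the size
  of the norm at once.
\<close>

definition weighted_l2 :: "('i \<Rightarrow> real) \<Rightarrow> 'i set \<Rightarrow> ('i \<Rightarrow> complex) \<Rightarrow> real \<Rightarrow> bool" where
  "weighted_l2 \<rho> I y S \<longleftrightarrow> (\<forall>F. finite F \<longrightarrow> F \<subseteq> I \<longrightarrow> L2_set (\<lambda>j. \<rho> j * norm (y j)) F \<le> S)"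

text \<open>
  Schur's test, with bound \<open>1/2\<close> for the rows and for the columns of the conjugated matrix
  \<open>\<rho>\<^sub>l K\<^sub>l\<^sub>j / \<rho>\<^sub>j\<close>: the matrix \<open>K\<close> has norm at most \<open>1/2\<close> on the \<open>\<ell>\<^sup>2\<close> space with weight \<open>\<rho>\<close>.
\<close>

definition schur_half :: "'i set \<Rightarrow> ('i \<Rightarrow> 'i \<Rightarrow> complex) \<Rightarrow> ('i \<Rightarrow> real) \<Rightarrow> bool" where
  "schur_half I K \<rho> \<longleftrightarrow> (\<forall>j\<in>I. \<rho> j > 0) \<and>
     (\<forall>l\<in>I. \<forall>F. finite F \<longrightarrow> F \<subseteq> I \<longrightarrow> (\<Sum>j\<in>F. norm (K l j) * \<rho> l / \<rho> j) \<le> 1 / 2) \<and>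
     (\<forall>j\<in>I. \<forall>F. finite F \<longrightarrow> F \<subseteq> I \<longrightarrow> (\<Sum>l\<in>F. norm (K l j) * \<rho> l / \<rho> j) \<le> 1 / 2)"

definition kernel_op :: "'i set \<Rightarrow> ('i \<Rightarrow> 'i \<Rightarrow> complex) \<Rightarrow> ('i \<Rightarrow> complex) \<Rightarrow> 'i \<Rightarrow> complex" where
  "kernel_op I K y l = (\<Sum>\<^sub>\<infinity>j\<in>I. K l j * y j)"

lemma weighted_l2D: "weighted_l2 \<rho> I y S \<Longrightarrow> finite F \<Longrightarrow> F \<subseteq> I \<Longrightarrow> L2_set (\<lambda>j. \<rho> j * norm (y j)) F \<le> S"
  by (simp add: weighted_l2_def)

lemma weighted_l2_nonneg: "weighted_l2 \<rho> I y S \<Longrightarrow> 0 \<le> S"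
  using weighted_l2D[of \<rho> I y S "{}"] by simp

lemma weighted_l2_pointwise: "weighted_l2 \<rho> I y S \<Longrightarrow> j \<in> I \<Longrightarrow> \<rho> j * norm (y j) \<le> S"
  using weighted_l2D[of \<rho> I y S "{j}"] by simp

lemma weighted_l2_cong:
  "(\<And>j. j \<in> I \<Longrightarrow> norm (y j) = norm (z j)) \<Longrightarrow> weighted_l2 \<rho> I y S \<longleftrightarrow> weighted_l2 \<rho> I z S"
  unfolding weighted_l2_def by (intro all_cong1 imp_cong refl) (simp add: L2_set_def subset_iff)

lemma weighted_l2_mono: "weighted_l2 \<rho> I y S \<Longrightarrow> S \<le> S' \<Longrightarrow> weighted_l2 \<rho> I y S'"
  unfolding weighted_l2_def by (meson order_trans)

lemma weighted_l2_add:
  assumes \<rho>: "\<And>j. j \<in> I \<Longrightarrow> 0 \<le> \<rho> j"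
    and y: "weighted_l2 \<rho> I y S" and z: "weighted_l2 \<rho> I z S'"
  shows "weighted_l2 \<rho> I (\<lambda>j. y j + z j) (S + S')"
  unfolding weighted_l2_def
proof (intro allI impI)
  fix F assume F: "finite F" "F \<subseteq> I"
  have "L2_set (\<lambda>j. \<rho> j * norm (y j + z j)) F \<le> L2_set (\<lambda>j. \<rho> j * norm (y j) + \<rho> j * norm (z j)) F"
  proof (rule L2_set_mono)
    fix j assume "j \<in> F"
    then have "0 \<le> \<rho> j" using F \<rho> by blast
    then show "\<rho> j * norm (y j + z j) \<le> \<rho> j * norm (y j) + \<rho> j * norm (z j)"
      using mult_left_mono[OF norm_triangle_ineq] by (simp flip: distrib_left)
    show "0 \<le> \<rho> j * norm (y j + z j)" using \<open>0 \<le> \<rho> j\<close> by simp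
  qed
  also have "\<dots> \<le> L2_set (\<lambda>j. \<rho> j * norm (y j)) F + L2_set (\<lambda>j. \<rho> j * norm (z j)) F"
    by (rule L2_set_triangle_ineq)
  also have "\<dots> \<le> S + S'" using y z F by (intro add_mono weighted_l2D)
  finally show "L2_set (\<lambda>j. \<rho> j * norm (y j + z j)) F \<le> S + S'" .
qed

lemma weighted_l2_uminus: "weighted_l2 \<rho> I (\<lambda>j. - y j) S \<longleftrightarrow> weighted_l2 \<rho> I y S"
  by (rule weighted_l2_cong) simp

lemma weighted_l2_scale:
  assumes "weighted_l2 \<rho> I y S"
  shows "weighted_l2 \<rho> I (\<lambda>j. c * y j) (norm c * S)"
  unfolding weighted_l2_def
proof (intro allI impI)
  fix F assume F: "finite F" "F \<subseteq> I"
  have "L2_set (\<lambda>j. \<rho> j * norm (c * y j)) F = norm c * L2_set (\<lambda>j. \<rho> j * norm (y j)) F"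
    by (simp add: L2_set_right_distrib norm_mult ac_simps)
  also have "\<dots> \<le> norm c * S" by (intro mult_left_mono weighted_l2D[OF assms F]) auto
  finally show "L2_set (\<lambda>j. \<rho> j * norm (c * y j)) F \<le> norm c * S" .
qed

lemma weighted_l2_LIMSEQ:
  assumes "\<And>n. weighted_l2 \<rho> I (z n) S" "\<And>j. j \<in> I \<Longrightarrow> (\<lambda>n. z n j) \<longlonglongrightarrow> y j"
  shows "weighted_l2 \<rho> I y S"
  unfolding weighted_l2_def
proof (intro allI impI)
  fix F assume F: "finite F" "F \<subseteq> I"
  have "(\<lambda>n. L2_set (\<lambda>j. \<rho> j * norm (z n j)) F) \<longlonglongrightarrow> L2_set (\<lambda>j. \<rho> j * norm (y j)) F"
    unfolding L2_set_def using F assms(2) by (intro tendsto_intros) auto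
  then show "L2_set (\<lambda>j. \<rho> j * norm (y j)) F \<le> S"
    by (rule LIMSEQ_le_const2) (use weighted_l2D[OF assms(1) F] in auto)
qed

text \<open>
  The usual proof of Schur's test: each entry \<open>M\<close> of the conjugated matrix is split as \<open>\<surd>M \<surd>M\<close>, and the
  Cauchy-Schwarz inequality is applied to each row.
\<close>

lemma schur_test_finite:
  assumes K: "schur_half I K \<rho>" and F: "finite F" "F \<subseteq> I" and J: "finite J" "J \<subseteq> I"
  shows "L2_set (\<lambda>l. \<rho> l * norm (\<Sum>j\<in>J. K l j * y j)) F \<le> 1 / 2 * L2_set (\<lambda>j. \<rho> j * norm (y j)) J"
proof -
  define M where "M l j = norm (K l j) * \<rho> l / \<rho> j" for l j
  define x where "x j = \<rho> j * norm (y j)" for j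
  have pos: "\<rho> j > 0" if "j \<in> I" for j using K that by (auto simp: schur_half_def)
  have M0: "0 \<le> M l j" if "j \<in> I" "l \<in> I" for l j
    using pos[OF that(1)] pos[OF that(2)] by (simp add: M_def)
  have row: "(\<Sum>j\<in>J. M l j) \<le> 1 / 2" if "l \<in> I" for l
    using K J that by (simp add: schur_half_def M_def)
  have col: "(\<Sum>l\<in>F. M l j) \<le> 1 / 2" if "j \<in> I" for j
    using K F that by (simp add: schur_half_def M_def)
  have 1: "(\<rho> l * norm (\<Sum>j\<in>J. K l j * y j))\<^sup>2 \<le> 1 / 2 * (\<Sum>j\<in>J. M l j * (x j)\<^sup>2)" if l: "l \<in> F" for l
  proof -
    have lI: "l \<in> I" using l F by blast
    have "\<rho> l * norm (\<Sum>j\<in>J. K l j * y j) \<le> \<rho> l * (\<Sum>j\<in>J. norm (K l j * y j))"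
      using pos[OF lI] by (intro mult_left_mono norm_sum) auto
    also have "\<dots> = (\<Sum>j\<in>J. sqrt (M l j) * (sqrt (M l j) * x j))"
      unfolding sum_distrib_left
    proof (rule sum.cong[OF refl])
      fix j assume "j \<in> J"
      then have jI: "j \<in> I" using J by blast
      have "sqrt (M l j) * (sqrt (M l j) * x j) = M l j * x j"
        using M0[OF jI lI] by (simp flip: mult.assoc)
      moreover have "M l j * x j = \<rho> l * norm (K l j * y j)"
        using pos[OF jI] by (simp add: M_def x_def norm_mult)
      ultimately show "\<rho> l * norm (K l j * y j) = sqrt (M l j) * (sqrt (M l j) * x j)" by simp
    qed
    finally have "(\<rho> l * norm (\<Sum>j\<in>J. K l j * y j))\<^sup>2 \<le> (\<Sum>j\<in>J. sqrt (M l j) * (sqrt (M l j) * x j))\<^sup>2"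
      using pos[OF lI] by (intro power_mono) auto
    also have "\<dots> \<le> (\<Sum>j\<in>J. (sqrt (M l j))\<^sup>2) * (\<Sum>j\<in>J. (sqrt (M l j) * x j)\<^sup>2)"
      by (rule Cauchy_Schwarz_ineq_sum)
    also have "\<dots> = (\<Sum>j\<in>J. M l j) * (\<Sum>j\<in>J. M l j * (x j)\<^sup>2)"
      using M0 lI J by (intro arg_cong2[where f="(*)"] sum.cong) (auto simp: power_mult_distrib)
    also have "\<dots> \<le> 1 / 2 * (\<Sum>j\<in>J. M l j * (x j)\<^sup>2)"
      using M0 lI J by (intro mult_right_mono row sum_nonneg) auto
    finally show ?thesis .
  qed
  have "(\<Sum>l\<in>F. (\<rho> l * norm (\<Sum>j\<in>J. K l j * y j))\<^sup>2) \<le> (\<Sum>l\<in>F. 1 / 2 * (\<Sum>j\<in>J. M l j * (x j)\<^sup>2))"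
    by (intro sum_mono 1)
  also have "\<dots> = 1 / 2 * (\<Sum>j\<in>J. (\<Sum>l\<in>F. M l j) * (x j)\<^sup>2)"
    unfolding sum_distrib_left[symmetric] sum_distrib_right by (subst sum.swap) (rule refl)
  also have "\<dots> \<le> 1 / 2 * (\<Sum>j\<in>J. 1 / 2 * (x j)\<^sup>2)"
    using J col by (intro mult_left_mono sum_mono mult_right_mono) auto
  also have "\<dots> = (1 / 2)\<^sup>2 * (\<Sum>j\<in>J. (x j)\<^sup>2)"
    unfolding sum_distrib_left[symmetric] by (simp add: power2_eq_square)
  finally have "L2_set (\<lambda>l. \<rho> l * norm (\<Sum>j\<in>J. K l j * y j)) F \<le> sqrt ((1 / 2)\<^sup>2 * (\<Sum>j\<in>J. (x j)\<^sup>2))"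
    unfolding L2_set_def by (rule real_sqrt_le_mono)
  also have "\<dots> = 1 / 2 * L2_set x J"
    unfolding real_sqrt_mult L2_set_def by simp
  finally show ?thesis unfolding x_def .
qed

lemma kernel_summable:
  assumes K: "schur_half I K \<rho>" and y: "weighted_l2 \<rho> I y S" and l: "l \<in> I"
  shows "(\<lambda>j. K l j * y j) summable_on I"
proof (rule abs_summable_summable, rule nonneg_bdd_above_summable_on)
  have pos: "\<rho> j > 0" if "j \<in> I" for j using K that by (auto simp: schur_half_def)
  show "bdd_above (sum (\<lambda>j. norm (K l j * y j)) ` {F. F \<subseteq> I \<and> finite F})"
  proof (rule bdd_aboveI2)
    fix F assume "F \<in> {F. F \<subseteq> I \<and> finite F}"
    then have F: "finite F" "F \<subseteq> I" by auto
    have "(\<Sum>j\<in>F. norm (K l j * y j)) \<le> (\<Sum>j\<in>F. norm (K l j) * \<rho> l / \<rho> j * (S / \<rho> l))"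
    proof (rule sum_mono)
      fix j assume "j \<in> F"
      then have j: "j \<in> I" using F by blast
      have "norm (y j) \<le> S / \<rho> j"
        using weighted_l2_pointwise[OF y j] pos[OF j] by (simp add: field_simps)
      then have "norm (K l j * y j) \<le> norm (K l j) * (S / \<rho> j)"
        unfolding norm_mult by (rule mult_left_mono) simp
      also have "\<dots> = norm (K l j) * \<rho> l / \<rho> j * (S / \<rho> l)"
        using pos[OF j] pos[OF l] by simp
      finally show "norm (K l j * y j) \<le> norm (K l j) * \<rho> l / \<rho> j * (S / \<rho> l)" .
    qed
    also have "\<dots> = (\<Sum>j\<in>F. norm (K l j) * \<rho> l / \<rho> j) * (S / \<rho> l)" by (rule sum_distrib_right[symmetric])
    also have "\<dots> \<le> 1 / 2 * (S / \<rho> l)"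
      using K l F pos[OF l] weighted_l2_nonneg[OF y]
      by (intro mult_right_mono) (auto simp: schur_half_def)
    finally show "(\<Sum>j\<in>F. norm (K l j * y j)) \<le> 1 / 2 * (S / \<rho> l)" .
  qed
qed simp

lemma weighted_l2_kernel_op:
  assumes K: "schur_half I K \<rho>" and y: "weighted_l2 \<rho> I y S"
  shows "weighted_l2 \<rho> I (kernel_op I K y) (S / 2)"
  unfolding weighted_l2_def
proof (intro allI impI)
  fix F assume F: "finite F" "F \<subseteq> I"
  have "((\<lambda>J. L2_set (\<lambda>l. \<rho> l * norm (\<Sum>j\<in>J. K l j * y j)) F)
      \<longlongrightarrow> L2_set (\<lambda>l. \<rho> l * norm (kernel_op I K y l)) F) (finite_subsets_at_top I)"
    unfolding L2_set_def kernel_op_def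
    using F by (intro tendsto_intros infsum_tendsto kernel_summable[OF K y]) auto
  moreover have "\<forall>\<^sub>F J in finite_subsets_at_top I. L2_set (\<lambda>l. \<rho> l * norm (\<Sum>j\<in>J. K l j * y j)) F \<le> S / 2"
  proof (rule eventually_finite_subsets_at_top_weakI)
    fix J assume J: "finite J" "J \<subseteq> I"
    show "L2_set (\<lambda>l. \<rho> l * norm (\<Sum>j\<in>J. K l j * y j)) F \<le> S / 2"
      using schur_test_finite[OF K F J, of y] weighted_l2D[OF y J] by simp
  qed
  ultimately show "L2_set (\<lambda>l. \<rho> l * norm (kernel_op I K y l)) F \<le> S / 2"
    by (rule tendsto_upperbound) simp
qed

lemma kernel_op_add:
  assumes "schur_half I K \<rho>" "weighted_l2 \<rho> I y S" "weighted_l2 \<rho> I z S'" "l \<in> I"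
  shows "kernel_op I K (\<lambda>j. y j + z j) l = kernel_op I K y l + kernel_op I K z l"
  unfolding kernel_op_def distrib_left
  by (rule infsum_add[OF kernel_summable[OF assms(1,2,4)] kernel_summable[OF assms(1,3,4)]])

lemma kernel_op_uminus: "kernel_op I K (\<lambda>j. - y j) l = - kernel_op I K y l"
  by (simp add: kernel_op_def infsum_uminus)

lemma kernel_op_scale: "kernel_op I K (\<lambda>j. c * y j) l = c * kernel_op I K y l"
proof -
  have "kernel_op I K (\<lambda>j. c * y j) l = (\<Sum>\<^sub>\<infinity>j\<in>I. c * (K l j * y j))"
    by (simp add: kernel_op_def ac_simps)
  then show ?thesis by (simp add: kernel_op_def infsum_cmult_right')
qed

lemma kernel_op_diff:
  assumes "schur_half I K \<rho>" "weighted_l2 \<rho> I y S" "weighted_l2 \<rho> I z S'" "l \<in> I"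
  shows "kernel_op I K (\<lambda>j. y j - z j) l = kernel_op I K y l - kernel_op I K z l"
  using kernel_op_add[OF assms(1,2), of "\<lambda>j. - z j" S' l] assms(3,4)
  by (simp add: weighted_l2_uminus kernel_op_uminus)

text \<open>
  A solution of the homogeneous equation satisfies \<open>y = - K y\<close>, so every bound for its norm can be halved.
  This uniqueness is what makes the solution depend linearly on the right-hand side.
\<close>

lemma perturbed_identity_injective:
  assumes K: "schur_half I K (\<lambda>_. 1)" and y: "weighted_l2 (\<lambda>_. 1) I y S"
    and eq: "\<And>l. l \<in> I \<Longrightarrow> y l + kernel_op I K y l = 0" and l: "l \<in> I"
  shows "y l = 0"
proof -
  have "weighted_l2 (\<lambda>_. 1) I y (S / 2 ^ n)" for n
  proof (induction n)
    case (Suc n)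
    have "norm (y l) = norm (kernel_op I K y l)" if "l \<in> I" for l
      using eq[OF that] by (simp add: add_eq_0_iff)
    then show ?case
      using weighted_l2_kernel_op[OF K Suc] weighted_l2_cong[of I y "kernel_op I K y" "\<lambda>_. 1"]
      by (simp add: mult.commute)
  qed (use y in simp)
  then have "norm (y l) \<le> S / 2 ^ n" for n
    using weighted_l2_pointwise[of "\<lambda>_. 1" I y "S / 2 ^ n" l] l by simp
  moreover have "(\<lambda>n. S / 2 ^ n) \<longlonglongrightarrow> 0"
    by (intro LIMSEQ_divide_realpow_zero) auto
  ultimately have "norm (y l) \<le> 0" by (intro LIMSEQ_le_const) auto
  then show ?thesis by simp
qed

text \<open>
  The iteration \<open>s\<^sub>n\<^sub>+\<^sub>1 = b - K s\<^sub>n\<close> converges in unweighted \<open>\<ell>\<^sup>2\<close>. In every weight that passes Schur's test,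
  the iterates satisfy the bound \<open>2 S\<close>, and such bounds survive pointwise limits. So one solution obeys
  all the weighted estimates.
\<close>

lemma perturbed_identity_solvable:
  assumes K: "schur_half I K (\<lambda>_. 1)" and b: "weighted_l2 (\<lambda>_. 1) I b S0"
  obtains y where "\<And>l. l \<in> I \<Longrightarrow> y l + kernel_op I K y l = b l"
    and "\<And>\<rho> S. schur_half I K \<rho> \<Longrightarrow> weighted_l2 \<rho> I b S \<Longrightarrow> weighted_l2 \<rho> I y (2 * S)"
proof -
  define s where "s n = ((\<lambda>y l. b l - kernel_op I K y l) ^^ n) (\<lambda>_. 0)" for n :: nat
  have s_Suc: "s (Suc n) = (\<lambda>l. b l - kernel_op I K (s n) l)" for n by (simp add: s_def)
  have s_bound: "weighted_l2 \<rho> I (s n) (2 * S)" if \<rho>: "schur_half I K \<rho>" and bS: "weighted_l2 \<rho> I b S" for \<rho> S n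
  proof (induction n)
    case 0
    show ?case using weighted_l2_nonneg[OF bS] by (simp add: s_def weighted_l2_def L2_set_0')
  next
    case (Suc n)
    have "weighted_l2 \<rho> I (\<lambda>l. b l + - kernel_op I K (s n) l) (S + 2 * S / 2)"
      using \<rho> by (intro weighted_l2_add bS weighted_l2_uminus[THEN iffD2] weighted_l2_kernel_op Suc)
        (auto simp: schur_half_def intro: less_imp_le)
    then show ?case by (simp add: s_Suc)
  qed
  \<comment> \<open>\<open>s (n + p) - s n\<close> is the \<open>n\<close>-fold image of \<open>s p - s 0\<close> under \<open>- K\<close>, hence the factor \<open>2\<^sup>-\<^sup>n\<close>.\<close>
  have diff: "weighted_l2 (\<lambda>_. 1) I (\<lambda>l. s (n + p) l - s n l) (2 * S0 / 2 ^ n)" for n p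
  proof (induction n)
    case 0
    then show ?case using s_bound[OF K b, of p] by (simp add: s_def)
  next
    case (Suc n)
    have "norm (s (Suc n + p) l - s (Suc n) l) = norm (kernel_op I K (\<lambda>l. s (n + p) l - s n l) l)" if "l \<in> I" for l
      using kernel_op_diff[OF K s_bound[OF K b] s_bound[OF K b] that, of "n + p" n]
      by (simp add: s_Suc norm_minus_commute)
    then show ?case
      using weighted_l2_kernel_op[OF K Suc]
        weighted_l2_cong[of I "\<lambda>l. s (Suc n + p) l - s (Suc n) l" "kernel_op I K (\<lambda>l. s (n + p) l - s n l)" "\<lambda>_. 1"]
      by (simp add: mult.commute)
  qed
  have lim0: "(\<lambda>n. 2 * S0 / 2 ^ n) \<longlonglongrightarrow> 0"
    by (intro LIMSEQ_divide_realpow_zero) auto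
  have pd: "norm (s (n + p) l - s n l) \<le> 2 * S0 / 2 ^ n" if "l \<in> I" for n p l
    using weighted_l2_pointwise[OF diff that] by simp
  have conv: "convergent (\<lambda>n. s n l)" if l: "l \<in> I" for l
  proof (rule Cauchy_convergent, rule CauchyI')
    fix e :: real assume "e > 0"
    then obtain n0 where n0: "2 * S0 / 2 ^ n < e" if "n \<ge> n0" for n
      using order_tendstoD(2)[OF lim0, of e] by (auto simp: eventually_sequentially)
    have "norm (s m l - s n l) < e" if "m \<ge> n0" "n > m" for m n
      using pd[OF l, of m "n - m"] n0[OF that(1)] that(2) by (simp add: norm_minus_commute)
    then show "\<exists>M. \<forall>m\<ge>M. \<forall>n>m. dist (s m l) (s n l) < e" unfolding dist_norm by blast
  qed
  define y where "y l = lim (\<lambda>n. s n l)" for l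
  have ylim: "(\<lambda>n. s n l) \<longlonglongrightarrow> y l" if "l \<in> I" for l
    using conv[OF that] unfolding y_def by (simp add: convergent_LIMSEQ_iff)
  have yb: "weighted_l2 \<rho> I y (2 * S)" if "schur_half I K \<rho>" "weighted_l2 \<rho> I b S" for \<rho> S
    by (rule weighted_l2_LIMSEQ[OF s_bound[OF that] ylim])
  have ydiff: "weighted_l2 (\<lambda>_. 1) I (\<lambda>l. y l - s n l) (2 * S0 / 2 ^ n)" for n
  proof (rule weighted_l2_LIMSEQ[where z="\<lambda>p l. s (n + p) l - s n l"])
    show "weighted_l2 (\<lambda>_. 1) I (\<lambda>l. s (n + p) l - s n l) (2 * S0 / 2 ^ n)" for p by (rule diff)
    fix l assume "l \<in> I"
    have "(\<lambda>p. s (n + p) l) \<longlonglongrightarrow> y l"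
      using LIMSEQ_ignore_initial_segment[OF ylim[OF \<open>l \<in> I\<close>], of n] by (simp add: add.commute)
    then show "(\<lambda>p. s (n + p) l - s n l) \<longlonglongrightarrow> y l - s n l" by (intro tendsto_intros)
  qed
  have "y l + kernel_op I K y l = b l" if l: "l \<in> I" for l
  proof -
    have "norm (kernel_op I K (s n) l - kernel_op I K y l) \<le> 2 * S0 / 2 ^ n" for n
    proof -
      have "norm (kernel_op I K (\<lambda>l. y l - s n l) l) \<le> 2 * S0 / 2 ^ n / 2"
        using weighted_l2_pointwise[OF weighted_l2_kernel_op[OF K ydiff] l] by simp
      also have "\<dots> \<le> 2 * S0 / 2 ^ n" using weighted_l2_nonneg[OF b] by (simp add: divide_right_mono)
      finally show ?thesis
        by (simp add: kernel_op_diff[OF K yb[OF K b] s_bound[OF K b] l] norm_minus_commute)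
    qed
    then have "(\<lambda>n. kernel_op I K (s n) l - kernel_op I K y l) \<longlonglongrightarrow> 0"
      by (intro Lim_null_comparison[OF always_eventually lim0]) blast
    then have "(\<lambda>n. kernel_op I K (s n) l) \<longlonglongrightarrow> kernel_op I K y l" by (rule LIM_zero_cancel)
    then have "(\<lambda>n. s (Suc n) l + kernel_op I K (s n) l) \<longlonglongrightarrow> y l + kernel_op I K y l"
      by (intro tendsto_add LIMSEQ_Suc[OF ylim[OF l]])
    then show ?thesis by (simp add: s_Suc LIMSEQ_const_iff)
  qed
  then show thesis using that yb by blast
qed

section \<open>Separated frequencies\<close>

text \<open>
  If \<open>I\<close> omits the small indices, this says more than a lower bound for the gaps between neighbours: it
  also keeps the positive and the negative frequencies apart.
\<close>

definition separated :: "real \<Rightarrow> int set \<Rightarrow> (int \<Rightarrow> real) \<Rightarrow> bool" where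
  "separated \<Gamma> I \<nu> \<longleftrightarrow> (\<forall>j\<in>I. \<forall>l\<in>I. \<Gamma> * \<bar>real_of_int (j - l)\<bar> \<le> \<bar>\<nu> j - \<nu> l\<bar>)"

text \<open>
  A bound for the sum of \<open>1 / (j - l)\<^sup>2\<close> over all integers \<open>j \<noteq> l\<close>. The term \<open>n = 0\<close> of the series is \<open>0\<close>
  since \<open>1 / 0 = 0\<close>; the summand \<open>1\<close> makes the constant visibly positive.
\<close>

definition inv_sq_sum :: real where
  "inv_sq_sum = 1 + 2 * (\<Sum>n. 1 / (real n)\<^sup>2)"

lemma inv_sq_summable: "summable (\<lambda>n. 1 / (real n)\<^sup>2)"
  using inverse_power_summable[of 2, where 'a=real] by (simp add: inverse_eq_divide)

lemma inv_sq_sum_pos: "0 < inv_sq_sum"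
  unfolding inv_sq_sum_def using suminf_nonneg[OF inv_sq_summable] by (simp add: add_pos_nonneg)

lemma inv_sq_sum_bound:
  fixes F :: "int set"
  assumes F: "finite F"
  shows "(\<Sum>j\<in>F - {l}. 1 / (real_of_int (j - l))\<^sup>2) \<le> inv_sq_sum"
proof -
  define h where "h n = 1 / (real n)\<^sup>2" for n :: nat
  have hs: "summable h" unfolding h_def by (rule inv_sq_summable)
  have half: "(\<Sum>j\<in>G. 1 / (real_of_int (j - l))\<^sup>2) \<le> suminf h"
    if G: "finite G" and inj: "inj_on (\<lambda>j. nat \<bar>j - l\<bar>) G" for G :: "int set"
  proof -
    have "(\<Sum>j\<in>G. 1 / (real_of_int (j - l))\<^sup>2) = (\<Sum>j\<in>G. h (nat \<bar>j - l\<bar>))"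
      by (intro sum.cong refl) (simp add: h_def)
    also have "\<dots> = sum h ((\<lambda>j. nat \<bar>j - l\<bar>) ` G)"
      by (simp add: sum.reindex[OF inj])
    also have "\<dots> \<le> suminf h" using G by (intro sum_le_suminf hs) (auto simp: h_def)
    finally show ?thesis .
  qed
  have "(\<Sum>j\<in>F - {l}. 1 / (real_of_int (j - l))\<^sup>2)
      = (\<Sum>j\<in>{j\<in>F. l < j} \<union> {j\<in>F. j < l}. 1 / (real_of_int (j - l))\<^sup>2)"
    by (intro sum.cong) auto
  also have "\<dots> = (\<Sum>j\<in>{j\<in>F. l < j}. 1 / (real_of_int (j - l))\<^sup>2) + (\<Sum>j\<in>{j\<in>F. j < l}. 1 / (real_of_int (j - l))\<^sup>2)"
    using F by (intro sum.union_disjoint) auto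
  also have "\<dots> \<le> suminf h + suminf h"
    using F by (intro add_mono half) (auto simp: inj_on_def)
  finally show ?thesis unfolding inv_sq_sum_def h_def[abs_def] by linarith
qed

lemma separated_sum_le:
  assumes \<Gamma>: "\<Gamma> > 0" and sep: "separated \<Gamma> I \<nu>" and F: "finite F" "F \<subseteq> I" and l: "l \<in> I"
  shows "(\<Sum>j\<in>F - {l}. 1 / (\<nu> j - \<nu> l)\<^sup>2) \<le> inv_sq_sum / \<Gamma>\<^sup>2"
proof -
  have "(\<Sum>j\<in>F - {l}. 1 / (\<nu> j - \<nu> l)\<^sup>2) \<le> (\<Sum>j\<in>F - {l}. 1 / (real_of_int (j - l))\<^sup>2 / \<Gamma>\<^sup>2)"
  proof (rule sum_mono)
    fix j assume j: "j \<in> F - {l}"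
    then have "\<Gamma> * \<bar>real_of_int (j - l)\<bar> \<le> \<bar>\<nu> j - \<nu> l\<bar>"
      using sep F l unfolding separated_def by blast
    then have "(\<Gamma> * \<bar>real_of_int (j - l)\<bar>)\<^sup>2 \<le> \<bar>\<nu> j - \<nu> l\<bar>\<^sup>2"
      using \<Gamma> by (intro power_mono) auto
    then have le: "\<Gamma>\<^sup>2 * (real_of_int (j - l))\<^sup>2 \<le> (\<nu> j - \<nu> l)\<^sup>2" by (simp add: power_mult_distrib)
    have "0 < \<Gamma>\<^sup>2 * (real_of_int (j - l))\<^sup>2" using \<Gamma> j by simp
    then have "1 / (\<nu> j - \<nu> l)\<^sup>2 \<le> 1 / (\<Gamma>\<^sup>2 * (real_of_int (j - l))\<^sup>2)"
      using le by (intro divide_left_mono mult_pos_pos) auto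
    then show "1 / (\<nu> j - \<nu> l)\<^sup>2 \<le> 1 / (real_of_int (j - l))\<^sup>2 / \<Gamma>\<^sup>2" by (simp add: mult.commute)
  qed
  also have "\<dots> = (\<Sum>j\<in>F - {l}. 1 / (real_of_int (j - l))\<^sup>2) / \<Gamma>\<^sup>2" by (simp add: sum_divide_distrib)
  also have "\<dots> \<le> inv_sq_sum / \<Gamma>\<^sup>2" using inv_sq_sum_bound[OF F(1)] by (simp add: divide_right_mono)
  finally show ?thesis .
qed

section \<open>The Gram kernel of modulated bumps\<close>

text \<open>
  Dividing \<open>x\<close> by \<open>R\<close> inside the power leaves at most the fraction \<open>1/R\<close> of the growth of \<open>(1 + x)\<^sup>q\<close>. The
  summand \<open>- 1\<close> on the right is needed for the induction.
\<close>

lemma binomial_damping: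
  fixes x R :: real
  assumes "x \<ge> 0" "R \<ge> 1"
  shows "(1 + x / R) ^ q \<le> 1 + ((1 + x) ^ q - 1) / R"
proof (induction q)
  case (Suc q)
  define a where "a = (1 + x) ^ q - 1"
  have a0: "0 \<le> a" using assms by (simp add: a_def one_le_power)
  have "(1 + x / R) ^ Suc q \<le> (1 + a / R) * (1 + x / R)"
    using mult_right_mono[OF Suc, of "1 + x / R"] assms by (simp add: a_def mult.commute)
  also have "\<dots> = 1 + x / R + a / R + (a * x / R) / R" by (simp add: algebra_simps)
  also have "(a * x / R) / R \<le> a * x / R"
    using divide_left_mono[of 1 R "a * x / R"] a0 assms by simp
  also have "1 + x / R + a / R + a * x / R = 1 + ((1 + x) ^ Suc q - 1) / R"
    using assms by (simp add: a_def field_simps)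
  finally show ?case by simp
qed simp

text \<open>
  The quotient of two weights exceeds \<open>1\<close> by at most a term of order \<open>1/R\<close> that depends on the frequencies
  only through their distance.
\<close>

lemma weight_ratio:
  fixes x y R :: real
  assumes "R \<ge> 1" "p \<le> q"
  shows "(1 + \<bar>x\<bar> / R) ^ p / (1 + \<bar>y\<bar> / R) ^ p \<le> 1 + (1 + \<bar>x - y\<bar>) ^ q / R"
proof -
  have pos: "0 < 1 + \<bar>y\<bar> / R" using assms by (simp add: add_pos_nonneg)
  have "1 + \<bar>x\<bar> / R \<le> (1 + \<bar>x - y\<bar> / R) * (1 + \<bar>y\<bar> / R)"
  proof -
    have "\<bar>x\<bar> / R \<le> \<bar>x - y\<bar> / R + \<bar>y\<bar> / R"
      using assms by (simp add: divide_right_mono flip: add_divide_distrib)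
    moreover have "0 \<le> \<bar>x - y\<bar> / R * (\<bar>y\<bar> / R)" using assms by simp
    moreover have "1 + X \<le> (1 + A) * (1 + B)" if "X \<le> A + B" "0 \<le> A * B" for A B X :: real
      using that by (simp add: algebra_simps)
    ultimately show ?thesis by blast
  qed
  then have "(1 + \<bar>x\<bar> / R) / (1 + \<bar>y\<bar> / R) \<le> 1 + \<bar>x - y\<bar> / R"
    using pos by (simp add: divide_le_eq)
  then have "((1 + \<bar>x\<bar> / R) / (1 + \<bar>y\<bar> / R)) ^ p \<le> (1 + \<bar>x - y\<bar> / R) ^ p"
    using assms by (intro power_mono) auto
  also have "\<dots> \<le> (1 + \<bar>x - y\<bar> / R) ^ q"
    using assms by (intro power_increasing) auto
  also have "\<dots> \<le> 1 + ((1 + \<bar>x - y\<bar>) ^ q - 1) / R"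
    using assms by (intro binomial_damping) auto
  also have "\<dots> \<le> 1 + (1 + \<bar>x - y\<bar>) ^ q / R"
    using assms by (simp add: divide_right_mono)
  finally show ?thesis by (simp add: power_divide)
qed

text \<open>
  The matrix of the moments at \<open>\<nu>\<^sub>l\<close> of \<open>exp (- \<i> \<nu>\<^sub>j t) f(t)\<close>, without its diagonal.
\<close>

definition gram_kernel :: "real \<Rightarrow> (int \<Rightarrow> real) \<Rightarrow> (real \<Rightarrow> complex) \<Rightarrow> int \<Rightarrow> int \<Rightarrow> complex" where
  "gram_kernel T \<nu> f l j = (if l = j then 0 else fourier T f (\<nu> l - \<nu> j))"

text \<open>
  Rows and columns are dominated by \<open>(C\<^sub>0 + C\<^sub>1 / R) / (\<nu>\<^sub>l - \<nu>\<^sub>j)\<^sup>2\<close>, where \<open>C\<^sub>1\<close> depends on the order \<open>q\<close> of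
  the weights and \<open>C\<^sub>0\<close> does not. Large gaps make the first part small and a large \<open>R\<close> the second. The order
  of the quantifiers is the point: \<open>\<Gamma>0\<close> is independent of \<open>q\<close>, so the low frequencies can be fixed before
  it is known how many derivatives their elimination will cost.
\<close>

lemma schur_half_gram_kernel:
  assumes T: "T > 0" and X: "supported_jet T X"
  obtains \<Gamma>0 where "\<Gamma>0 > 0"
    "\<And>q. \<exists>R\<ge>1. \<forall>\<Gamma> I \<nu> p. \<Gamma> \<ge> \<Gamma>0 \<longrightarrow> separated \<Gamma> I \<nu> \<longrightarrow> p \<le> q \<longrightarrow>
        schur_half I (gram_kernel T \<nu> (X 0)) (\<lambda>j. (1 + \<bar>\<nu> j\<bar> / R) ^ p)"
proof -
  obtain C0 where C0: "C0 \<ge> 0" "\<And>z. (1 + \<bar>z\<bar>) ^ 2 * norm (fourier T (X 0) z) \<le> C0"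
    using fourier_decay[OF T X, of 2 0] by blast
  \<comment> \<open>\<open>\<Gamma>0 \<ge> 1\<close> allows replacing \<open>\<Gamma>0\<^sup>2\<close> by \<open>\<Gamma>0\<close> in the choice of the constant.\<close>
  define \<Gamma>0 where "\<Gamma>0 = max 1 (4 * C0 * inv_sq_sum)"
  have \<Gamma>0: "\<Gamma>0 > 0" "C0 * inv_sq_sum / \<Gamma>0\<^sup>2 \<le> 1 / 4"
  proof -
    show "\<Gamma>0 > 0" by (simp add: \<Gamma>0_def)
    have "4 * C0 * inv_sq_sum \<le> \<Gamma>0" "1 \<le> \<Gamma>0" by (simp_all add: \<Gamma>0_def)
    then have "4 * C0 * inv_sq_sum \<le> \<Gamma>0\<^sup>2"
      using mult_left_mono[of 1 \<Gamma>0 \<Gamma>0] unfolding power2_eq_square by linarith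
    then show "C0 * inv_sq_sum / \<Gamma>0\<^sup>2 \<le> 1 / 4" using \<open>\<Gamma>0 > 0\<close> by (simp add: divide_le_eq)
  qed
  have "\<exists>R\<ge>1. \<forall>\<Gamma> I \<nu> p. \<Gamma> \<ge> \<Gamma>0 \<longrightarrow> separated \<Gamma> I \<nu> \<longrightarrow> p \<le> q \<longrightarrow>
        schur_half I (gram_kernel T \<nu> (X 0)) (\<lambda>j. (1 + \<bar>\<nu> j\<bar> / R) ^ p)" for q
  proof -
    obtain C1 where C1: "C1 \<ge> 0" "\<And>z. (1 + \<bar>z\<bar>) ^ (2 + q) * norm (fourier T (X 0) z) \<le> C1"
      using fourier_decay[OF T X, of "2 + q" 0] by blast
    define Q where "Q = C1 * inv_sq_sum / \<Gamma>0\<^sup>2"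
    define R where "R = max 1 (4 * Q)"
    have R: "R \<ge> 1" "C1 / R * inv_sq_sum / \<Gamma>0\<^sup>2 \<le> 1 / 4"
    proof -
      show "R \<ge> 1" by (simp add: R_def)
      have "4 * Q \<le> R" by (simp add: R_def)
      then have "Q / R \<le> 1 / 4" using \<open>R \<ge> 1\<close> by (simp add: divide_le_eq)
      moreover have "C1 / R * inv_sq_sum / \<Gamma>0\<^sup>2 = Q / R" by (simp add: Q_def)
      ultimately show "C1 / R * inv_sq_sum / \<Gamma>0\<^sup>2 \<le> 1 / 4" by simp
    qed
    have entry: "norm (fourier T (X 0) z) * (1 + (1 + \<bar>z\<bar>) ^ q / R) \<le> (C0 + C1 / R) * (1 / z\<^sup>2)" if "z \<noteq> 0" for z
    proof -
      have z2: "z\<^sup>2 \<le> (1 + \<bar>z\<bar>)\<^sup>2" using power_mono[of "\<bar>z\<bar>" "1 + \<bar>z\<bar>" 2] by simp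
      have "z\<^sup>2 * (norm (fourier T (X 0) z) * (1 + (1 + \<bar>z\<bar>) ^ q / R))
          \<le> (1 + \<bar>z\<bar>)\<^sup>2 * (norm (fourier T (X 0) z) * (1 + (1 + \<bar>z\<bar>) ^ q / R))"
        using R by (intro mult_right_mono z2) auto
      also have "\<dots> = (1 + \<bar>z\<bar>)\<^sup>2 * norm (fourier T (X 0) z) + (1 + \<bar>z\<bar>) ^ (2 + q) * norm (fourier T (X 0) z) / R"
      proof -
        have "A * (N * (1 + B / R)) = A * N + A * B * N / R" for A B N :: real
          by (simp add: distrib_left)
        then show ?thesis unfolding power_add .
      qed
      also have "\<dots> \<le> C0 + C1 / R"
        using C0(2)[of z] C1(2)[of z] R by (intro add_mono divide_right_mono) auto
      finally show ?thesis using that by (simp add: field_simps)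
    qed
    have "schur_half I (gram_kernel T \<nu> (X 0)) (\<lambda>j. (1 + \<bar>\<nu> j\<bar> / R) ^ p)"
      if \<Gamma>: "\<Gamma> \<ge> \<Gamma>0" and sep: "separated \<Gamma> I \<nu>" and p: "p \<le> q" for \<Gamma> I \<nu> p
    proof -
      let ?\<rho> = "\<lambda>j. (1 + \<bar>\<nu> j\<bar> / R) ^ p" and ?K = "gram_kernel T \<nu> (X 0)"
      have \<Gamma>pos: "\<Gamma> > 0" using \<Gamma> \<Gamma>0 by linarith
      have bound: "norm (?K l j) * ?\<rho> l / ?\<rho> j \<le> (if l = j then 0 else (C0 + C1 / R) * (1 / (\<nu> l - \<nu> j)\<^sup>2))"
        if lj: "l \<in> I" "j \<in> I" for l j
      proof (cases "l = j")
        case False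
        have "0 < \<Gamma> * \<bar>real_of_int (l - j)\<bar>" using False \<Gamma>pos by simp
        also have "\<dots> \<le> \<bar>\<nu> l - \<nu> j\<bar>" using sep lj by (auto simp: separated_def)
        finally have nz: "\<nu> l - \<nu> j \<noteq> 0" by simp
        have "norm (?K l j) * (?\<rho> l / ?\<rho> j) \<le> norm (?K l j) * (1 + (1 + \<bar>\<nu> l - \<nu> j\<bar>) ^ q / R)"
          by (intro mult_left_mono weight_ratio R p) simp
        also have "\<dots> \<le> (C0 + C1 / R) * (1 / (\<nu> l - \<nu> j)\<^sup>2)"
          using entry[OF nz] False by (simp add: gram_kernel_def)
        finally show ?thesis using False by simp
      qed (simp add: gram_kernel_def)
      have small: "(\<Sum>j\<in>F. if l = j then 0 else (C0 + C1 / R) * (1 / (\<nu> l - \<nu> j)\<^sup>2)) \<le> 1 / 2"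
        if F: "finite F" "F \<subseteq> I" and l: "l \<in> I" for F l
      proof -
        have "(\<Sum>j\<in>F. if l = j then 0 else (C0 + C1 / R) * (1 / (\<nu> l - \<nu> j)\<^sup>2))
            = (\<Sum>j\<in>F - {l}. (C0 + C1 / R) * (1 / (\<nu> j - \<nu> l)\<^sup>2))"
          using F by (intro sum.mono_neutral_cong_right) (auto simp: power2_commute)
        also have "\<dots> = (C0 + C1 / R) * (\<Sum>j\<in>F - {l}. 1 / (\<nu> j - \<nu> l)\<^sup>2)"
          by (rule sum_distrib_left[symmetric])
        also have "\<dots> \<le> (C0 + C1 / R) * (inv_sq_sum / \<Gamma>\<^sup>2)"
          using C0 C1 R by (intro mult_left_mono separated_sum_le[OF \<Gamma>pos sep F l]) auto
        also have "\<dots> \<le> (C0 + C1 / R) * (inv_sq_sum / \<Gamma>0\<^sup>2)"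
          using C0 C1 R inv_sq_sum_pos \<Gamma> \<Gamma>0(1) \<Gamma>pos by (intro mult_left_mono divide_left_mono power_mono) auto
        also have "\<dots> = C0 * inv_sq_sum / \<Gamma>0\<^sup>2 + C1 / R * inv_sq_sum / \<Gamma>0\<^sup>2" by (simp add: distrib_right add_divide_distrib)
        also have "\<dots> \<le> 1 / 2" by (rule order_trans[OF add_mono[OF \<Gamma>0(2) R(2)]]) simp
        finally show ?thesis .
      qed
      show ?thesis
        unfolding schur_half_def
      proof (intro conjI ballI allI impI)
        show "0 < ?\<rho> j" for j using R by (intro zero_less_power add_pos_nonneg) auto
        fix l F assume l: "l \<in> I" and F: "finite F" "F \<subseteq> I"
        show "(\<Sum>j\<in>F. norm (?K l j) * ?\<rho> l / ?\<rho> j) \<le> 1 / 2"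
          by (rule order_trans[OF sum_mono[OF bound] small[OF F l]]) (use F l in auto)
        have "(\<Sum>j\<in>F. norm (?K j l) * ?\<rho> j / ?\<rho> l) \<le> (\<Sum>j\<in>F. if l = j then 0 else (C0 + C1 / R) * (1 / (\<nu> l - \<nu> j)\<^sup>2))"
          by (rule order_trans[OF sum_mono[OF bound]]) (use F l in \<open>auto simp: power2_commute intro!: sum_mono\<close>)
        then show "(\<Sum>j\<in>F. norm (?K j l) * ?\<rho> j / ?\<rho> l) \<le> 1 / 2"
          using small[OF F l] by linarith
      qed
    qed
    then show ?thesis using R by blast
  qed
  with \<Gamma>0(1) show thesis by (rule that)
qed

section \<open>Bessel inequalities\<close>

lemma sq_norm_add_continuous:
  fixes u v :: "real \<Rightarrow> 'b::euclidean_space"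
  assumes "continuous_on UNIV u" "continuous_on UNIV v"
  shows "sq_norm T (\<lambda>t. u t + v t) \<le> 2 * sq_norm T u + 2 * sq_norm T v"
proof -
  have i: "integrable (leb T) (\<lambda>t. (norm (w t))\<^sup>2)" if "continuous_on UNIV w" for w :: "real \<Rightarrow> 'b"
    by (intro integrable_leb_continuous continuous_intros that)
  have "sq_norm T (\<lambda>t. u t + v t) \<le> (\<integral>t. (2 * (norm (u t))\<^sup>2 + 2 * (norm (v t))\<^sup>2) \<partial>leb T)"
    unfolding sq_norm_def
    by (intro integral_mono norm_add_sq Bochner_Integration.integrable_add integrable_mult_right i
        continuous_on_add assms)
  also have "\<dots> = 2 * sq_norm T u + 2 * sq_norm T v"
    using i[OF assms(1)] i[OF assms(2)] by (simp add: sq_norm_def)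
  finally show ?thesis .
qed

text \<open>
  This is \<open>2 a b \<le> a\<^sup>2 + b\<^sup>2\<close> together with the symmetry of \<open>D\<close>.
\<close>

lemma schur_quadratic_form:
  fixes a :: "'i \<Rightarrow> real"
  assumes F: "finite F" and D: "\<And>j l. 0 \<le> D j l" "\<And>j l. D j l = D l j"
    and B: "\<And>j. j \<in> F \<Longrightarrow> (\<Sum>l\<in>F. D j l) \<le> B"
  shows "(\<Sum>j\<in>F. \<Sum>l\<in>F. a j * a l * D j l) \<le> B * (\<Sum>j\<in>F. (a j)\<^sup>2)"
proof -
  have "(\<Sum>j\<in>F. \<Sum>l\<in>F. a j * a l * D j l) \<le> (\<Sum>j\<in>F. \<Sum>l\<in>F. ((a j)\<^sup>2 * D j l + (a l)\<^sup>2 * D j l) / 2)"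
  proof (intro sum_mono)
    fix j l
    have "a j * a l * D j l \<le> ((a j)\<^sup>2 + (a l)\<^sup>2) / 2 * D j l"
      using zero_le_power2[of "a j - a l"] by (intro mult_right_mono D) (simp add: power2_diff)
    then show "a j * a l * D j l \<le> ((a j)\<^sup>2 * D j l + (a l)\<^sup>2 * D j l) / 2" by (simp add: distrib_right)
  qed
  also have "\<dots> = ((\<Sum>j\<in>F. \<Sum>l\<in>F. (a j)\<^sup>2 * D j l) + (\<Sum>j\<in>F. \<Sum>l\<in>F. (a l)\<^sup>2 * D j l)) / 2"
    unfolding sum.distrib[symmetric] sum_divide_distrib ..
  also have "(\<Sum>j\<in>F. \<Sum>l\<in>F. (a l)\<^sup>2 * D j l) = (\<Sum>j\<in>F. \<Sum>l\<in>F. (a j)\<^sup>2 * D j l)"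
    by (subst sum.swap) (intro sum.cong refl arg_cong2[where f="(*)"] D(2))
  also have "((\<Sum>j\<in>F. \<Sum>l\<in>F. (a j)\<^sup>2 * D j l) + (\<Sum>j\<in>F. \<Sum>l\<in>F. (a j)\<^sup>2 * D j l)) / 2
      = (\<Sum>j\<in>F. (a j)\<^sup>2 * (\<Sum>l\<in>F. D j l))" unfolding sum_distrib_left[symmetric] by simp
  also have "\<dots> \<le> (\<Sum>j\<in>F. (a j)\<^sup>2 * B)" by (intro sum_mono mult_left_mono B) auto
  finally show ?thesis by (simp add: sum_distrib_left mult.commute)
qed

text \<open>
  A bump \<open>G\<close> that is positive on the support of \<open>h\<close> dominates \<open>\<bar>h\<bar>\<^sup>2\<close> up to a constant. Integrated against
  \<open>G\<close>, the exponentials have a Gram matrix whose entries decay like the inverse square of the distance of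
  the frequencies, and Schur's test bounds its quadratic form.
\<close>

lemma bessel_exponentials:
  fixes h :: "real \<Rightarrow> complex"
  assumes T: "T > 0" and h: "continuous_on UNIV h" and ab: "0 < a" "b < T" "\<And>t. t \<notin> {a..b} \<Longrightarrow> h t = 0"
    and \<Gamma>: "\<Gamma> > 0" and sep: "separated \<Gamma> I \<nu>"
  obtains C where "C \<ge> 0" "\<And>F c. finite F \<Longrightarrow> F \<subseteq> I \<Longrightarrow>
    sq_norm T (\<lambda>t. \<Sum>j\<in>F. c j * (exp (- \<i> * of_real (\<nu> j * t)) * h t)) \<le> C * (\<Sum>j\<in>F. (norm (c j))\<^sup>2)"
proof -
  define G where "G t = flat (t - a / 2) * flat ((b + T) / 2 - t)" for t
  obtain X where X: "jet X" "\<And>t. X 0 t = G t" "\<And>m t. t \<notin> {a / 2..(b + T) / 2} \<Longrightarrow> X m t = 0"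
    unfolding G_def by (rule bump_jet[of 1 "a / 2" "(b + T) / 2"]) simp_all
  have sX: "supported_jet T X"
    unfolding supported_jet_def
  proof (intro conjI exI)
    show "0 < a / 2" "(b + T) / 2 < T" using ab by simp_all
  qed (use X in auto)
  define Y where "Y m t = complex_of_real (X m t)" for m t
  have sY: "supported_jet T Y"
    unfolding Y_def by (rule supported_jet_map[OF sX bounded_linear_of_real])
  have Gc: "continuous_on UNIV G"
  proof -
    have "X 0 = G" using X(2) by blast
    then show ?thesis using jet_continuous[OF X(1), of UNIV 0] by simp
  qed
  have G0: "0 \<le> G t" for t by (simp add: G_def flat_nonneg)
  have Gpos: "0 < G t" if "t \<in> {a..b}" for t
    using that ab unfolding G_def by (intro mult_pos_pos flat_pos) auto
  \<comment> \<open>\<open>M\<close> is the maximum of \<open>\<bar>h\<bar>\<^sup>2 / G\<close> over \<open>[a,b]\<close>.\<close>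
  obtain M where M: "0 \<le> M" "\<And>t. (norm (h t))\<^sup>2 \<le> M * G t"
  proof (cases "{a..b} = {}")
    case True
    then show ?thesis using that[of 0] ab(3) by simp
  next
    case False
    have "continuous_on {a..b} (\<lambda>t. (norm (h t))\<^sup>2 / G t)"
    proof (rule continuous_on_divide)
      show "continuous_on {a..b} (\<lambda>t. (norm (h t))\<^sup>2)"
        by (rule continuous_on_power[OF continuous_on_norm[OF continuous_on_subset[OF h]]]) simp
      show "continuous_on {a..b} G" by (rule continuous_on_subset[OF Gc]) simp
      show "\<forall>t\<in>{a..b}. G t \<noteq> 0" using Gpos by (metis less_irrefl)
    qed
    from continuous_attains_sup[OF compact_Icc False this]
    obtain s where s: "s \<in> {a..b}" "\<And>t. t \<in> {a..b} \<Longrightarrow> (norm (h t))\<^sup>2 / G t \<le> (norm (h s))\<^sup>2 / G s" by blast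
    show ?thesis
    proof (rule that[of "(norm (h s))\<^sup>2 / G s"])
      show "0 \<le> (norm (h s))\<^sup>2 / G s" using G0 by simp
      show "(norm (h t))\<^sup>2 \<le> (norm (h s))\<^sup>2 / G s * G t" for t
      proof (cases "t \<in> {a..b}")
        case True
        then show ?thesis using s(2)[OF True] Gpos[OF True] by (simp add: pos_divide_le_eq)
      next
        case False
        then show ?thesis using ab(3) G0 by simp
      qed
    qed
  qed
  obtain C0 where C0: "C0 \<ge> 0" "\<And>z. (1 + \<bar>z\<bar>) ^ 2 * norm (fourier T (Y 0) z) \<le> C0"
    using fourier_decay[OF T sY, of 2 0] by blast
  \<comment> \<open>A symmetric majorant of the Gram matrix.\<close>
  define D where "D j l = C0 / (1 + \<bar>\<nu> l - \<nu> j\<bar>)\<^sup>2" for j l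
  have D: "0 \<le> D j l" "D j l = D l j" for j l using C0(1) by (simp_all add: D_def abs_minus_commute)
  have DY: "norm (fourier T (Y 0) (\<nu> l - \<nu> j)) \<le> D j l" for j l
    using C0(2)[of "\<nu> l - \<nu> j"] by (simp add: D_def pos_le_divide_eq mult.commute)
  define B where "B = C0 * (1 + inv_sq_sum / \<Gamma>\<^sup>2)"
  have B: "(\<Sum>l\<in>F. D j l) \<le> B" if F: "finite F" "F \<subseteq> I" and j: "j \<in> F" for F j
  proof -
    have "(\<Sum>l\<in>F. D j l) = D j j + (\<Sum>l\<in>F - {j}. D j l)" using F j by (simp add: sum.remove)
    also have "(\<Sum>l\<in>F - {j}. D j l) \<le> (\<Sum>l\<in>F - {j}. C0 * (1 / (\<nu> l - \<nu> j)\<^sup>2))"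
    proof (rule sum_mono)
      fix l assume l: "l \<in> F - {j}"
      have "0 < \<Gamma> * \<bar>real_of_int (l - j)\<bar>" using l \<Gamma> by simp
      also have "\<dots> \<le> \<bar>\<nu> l - \<nu> j\<bar>" using sep l j F unfolding separated_def by blast
      finally have nz: "\<nu> l - \<nu> j \<noteq> 0" by simp
      have "(\<nu> l - \<nu> j)\<^sup>2 \<le> (1 + \<bar>\<nu> l - \<nu> j\<bar>)\<^sup>2"
        using power_mono[of "\<bar>\<nu> l - \<nu> j\<bar>" "1 + \<bar>\<nu> l - \<nu> j\<bar>" 2] by simp
      then have "1 / (1 + \<bar>\<nu> l - \<nu> j\<bar>)\<^sup>2 \<le> 1 / (\<nu> l - \<nu> j)\<^sup>2"
        using nz by (intro divide_left_mono) auto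
      from mult_left_mono[OF this C0(1)] show "D j l \<le> C0 * (1 / (\<nu> l - \<nu> j)\<^sup>2)" by (simp add: D_def)
    qed
    also have "\<dots> = C0 * (\<Sum>l\<in>F - {j}. 1 / (\<nu> l - \<nu> j)\<^sup>2)" by (rule sum_distrib_left[symmetric])
    also have "\<dots> \<le> C0 * (inv_sq_sum / \<Gamma>\<^sup>2)"
      using j F by (intro mult_left_mono separated_sum_le[OF \<Gamma> sep F] C0) auto
    also have "D j j = C0" by (simp add: D_def)
    finally show ?thesis by (simp add: B_def distrib_left)
  qed
  have main: "sq_norm T (\<lambda>t. \<Sum>j\<in>F. c j * (exp (- \<i> * of_real (\<nu> j * t)) * h t)) \<le> M * B * (\<Sum>j\<in>F. (norm (c j))\<^sup>2)"
    if F: "finite F" "F \<subseteq> I" for F c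
  proof -
    define P where "P t = (\<Sum>j\<in>F. c j * exp (- \<i> * of_real (\<nu> j * t)))" for t
    have Pc: "continuous_on UNIV P" unfolding P_def by (intro continuous_intros)
    have expand: "complex_of_real (G t * (norm (P t))\<^sup>2)
        = (\<Sum>j\<in>F. \<Sum>l\<in>F. c j * cnj (c l) * (Y 0 t * exp (\<i> * of_real ((\<nu> l - \<nu> j) * t))))" for t
    proof -
      have e: "exp (- \<i> * of_real (\<nu> j * t)) * cnj (exp (- \<i> * of_real (\<nu> l * t))) = exp (\<i> * of_real ((\<nu> l - \<nu> j) * t))" for j l
      proof -
        have "cnj (exp (- \<i> * of_real (\<nu> l * t))) = exp (\<i> * of_real (\<nu> l * t))"
          by (simp add: exp_cnj)
        moreover have "exp (- \<i> * of_real x) * exp (\<i> * of_real y) = exp (\<i> * of_real (y - x))" for x y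
          by (simp add: right_diff_distrib flip: exp_add)
        ultimately show ?thesis by (simp only: left_diff_distrib)
      qed
      have "complex_of_real (G t * (norm (P t))\<^sup>2) = Y 0 t * (P t * cnj (P t))"
        by (simp only: of_real_mult complex_norm_square Y_def X(2))
      also have "P t * cnj (P t) = (\<Sum>j\<in>F. \<Sum>l\<in>F. c j * exp (- \<i> * of_real (\<nu> j * t)) * (cnj (c l) * cnj (exp (- \<i> * of_real (\<nu> l * t)))))"
        unfolding P_def cnj_sum complex_cnj_mult by (rule sum_product)
      also have "\<dots> = (\<Sum>j\<in>F. \<Sum>l\<in>F. c j * cnj (c l) * exp (\<i> * of_real ((\<nu> l - \<nu> j) * t)))"
      proof (intro sum.cong refl)
        fix j l
        have "x * p * (y * q) = x * y * (p * q)" for x y p q :: complex by simp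
        then show "c j * exp (- \<i> * of_real (\<nu> j * t)) * (cnj (c l) * cnj (exp (- \<i> * of_real (\<nu> l * t))))
          = c j * cnj (c l) * exp (\<i> * of_real ((\<nu> l - \<nu> j) * t))" unfolding e[symmetric] .
      qed
      finally show ?thesis by (simp only: sum_distrib_left mult.left_commute[of "Y 0 t"])
    qed
    have Yi: "integrable (leb T) (\<lambda>t. Y 0 t * exp (\<i> * of_real (z * t)))" for z
      by (intro integrable_leb_continuous continuous_intros jet_continuous[OF supported_jet_jet[OF sY]])
    have "complex_of_real (\<integral>t. G t * (norm (P t))\<^sup>2 \<partial>leb T) = (\<integral>t. complex_of_real (G t * (norm (P t))\<^sup>2) \<partial>leb T)"
      by (rule integral_complex_of_real[symmetric])
    also have "\<dots> = (\<Sum>j\<in>F. \<Sum>l\<in>F. c j * cnj (c l) * fourier T (Y 0) (\<nu> l - \<nu> j))"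
      unfolding expand
    proof (subst Bochner_Integration.integral_sum)
      show "integrable (leb T) (\<lambda>t. \<Sum>l\<in>F. c j * cnj (c l) * (Y 0 t * exp (\<i> * of_real ((\<nu> l - \<nu> j) * t))))" for j
        by (intro Bochner_Integration.integrable_sum integrable_mult_right Yi)
      have "(\<integral>t. (\<Sum>l\<in>F. c j * cnj (c l) * (Y 0 t * exp (\<i> * of_real ((\<nu> l - \<nu> j) * t)))) \<partial>leb T)
          = (\<Sum>l\<in>F. c j * cnj (c l) * fourier T (Y 0) (\<nu> l - \<nu> j))" for j
        unfolding fourier_def
        by (subst Bochner_Integration.integral_sum)
           (intro integrable_mult_right Yi, simp only: integral_mult_right_zero)
      then show "(\<Sum>j\<in>F. \<integral>t. (\<Sum>l\<in>F. c j * cnj (c l) * (Y 0 t * exp (\<i> * of_real ((\<nu> l - \<nu> j) * t)))) \<partial>leb T)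
        = (\<Sum>j\<in>F. \<Sum>l\<in>F. c j * cnj (c l) * fourier T (Y 0) (\<nu> l - \<nu> j))" by (simp only:)
    qed
    finally have "\<bar>\<integral>t. G t * (norm (P t))\<^sup>2 \<partial>leb T\<bar> = norm (\<Sum>j\<in>F. \<Sum>l\<in>F. c j * cnj (c l) * fourier T (Y 0) (\<nu> l - \<nu> j))"
      by (simp only: norm_of_real[symmetric, where 'a=complex])
    also have "\<dots> \<le> (\<Sum>j\<in>F. \<Sum>l\<in>F. norm (c j) * norm (c l) * D j l)"
    proof (intro order_trans[OF norm_sum] sum_mono)
      fix j l
      have "norm (c j * cnj (c l) * fourier T (Y 0) (\<nu> l - \<nu> j)) = norm (c j) * norm (c l) * norm (fourier T (Y 0) (\<nu> l - \<nu> j))"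
        by (simp add: norm_mult)
      also have "\<dots> \<le> norm (c j) * norm (c l) * D j l" by (intro mult_left_mono DY) simp
      finally show "norm (c j * cnj (c l) * fourier T (Y 0) (\<nu> l - \<nu> j)) \<le> norm (c j) * norm (c l) * D j l" .
    qed
    also have "\<dots> \<le> B * (\<Sum>j\<in>F. (norm (c j))\<^sup>2)"
      by (rule schur_quadratic_form[OF F(1) D B[OF F]])
    finally have GP: "(\<integral>t. G t * (norm (P t))\<^sup>2 \<partial>leb T) \<le> B * (\<Sum>j\<in>F. (norm (c j))\<^sup>2)" by linarith
    have "sq_norm T (\<lambda>t. \<Sum>j\<in>F. c j * (exp (- \<i> * of_real (\<nu> j * t)) * h t)) = sq_norm T (\<lambda>t. P t * h t)"
      by (simp add: P_def sum_distrib_right mult.assoc)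
    also have "\<dots> \<le> (\<integral>t. M * (G t * (norm (P t))\<^sup>2) \<partial>leb T)"
      unfolding sq_norm_def
    proof (rule integral_mono)
      show "integrable (leb T) (\<lambda>t. (norm (P t * h t))\<^sup>2)" "integrable (leb T) (\<lambda>t. M * (G t * (norm (P t))\<^sup>2))"
        by (intro integrable_leb_continuous continuous_intros Pc h Gc)+
      show "(norm (P t * h t))\<^sup>2 \<le> M * (G t * (norm (P t))\<^sup>2)" for t
        using mult_right_mono[OF M(2)[of t], of "(norm (P t))\<^sup>2"]
        by (simp add: norm_mult power_mult_distrib ac_simps)
    qed
    also have "\<dots> \<le> M * (B * (\<Sum>j\<in>F. (norm (c j))\<^sup>2))"
      using mult_left_mono[OF GP M(1)] by simp
    finally show ?thesis by (simp add: mult.assoc)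
  qed
  have "B \<ge> 0" using C0(1) inv_sq_sum_pos by (simp add: B_def)
  with main M(1) show thesis by (intro that[of "M * B"]) auto
qed

text \<open>
  \<open>s\<close> is the order of the differential operator that has been applied to the modulated functions: \<open>m\<close>
  derivatives cost \<open>m + s\<close> powers of the frequency.
\<close>

definition bessel_family :: "real \<Rightarrow> int set \<Rightarrow> (int \<Rightarrow> real) \<Rightarrow> nat \<Rightarrow> (int \<Rightarrow> nat \<Rightarrow> real \<Rightarrow> complex) \<Rightarrow> bool" where
  "bessel_family T I \<nu> s f \<longleftrightarrow> (\<forall>m. \<exists>C\<ge>0. \<forall>F c. finite F \<longrightarrow> F \<subseteq> I \<longrightarrow>
     sq_norm T (\<lambda>t. \<Sum>j\<in>F. c j * f j m t) \<le> C * (\<Sum>j\<in>F. (norm (c j) * (1 + \<bar>\<nu> j\<bar>) ^ (m + s))\<^sup>2))"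

text \<open>
  Adding \<open>d\<^sub>j v\<^sub>j\<close> with \<open>d\<^sub>j = O(1 + \<bar>\<nu>\<^sub>j\<bar>)\<close> costs one power of the frequency. The factors \<open>d\<^sub>j\<close> are
  absorbed into the coefficients, which is possible because the bounds hold for all coefficients.
\<close>

lemma sq_norm_shift_sum:
  fixes u v :: "int \<Rightarrow> real \<Rightarrow> complex"
  assumes u: "\<And>j. continuous_on UNIV (u j)" and v: "\<And>j. continuous_on UNIV (v j)"
    and ub: "\<And>c. sq_norm T (\<lambda>t. \<Sum>j\<in>F. c j * u j t) \<le> C * (\<Sum>j\<in>F. (norm (c j) * (1 + \<bar>\<nu> j\<bar>) ^ Suc p)\<^sup>2)"
    and vb: "\<And>c. sq_norm T (\<lambda>t. \<Sum>j\<in>F. c j * v j t) \<le> C' * (\<Sum>j\<in>F. (norm (c j) * (1 + \<bar>\<nu> j\<bar>) ^ p)\<^sup>2)"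
    and d: "\<And>j. norm (d j) \<le> E * (1 + \<bar>\<nu> j\<bar>)" and E: "0 \<le> E" "0 \<le> C'"
  shows "sq_norm T (\<lambda>t. \<Sum>j\<in>F. c j * (u j t + d j * v j t))
    \<le> (2 * C + 2 * C' * E\<^sup>2) * (\<Sum>j\<in>F. (norm (c j) * (1 + \<bar>\<nu> j\<bar>) ^ Suc p)\<^sup>2)"
proof -
  have "(\<Sum>j\<in>F. (norm (c j * d j) * (1 + \<bar>\<nu> j\<bar>) ^ p)\<^sup>2) \<le> (\<Sum>j\<in>F. E\<^sup>2 * (norm (c j) * (1 + \<bar>\<nu> j\<bar>) ^ Suc p)\<^sup>2)"
  proof (rule sum_mono)
    fix j
    have "norm (c j * d j) * (1 + \<bar>\<nu> j\<bar>) ^ p \<le> norm (c j) * (E * (1 + \<bar>\<nu> j\<bar>)) * (1 + \<bar>\<nu> j\<bar>) ^ p"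
      unfolding norm_mult by (intro mult_right_mono mult_left_mono d) auto
    also have "\<dots> = E * (norm (c j) * (1 + \<bar>\<nu> j\<bar>) ^ Suc p)" by simp
    finally have "(norm (c j * d j) * (1 + \<bar>\<nu> j\<bar>) ^ p)\<^sup>2 \<le> (E * (norm (c j) * (1 + \<bar>\<nu> j\<bar>) ^ Suc p))\<^sup>2"
      by (intro power_mono) auto
    then show "(norm (c j * d j) * (1 + \<bar>\<nu> j\<bar>) ^ p)\<^sup>2 \<le> E\<^sup>2 * (norm (c j) * (1 + \<bar>\<nu> j\<bar>) ^ Suc p)\<^sup>2"
      by (simp only: power_mult_distrib)
  qed
  then have "C' * (\<Sum>j\<in>F. (norm (c j * d j) * (1 + \<bar>\<nu> j\<bar>) ^ p)\<^sup>2) \<le> C' * (E\<^sup>2 * (\<Sum>j\<in>F. (norm (c j) * (1 + \<bar>\<nu> j\<bar>) ^ Suc p)\<^sup>2))"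
    unfolding sum_distrib_left[symmetric] by (rule mult_left_mono[OF _ E(2)])
  then have vb': "sq_norm T (\<lambda>t. \<Sum>j\<in>F. (c j * d j) * v j t) \<le> C' * E\<^sup>2 * (\<Sum>j\<in>F. (norm (c j) * (1 + \<bar>\<nu> j\<bar>) ^ Suc p)\<^sup>2)"
    using vb[of "\<lambda>j. c j * d j"] by (simp only: mult.assoc)
  have "sq_norm T (\<lambda>t. \<Sum>j\<in>F. c j * (u j t + d j * v j t))
      = sq_norm T (\<lambda>t. (\<Sum>j\<in>F. c j * u j t) + (\<Sum>j\<in>F. (c j * d j) * v j t))"
    by (simp add: distrib_left sum.distrib mult.assoc)
  also have "\<dots> \<le> 2 * sq_norm T (\<lambda>t. \<Sum>j\<in>F. c j * u j t) + 2 * sq_norm T (\<lambda>t. \<Sum>j\<in>F. (c j * d j) * v j t)"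
    by (intro sq_norm_add_continuous continuous_intros u v)
  finally show ?thesis using ub[of c] vb' by (simp add: distrib_right)
qed

text \<open>
  The \<open>m\<close>-th derivative of \<open>exp (- \<i> \<nu>\<^sub>j t) X(t)\<close> involves the derivatives of \<open>X\<close> up to order \<open>m\<close>, so the
  induction on \<open>m\<close> treats all components of the jet \<open>X\<close> together.
\<close>

lemma bessel_family_modulate:
  assumes T: "T > 0" and X: "supported_jet T X" and \<Gamma>: "\<Gamma> > 0" and sep: "separated \<Gamma> I \<nu>"
  shows "bessel_family T I \<nu> 0 (\<lambda>j. modulate_jet (\<nu> j) X)"
proof -
  obtain a b where ab: "0 < a" "b < T" "\<And>m t. t \<notin> {a..b} \<Longrightarrow> X m t = 0"
    using X unfolding supported_jet_def by auto
  have c: "continuous_on UNIV (\<lambda>t. exp (- \<i> * of_real (\<nu> j * t)) * (shift_jet (- \<nu> j) ^^ m) X r t)" for j m r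
    by (intro continuous_intros jet_continuous[OF supported_jet_jet[OF supported_jet_shift_funpow[OF X]]])
  have "\<exists>C\<ge>0. \<forall>F c. finite F \<longrightarrow> F \<subseteq> I \<longrightarrow>
     sq_norm T (\<lambda>t. \<Sum>j\<in>F. c j * (exp (- \<i> * of_real (\<nu> j * t)) * (shift_jet (- \<nu> j) ^^ m) X r t))
       \<le> C * (\<Sum>j\<in>F. (norm (c j) * (1 + \<bar>\<nu> j\<bar>) ^ m)\<^sup>2)" for m r
  proof (induction m arbitrary: r)
    case 0
    obtain C where "C \<ge> 0" "\<And>F c. finite F \<Longrightarrow> F \<subseteq> I \<Longrightarrow>
      sq_norm T (\<lambda>t. \<Sum>j\<in>F. c j * (exp (- \<i> * of_real (\<nu> j * t)) * X r t)) \<le> C * (\<Sum>j\<in>F. (norm (c j))\<^sup>2)"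
      by (rule bessel_exponentials[OF T jet_continuous[OF supported_jet_jet[OF X], of _ r] ab \<Gamma> sep])
         (assumption | rule that)+
    then show ?case by (intro exI[of _ C]) simp
  next
    case (Suc m)
    obtain C where C: "C \<ge> 0" "\<And>F c. finite F \<Longrightarrow> F \<subseteq> I \<Longrightarrow>
       sq_norm T (\<lambda>t. \<Sum>j\<in>F. c j * (exp (- \<i> * of_real (\<nu> j * t)) * (shift_jet (- \<nu> j) ^^ m) X (Suc r) t))
       \<le> C * (\<Sum>j\<in>F. (norm (c j) * (1 + \<bar>\<nu> j\<bar>) ^ m)\<^sup>2)" using Suc by blast
    obtain C' where C': "C' \<ge> 0" "\<And>F c. finite F \<Longrightarrow> F \<subseteq> I \<Longrightarrow>
       sq_norm T (\<lambda>t. \<Sum>j\<in>F. c j * (exp (- \<i> * of_real (\<nu> j * t)) * (shift_jet (- \<nu> j) ^^ m) X r t))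
       \<le> C' * (\<Sum>j\<in>F. (norm (c j) * (1 + \<bar>\<nu> j\<bar>) ^ m)\<^sup>2)" using Suc by blast
    have "sq_norm T (\<lambda>t. \<Sum>j\<in>F. c j * (exp (- \<i> * of_real (\<nu> j * t)) * (shift_jet (- \<nu> j) ^^ Suc m) X r t))
       \<le> (2 * C + 2 * C' * 1\<^sup>2) * (\<Sum>j\<in>F. (norm (c j) * (1 + \<bar>\<nu> j\<bar>) ^ Suc m)\<^sup>2)"
      if F: "finite F" "F \<subseteq> I" for F c
    proof -
      have le: "C * (\<Sum>j\<in>F. (norm (c j) * (1 + \<bar>\<nu> j\<bar>) ^ m)\<^sup>2) \<le> C * (\<Sum>j\<in>F. (norm (c j) * (1 + \<bar>\<nu> j\<bar>) ^ Suc m)\<^sup>2)" for c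
        using C(1) by (intro mult_left_mono sum_mono power_mono mult_left_mono power_increasing) auto
      have "sq_norm T (\<lambda>t. \<Sum>j\<in>F. c j * (exp (- \<i> * of_real (\<nu> j * t)) * (shift_jet (- \<nu> j) ^^ m) X (Suc r) t
            + (\<i> * of_real (- \<nu> j)) * (exp (- \<i> * of_real (\<nu> j * t)) * (shift_jet (- \<nu> j) ^^ m) X r t)))
         \<le> (2 * C + 2 * C' * 1\<^sup>2) * (\<Sum>j\<in>F. (norm (c j) * (1 + \<bar>\<nu> j\<bar>) ^ Suc m)\<^sup>2)"
        by (rule sq_norm_shift_sum[OF c c order_trans[OF C(2)[OF F] le] C'(2)[OF F]])
           (use C'(1) in \<open>auto simp: norm_mult\<close>)
      moreover have "exp (- \<i> * of_real (\<nu> j * t)) * (shift_jet (- \<nu> j) ^^ Suc m) X r t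
          = exp (- \<i> * of_real (\<nu> j * t)) * (shift_jet (- \<nu> j) ^^ m) X (Suc r) t
            + (\<i> * of_real (- \<nu> j)) * (exp (- \<i> * of_real (\<nu> j * t)) * (shift_jet (- \<nu> j) ^^ m) X r t)" for j t
      proof -
        have "e * (u + d * v) = e * u + d * (e * v)" for e u d v :: complex
          by (simp add: distrib_left)
        then show ?thesis unfolding funpow.simps(2) o_apply shift_jet_def[of _ "(shift_jet (- \<nu> j) ^^ m) X"] .
      qed
      ultimately show ?thesis by (simp only:)
    qed
    then show ?case using C C' by (intro exI[of _ "2 * C + 2 * C' * 1\<^sup>2"]) simp
  qed
  from this[of _ 0] show ?thesis
    unfolding bessel_family_def modulate_jet_def add_0_right by blast
qed

lemma bessel_family_shift:
  assumes f: "\<And>j. jet (f j)" and b: "bessel_family T I \<nu> s f"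
  shows "bessel_family T I \<nu> (Suc s) (\<lambda>j. shift_jet \<mu> (f j))"
  unfolding bessel_family_def
proof
  fix m
  obtain C where C: "C \<ge> 0" "\<And>F c. finite F \<Longrightarrow> F \<subseteq> I \<Longrightarrow>
      sq_norm T (\<lambda>t. \<Sum>j\<in>F. c j * f j (Suc m) t) \<le> C * (\<Sum>j\<in>F. (norm (c j) * (1 + \<bar>\<nu> j\<bar>) ^ Suc (m + s))\<^sup>2)"
    using b[unfolded bessel_family_def, rule_format, of "Suc m"] unfolding add_Suc by blast
  obtain C' where C': "C' \<ge> 0" "\<And>F c. finite F \<Longrightarrow> F \<subseteq> I \<Longrightarrow>
      sq_norm T (\<lambda>t. \<Sum>j\<in>F. c j * f j m t) \<le> C' * (\<Sum>j\<in>F. (norm (c j) * (1 + \<bar>\<nu> j\<bar>) ^ (m + s))\<^sup>2)"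
    using b unfolding bessel_family_def by blast
  have "sq_norm T (\<lambda>t. \<Sum>j\<in>F. c j * shift_jet \<mu> (f j) m t)
      \<le> (2 * C + 2 * C' * \<bar>\<mu>\<bar>\<^sup>2) * (\<Sum>j\<in>F. (norm (c j) * (1 + \<bar>\<nu> j\<bar>) ^ (m + Suc s))\<^sup>2)"
    if F: "finite F" "F \<subseteq> I" for F c
    unfolding shift_jet_def add_Suc_right
    by (rule sq_norm_shift_sum[OF jet_continuous[OF f] jet_continuous[OF f] C(2)[OF F] C'(2)[OF F]])
       (use C'(1) mult_left_mono[of 1 "1 + \<bar>\<nu> j\<bar>" "\<bar>\<mu>\<bar>" for j] in \<open>auto simp: norm_mult\<close>)
  then show "\<exists>C\<ge>0. \<forall>F c. finite F \<longrightarrow> F \<subseteq> I \<longrightarrow> sq_norm T (\<lambda>t. \<Sum>j\<in>F. c j * shift_jet \<mu> (f j) m t)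
      \<le> C * (\<Sum>j\<in>F. (norm (c j) * (1 + \<bar>\<nu> j\<bar>) ^ (m + Suc s))\<^sup>2)"
    using C(1) C'(1) by (intro exI[of _ "2 * C + 2 * C' * \<bar>\<mu>\<bar>\<^sup>2"]) simp
qed

lemma bessel_family_shift_list:
  assumes "T > 0" "supported_jet T X" "\<Gamma> > 0" "separated \<Gamma> I \<nu>"
  shows "bessel_family T I \<nu> (length \<mu>s) (\<lambda>j. shift_list \<mu>s (modulate_jet (\<nu> j) X))"
proof (induction \<mu>s)
  case Nil
  show ?case using bessel_family_modulate[OF assms] by simp
next
  case (Cons \<mu> \<mu>s)
  have "jet (shift_list \<mu>s (modulate_jet (\<nu> j) X))" for j
    by (rule supported_jet_jet[OF supported_jet_shift_list[OF supported_jet_modulate[OF assms(2)]]])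
  from bessel_family_shift[OF this Cons] show ?case by simp
qed

section \<open>The frequencies\<close>

text \<open>
  \<open>c j\<^sup>\<epsilon>\<close> exceeds \<open>\<Gamma>\<close> as soon as \<open>j\<close> exceeds the power of \<open>\<Gamma> / c\<close> with exponent \<open>1/\<epsilon>\<close>. Arbitrarily large gaps
  are what makes the Gram kernel small.
\<close>

lemma gaps_unbounded:
  fixes \<omega> :: "nat \<Rightarrow> real"
  assumes "\<exists>\<epsilon>>0. \<exists>N\<^sub>0::nat. \<exists>c>0. \<forall>j\<ge>N\<^sub>0. \<omega> (Suc j) - \<omega> j \<ge> c * real j powr \<epsilon>"
  obtains N where "\<And>j. j \<ge> N \<Longrightarrow> \<Gamma> \<le> \<omega> (Suc j) - \<omega> j"
proof -
  obtain \<epsilon> N0 c where h: "\<epsilon> > 0" "c > 0" "\<And>j. j \<ge> N0 \<Longrightarrow> \<omega> (Suc j) - \<omega> j \<ge> c * real j powr \<epsilon>"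
    using assms by blast
  define x where "x = max 1 \<Gamma> / c"
  have x: "x > 0" using h by (simp add: x_def)
  show thesis
  proof (rule that[of "max N0 (nat \<lceil>x powr (1 / \<epsilon>)\<rceil>)"])
    fix j assume j: "j \<ge> max N0 (nat \<lceil>x powr (1 / \<epsilon>)\<rceil>)"
    then have "x powr (1 / \<epsilon>) \<le> real j" by (simp add: nat_le_iff ceiling_le_iff)
    then have "(x powr (1 / \<epsilon>)) powr \<epsilon> \<le> real j powr \<epsilon>" using h by (intro powr_mono2) auto
    then have "x \<le> real j powr \<epsilon>" using h x by (simp add: powr_powr)
    then have "c * x \<le> c * real j powr \<epsilon>" using h by simp
    moreover have "\<Gamma> \<le> c * x" using h by (simp add: x_def)
    ultimately show "\<Gamma> \<le> \<omega> (Suc j) - \<omega> j" using h(3)[of j] j by simp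
  qed
qed

lemma gaps_sum:
  fixes \<omega> :: "nat \<Rightarrow> real"
  assumes "\<And>j. j \<ge> N \<Longrightarrow> \<Gamma> \<le> \<omega> (Suc j) - \<omega> j" "N \<le> l" "l \<le> j"
  shows "\<Gamma> * (real j - real l) \<le> \<omega> j - \<omega> l"
  using assms(3)
proof (induction j rule: dec_induct)
  case (step i)
  have "\<Gamma> \<le> \<omega> (Suc i) - \<omega> i" using assms step by auto
  then show ?case using step by (simp add: algebra_simps)
qed simp

text \<open>
  If \<open>j\<close> and \<open>l\<close> have opposite signs, \<open>\<nu>\<^sub>j - \<nu>\<^sub>l\<close> is a sum of two values of \<open>\<omega>\<close>, and the gaps below \<open>N\<close> are
  not controlled; this is what the linear lower bound is for.
\<close>

lemma omega_ext_separated: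
  assumes gap: "\<And>l j. N \<le> l \<Longrightarrow> l \<le> j \<Longrightarrow> \<Gamma> * (real j - real l) \<le> \<omega> j - \<omega> l"
    and lin: "\<And>j. N \<le> j \<Longrightarrow> \<Gamma> * real j \<le> \<omega> j" and \<Gamma>: "\<Gamma> \<ge> 0"
  shows "separated \<Gamma> {j. int N \<le> \<bar>j\<bar>} (omega_ext \<omega>)"
proof -
  have *: "\<Gamma> * real_of_int (j - l) \<le> omega_ext \<omega> j - omega_ext \<omega> l"
    if "int N \<le> \<bar>j\<bar>" "int N \<le> \<bar>l\<bar>" "l \<le> j" for j l
  proof -
    consider "0 \<le> l" | "j < 0" | "l < 0" "0 \<le> j" by linarith
    then show ?thesis
    proof cases
      case 1
      then have "N \<le> nat l" "nat l \<le> nat j" using that by auto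
      from gap[OF this] show ?thesis using 1 that by (simp add: omega_ext_def)
    next
      case 2
      then have "N \<le> nat (- j)" "nat (- j) \<le> nat (- l)" using that by auto
      from gap[OF this] show ?thesis using 2 that by (simp add: omega_ext_def)
    next
      case 3
      have "N \<le> nat j" "N \<le> nat (- l)" using 3 that by auto
      from lin[OF this(1)] lin[OF this(2)] show ?thesis using 3 by (simp add: omega_ext_def right_diff_distrib)
    qed
  qed
  show ?thesis unfolding separated_def
  proof (intro ballI)
    fix j l assume jl: "j \<in> {j. int N \<le> \<bar>j\<bar>}" "l \<in> {j. int N \<le> \<bar>j\<bar>}"
    show "\<Gamma> * \<bar>real_of_int (j - l)\<bar> \<le> \<bar>omega_ext \<omega> j - omega_ext \<omega> l\<bar>"
    proof (cases "l \<le> j")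
      case True
      then have "\<bar>real_of_int (j - l)\<bar> = real_of_int (j - l)" by simp
      then show ?thesis using *[of j l] True jl by simp
    next
      case False
      then have "\<bar>real_of_int (j - l)\<bar> = real_of_int (l - j)" by simp
      then show ?thesis using *[of l j] False jl by simp
    qed
  qed
qed

text \<open>
  All but finitely many gaps are at least \<open>1\<close>, and the others are positive.
\<close>

lemma omega_ext_separated_UNIV:
  fixes \<omega> :: "nat \<Rightarrow> real"
  assumes "strict_mono \<omega>" "\<omega> 0 = 0"
    and "\<exists>\<epsilon>>0. \<exists>N\<^sub>0::nat. \<exists>c>0. \<forall>j\<ge>N\<^sub>0. \<omega> (Suc j) - \<omega> j \<ge> c * real j powr \<epsilon>"
  obtains \<gamma> where "\<gamma> > 0" "separated \<gamma> UNIV (omega_ext \<omega>)"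
proof -
  obtain N where N: "\<And>j. j \<ge> N \<Longrightarrow> 1 \<le> \<omega> (Suc j) - \<omega> j" by (rule gaps_unbounded[OF assms(3)]) (rule that)
  \<comment> \<open>The entry \<open>1\<close> bounds the gaps from index \<open>N\<close> on.\<close>
  define \<gamma> where "\<gamma> = Min (insert 1 ((\<lambda>j. \<omega> (Suc j) - \<omega> j) ` {..<N}))"
  have pos: "\<gamma> > 0"
    unfolding \<gamma>_def using assms(1) by (subst Min_gr_iff) (auto simp: strict_mono_def)
  have gap: "\<gamma> \<le> \<omega> (Suc j) - \<omega> j" for j
  proof (cases "j < N")
    case True
    then show ?thesis unfolding \<gamma>_def by (intro Min_le) auto
  next
    case False
    have "\<gamma> \<le> 1" unfolding \<gamma>_def by (intro Min_le) auto
    then show ?thesis using N[of j] False by simp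
  qed
  have g: "\<gamma> * (real j - real l) \<le> \<omega> j - \<omega> l" if "l \<le> j" for j l
    by (rule gaps_sum[where N=0]) (use gap that in auto)
  have "separated \<gamma> {j. int 0 \<le> \<bar>j\<bar>} (omega_ext \<omega>)"
    by (rule omega_ext_separated) (use g g[of 0] assms(2) pos in auto)
  with pos show thesis using that by simp
qed

text \<open>
  If the gaps beyond \<open>N\<close> are at least \<open>2 \<Gamma>\<close>, then \<open>\<omega>\<^sub>j \<ge> 2 \<Gamma> (j - N) \<ge> \<Gamma> j\<close> for \<open>j \<ge> 2 N\<close>.
\<close>

lemma omega_ext_separated_high:
  fixes \<omega> :: "nat \<Rightarrow> real"
  assumes "\<And>j. \<omega> j \<ge> 0"
    and "\<exists>\<epsilon>>0. \<exists>N\<^sub>0::nat. \<exists>c>0. \<forall>j\<ge>N\<^sub>0. \<omega> (Suc j) - \<omega> j \<ge> c * real j powr \<epsilon>" and \<Gamma>: "\<Gamma> > 0"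
  obtains N where "N \<ge> 1" "separated \<Gamma> {j. int N \<le> \<bar>j\<bar>} (omega_ext \<omega>)"
proof -
  obtain N where N: "\<And>j. j \<ge> N \<Longrightarrow> 2 * \<Gamma> \<le> \<omega> (Suc j) - \<omega> j" by (rule gaps_unbounded[OF assms(2)]) (rule that)
  have "separated \<Gamma> {j. int (2 * N + 1) \<le> \<bar>j\<bar>} (omega_ext \<omega>)"
  proof (rule omega_ext_separated)
    fix l j :: nat assume "2 * N + 1 \<le> l" "l \<le> j"
    have "\<Gamma> \<le> \<omega> (Suc i) - \<omega> i" if "i \<ge> N" for i using N[OF that] \<Gamma> by linarith
    then show "\<Gamma> * (real j - real l) \<le> \<omega> j - \<omega> l"
      by (rule gaps_sum) (use \<open>2 * N + 1 \<le> l\<close> \<open>l \<le> j\<close> in auto)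
  next
    fix j :: nat assume j: "2 * N + 1 \<le> j"
    have "\<Gamma> * real j \<le> \<Gamma> * (2 * (real j - real N))" using j \<Gamma> by (intro mult_left_mono) auto
    also have "\<dots> = (2 * \<Gamma>) * (real j - real N)" by simp
    also have "\<dots> \<le> \<omega> j - \<omega> N" by (rule gaps_sum[where N=N]) (use N j in auto)
    also have "\<dots> \<le> \<omega> j" using assms(1)[of N] by simp
    finally show "\<Gamma> * real j \<le> \<omega> j" .
  qed (use \<Gamma> in simp)
  then show thesis by (intro that[of "2 * N + 1"]) auto
qed

section \<open>Solving the high-frequency moments\<close>

lemma LIMSEQ_sum_window:
  assumes "(f :: int \<Rightarrow> complex) summable_on I"
  shows "(\<lambda>M. \<Sum>j\<in>I \<inter> {- int M..int M}. f j) \<longlonglongrightarrow> infsum f I"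
proof (rule filterlim_compose[OF infsum_tendsto[OF assms]])
  show "filterlim (\<lambda>M. I \<inter> {- int M..int M}) (finite_subsets_at_top I) sequentially"
    unfolding filterlim_finite_subsets_at_top
  proof (intro allI impI)
    fix F assume F: "finite F \<and> F \<subseteq> I"
    obtain M0 :: nat where M0: "\<And>j. j \<in> F \<Longrightarrow> \<bar>j\<bar> \<le> int M0"
    proof (rule that)
      fix j assume "j \<in> F"
      then have "nat \<bar>j\<bar> \<le> (\<Sum>i\<in>F. nat \<bar>i\<bar>)" using F by (intro member_le_sum) auto
      then show "\<bar>j\<bar> \<le> int (\<Sum>i\<in>F. nat \<bar>i\<bar>)" by linarith
    qed
    show "\<forall>\<^sub>F M in sequentially. finite (I \<inter> {- int M..int M}) \<and> F \<subseteq> I \<inter> {- int M..int M} \<and> I \<inter> {- int M..int M} \<subseteq> I"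
      using eventually_ge_at_top[of M0]
    proof eventually_elim
      case (elim M)
      then have "\<bar>j\<bar> \<le> int M" if "j \<in> F" for j using M0[OF that] by linarith
      then have "j \<in> {- int M..int M}" if "j \<in> F" for j using that by (fastforce simp: abs_le_iff)
      then show ?case using F by blast
    qed
  qed
qed

lemma weighted_l2_weight_mono:
  assumes "weighted_l2 \<rho> I y S" "\<And>j. j \<in> I \<Longrightarrow> 0 \<le> \<rho>' j * norm (z j) \<and> \<rho>' j * norm (z j) \<le> c * (\<rho> j * norm (y j))" "0 \<le> c"
  shows "weighted_l2 \<rho>' I z (c * S)"
  unfolding weighted_l2_def
proof (intro allI impI)
  fix F assume F: "finite F" "F \<subseteq> I"
  have "L2_set (\<lambda>j. \<rho>' j * norm (z j)) F \<le> L2_set (\<lambda>j. c * (\<rho> j * norm (y j))) F"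
    by (rule L2_set_mono) (use assms(2) F in auto)
  also have "\<dots> = c * L2_set (\<lambda>j. \<rho> j * norm (y j)) F" by (simp add: L2_set_right_distrib assms(3))
  also have "\<dots> \<le> c * S" by (intro mult_left_mono weighted_l2D[OF assms(1) F] assms(3))
  finally show "L2_set (\<lambda>j. \<rho>' j * norm (z j)) F \<le> c * S" .
qed

text \<open>
  Write \<open>p\<close> for the symbol of \<open>\<mu>s\<close>. The moment at \<open>\<nu>\<^sub>l\<close> of the series with coefficients \<open>y\<close> is
  \<open>p(\<nu>\<^sub>l) (y\<^sub>l + (K y)\<^sub>l)\<close>, so prescribing the moments \<open>\<beta>\<close> means solving \<open>y + K y = \<beta> / p\<close>. The division by
  \<open>p\<close> improves the weight by \<open>length \<mu>s\<close> powers, exactly the loss in the Bessel inequality for the shifted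
  functions. Uniqueness of \<open>y\<close> gives linearity.
\<close>

lemma gram_solver:
  assumes T: "T > 0" and X: "supported_jet T X" and X1: "fourier T (X 0) 0 = 1"
    and R: "R \<ge> 1"
    and K: "\<And>p. p \<le> k + length \<mu>s \<Longrightarrow> schur_half I (gram_kernel T \<nu> (X 0)) (\<lambda>j. (1 + \<bar>\<nu> j\<bar> / R) ^ p)"
    and c0: "c0 > 0"
    and low: "\<And>j. j \<in> I \<Longrightarrow> c0 * (1 + \<bar>\<nu> j\<bar>) ^ length \<mu>s \<le> norm (symbol \<mu>s (\<nu> j))"
  obtains Y C where "C \<ge> 0"
    "\<And>\<beta> \<beta>' S S' j. weighted_l2 (\<lambda>_. 1) I \<beta> S \<Longrightarrow> weighted_l2 (\<lambda>_. 1) I \<beta>' S' \<Longrightarrow> j \<in> I \<Longrightarrow>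
      Y (\<lambda>j. \<beta> j + \<beta>' j) j = Y \<beta> j + Y \<beta>' j"
    "\<And>\<beta> c S j. weighted_l2 (\<lambda>_. 1) I \<beta> S \<Longrightarrow> j \<in> I \<Longrightarrow> Y (\<lambda>j. c * \<beta> j) j = c * Y \<beta> j"
    "\<And>\<beta> m S. m \<le> k \<Longrightarrow> weighted_l2 (\<lambda>j. (1 + \<bar>\<nu> j\<bar>) ^ m) I \<beta> S \<Longrightarrow>
      weighted_l2 (\<lambda>j. (1 + \<bar>\<nu> j\<bar>) ^ (m + length \<mu>s)) I (Y \<beta>) (C * S)"
    "\<And>\<beta> S l. weighted_l2 (\<lambda>_. 1) I \<beta> S \<Longrightarrow> l \<in> I \<Longrightarrow>
      (\<lambda>M. \<Sum>j\<in>I \<inter> {- int M..int M}. Y \<beta> j * fourier T (shift_list \<mu>s (modulate_jet (\<nu> j) X) 0) (\<nu> l)) \<longlonglongrightarrow> \<beta> l"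
proof -
  let ?K = "gram_kernel T \<nu> (X 0)" and ?D = "length \<mu>s" and ?p = "\<lambda>j. symbol \<mu>s (\<nu> j)"
  have K1: "schur_half I ?K (\<lambda>_. 1)" using K[of 0] by simp
  have p0: "?p j \<noteq> 0" if "j \<in> I" for j
  proof -
    have "0 < c0 * (1 + \<bar>\<nu> j\<bar>) ^ ?D" using c0 by (simp add: add_pos_nonneg)
    then show ?thesis using low[OF that] by auto
  qed
  have bound_b: "weighted_l2 (\<lambda>j. (1 + \<bar>\<nu> j\<bar> / R) ^ (m + ?D)) I (\<lambda>j. \<beta> j / ?p j) (1 / c0 * S)"
    if \<beta>: "weighted_l2 (\<lambda>j. (1 + \<bar>\<nu> j\<bar>) ^ m) I \<beta> S" for \<beta> m S
  proof (rule weighted_l2_weight_mono[OF \<beta>], intro conjI)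
    fix j assume j: "j \<in> I"
    show "0 \<le> (1 + \<bar>\<nu> j\<bar> / R) ^ (m + ?D) * norm (\<beta> j / ?p j)" using R by simp
    have "\<bar>\<nu> j\<bar> / R \<le> \<bar>\<nu> j\<bar> / 1" using R by (intro divide_left_mono) auto
    then have "(1 + \<bar>\<nu> j\<bar> / R) ^ (m + ?D) \<le> (1 + \<bar>\<nu> j\<bar>) ^ (m + ?D)" using R by (intro power_mono) auto
    then have "(1 + \<bar>\<nu> j\<bar> / R) ^ (m + ?D) * norm (\<beta> j / ?p j) \<le> (1 + \<bar>\<nu> j\<bar>) ^ (m + ?D) * (norm (\<beta> j) / norm (?p j))"
      unfolding norm_divide by (intro mult_right_mono) auto
    also have "\<dots> \<le> (1 + \<bar>\<nu> j\<bar>) ^ (m + ?D) * (norm (\<beta> j) / (c0 * (1 + \<bar>\<nu> j\<bar>) ^ ?D))"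
      using low[OF j] c0 p0[OF j]
      by (intro mult_left_mono divide_left_mono mult_pos_pos) (auto simp: add_pos_nonneg)
    also have "\<dots> = 1 / c0 * ((1 + \<bar>\<nu> j\<bar>) ^ m * norm (\<beta> j))"
    proof -
      have "0 < 1 + \<bar>\<nu> j\<bar>" by (simp add: add_pos_nonneg)
      then have "(1 + \<bar>\<nu> j\<bar>) ^ ?D \<noteq> 0" by simp
      then show ?thesis by (simp add: power_add del: power_eq_0_iff)
    qed
    finally show "(1 + \<bar>\<nu> j\<bar> / R) ^ (m + ?D) * norm (\<beta> j / ?p j) \<le> 1 / c0 * ((1 + \<bar>\<nu> j\<bar>) ^ m * norm (\<beta> j))" .
  qed (use c0 in simp)
  have b1: "weighted_l2 (\<lambda>_. 1) I (\<lambda>j. \<beta> j / ?p j) (1 / c0 * S)" if "weighted_l2 (\<lambda>_. 1) I \<beta> S" for \<beta> S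
  proof -
    have "weighted_l2 (\<lambda>j. (1 + \<bar>\<nu> j\<bar> / R) ^ (0 + ?D)) I (\<lambda>j. \<beta> j / ?p j) (1 / c0 * S)"
      by (rule bound_b) (use that in simp)
    from weighted_l2_weight_mono[OF this, of "\<lambda>_. 1" "\<lambda>j. \<beta> j / ?p j" 1]
    show ?thesis using R by (simp add: mult_le_cancel_right1 one_le_power del: norm_divide)
  qed
  define solves where "solves \<beta> y \<longleftrightarrow> (\<forall>l\<in>I. y l + kernel_op I ?K y l = \<beta> l / ?p l) \<and> (\<exists>S. weighted_l2 (\<lambda>_. 1) I y S)" for \<beta> y
  define Y where "Y \<beta> = (SOME y. solves \<beta> y)" for \<beta>
  have unique: "y j = z j" if y: "solves \<beta> y" and z: "solves \<beta> z" and j: "j \<in> I" for \<beta> y z j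
  proof -
    obtain S S' where S: "weighted_l2 (\<lambda>_. 1) I y S" "weighted_l2 (\<lambda>_. 1) I z S'"
      using y z unfolding solves_def by blast
    have d: "weighted_l2 (\<lambda>_. 1) I (\<lambda>j. y j + - z j) (S + S')"
      by (intro weighted_l2_add S weighted_l2_uminus[THEN iffD2]) simp
    have "(\<lambda>j. y j + - z j) j = 0"
    proof (rule perturbed_identity_injective[OF K1 d _ j])
      fix l assume l: "l \<in> I"
      have "y l + kernel_op I ?K y l = z l + kernel_op I ?K z l" using y z l unfolding solves_def by simp
      then show "y l + - z l + kernel_op I ?K (\<lambda>j. y j + - z j) l = 0"
      proof -
        have "a + u = b + v \<Longrightarrow> a + - b + (u - v) = 0" for a b u v :: complex
          by (simp add: algebra_simps)
        moreover have "kernel_op I ?K (\<lambda>j. y j + - z j) l = kernel_op I ?K y l - kernel_op I ?K z l"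
          using kernel_op_diff[OF K1 S l] by simp
        ultimately show ?thesis using \<open>y l + _ = z l + _\<close> by metis
      qed
    qed
    then show ?thesis by simp
  qed
  have ex: "\<exists>y. solves \<beta> y \<and> (\<forall>\<rho> S. schur_half I ?K \<rho> \<longrightarrow> weighted_l2 \<rho> I (\<lambda>j. \<beta> j / ?p j) S \<longrightarrow> weighted_l2 \<rho> I y (2 * S))"
    if \<beta>: "weighted_l2 (\<lambda>_. 1) I \<beta> S" for \<beta> S
  proof -
    obtain y where y: "\<And>l. l \<in> I \<Longrightarrow> y l + kernel_op I ?K y l = \<beta> l / ?p l"
      "\<And>\<rho> S. schur_half I ?K \<rho> \<Longrightarrow> weighted_l2 \<rho> I (\<lambda>j. \<beta> j / ?p j) S \<Longrightarrow> weighted_l2 \<rho> I y (2 * S)"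
      by (rule perturbed_identity_solvable[OF K1 b1[OF \<beta>]]) (rule that)
    then have "solves \<beta> y" unfolding solves_def using y(2)[OF K1 b1[OF \<beta>]] by blast
    then show ?thesis using y by blast
  qed
  have Y: "solves \<beta> (Y \<beta>)" if "weighted_l2 (\<lambda>_. 1) I \<beta> S" for \<beta> S
    unfolding Y_def using ex[OF that] by (metis someI_ex)
  have Yb: "weighted_l2 \<rho> I (Y \<beta>) (2 * S')"
    if \<beta>: "weighted_l2 (\<lambda>_. 1) I \<beta> S" and \<rho>: "schur_half I ?K \<rho>" "weighted_l2 \<rho> I (\<lambda>j. \<beta> j / ?p j) S'" for \<beta> S \<rho> S'
  proof -
    obtain y where y: "solves \<beta> y" "weighted_l2 \<rho> I y (2 * S')" using ex[OF \<beta>] \<rho> by blast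
    have "norm (Y \<beta> j) = norm (y j)" if "j \<in> I" for j using unique[OF Y[OF \<beta>] y(1) that] by simp
    then show ?thesis using y(2) weighted_l2_cong[of I "Y \<beta>" y \<rho>] by blast
  qed
  show thesis
  proof (rule that[of "R ^ (k + ?D) * (2 / c0)" Y])
    show "0 \<le> R ^ (k + ?D) * (2 / c0)" using R c0 by simp
  next
    fix \<beta> \<beta>' S S' j
    assume \<beta>: "weighted_l2 (\<lambda>_. 1) I \<beta> S" and \<beta>': "weighted_l2 (\<lambda>_. 1) I \<beta>' S'" and j: "j \<in> I"
    obtain A A' where A: "weighted_l2 (\<lambda>_. 1) I (Y \<beta>) A" "weighted_l2 (\<lambda>_. 1) I (Y \<beta>') A'"
      using Y[OF \<beta>] Y[OF \<beta>'] unfolding solves_def by blast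
    have s: "weighted_l2 (\<lambda>_. 1) I (\<lambda>j. \<beta> j + \<beta>' j) (S + S')" by (intro weighted_l2_add \<beta> \<beta>') simp
    have "solves (\<lambda>j. \<beta> j + \<beta>' j) (\<lambda>j. Y \<beta> j + Y \<beta>' j)"
      unfolding solves_def
    proof (intro conjI ballI exI)
      show "weighted_l2 (\<lambda>_. 1) I (\<lambda>j. Y \<beta> j + Y \<beta>' j) (A + A')" by (intro weighted_l2_add A) simp
      fix l assume l: "l \<in> I"
      have "Y \<beta> l + kernel_op I ?K (Y \<beta>) l = \<beta> l / ?p l" "Y \<beta>' l + kernel_op I ?K (Y \<beta>') l = \<beta>' l / ?p l"
        using Y[OF \<beta>] Y[OF \<beta>'] l unfolding solves_def by blast+
      then show "Y \<beta> l + Y \<beta>' l + kernel_op I ?K (\<lambda>j. Y \<beta> j + Y \<beta>' j) l = (\<beta> l + \<beta>' l) / ?p l"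
        unfolding kernel_op_add[OF K1 A l] add_divide_distrib by (metis add.assoc add.left_commute)
    qed
    from unique[OF Y[OF s] this j] show "Y (\<lambda>j. \<beta> j + \<beta>' j) j = Y \<beta> j + Y \<beta>' j" .
  next
    fix \<beta> c S j assume \<beta>: "weighted_l2 (\<lambda>_. 1) I \<beta> S" and j: "j \<in> I"
    obtain A where A: "weighted_l2 (\<lambda>_. 1) I (Y \<beta>) A"
      using Y[OF \<beta>] unfolding solves_def by blast
    have "solves (\<lambda>j. c * \<beta> j) (\<lambda>j. c * Y \<beta> j)"
      unfolding solves_def
    proof (intro conjI ballI exI)
      show "weighted_l2 (\<lambda>_. 1) I (\<lambda>j. c * Y \<beta> j) (norm c * A)" by (rule weighted_l2_scale[OF A])
      fix l assume l: "l \<in> I"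
      have "Y \<beta> l + kernel_op I ?K (Y \<beta>) l = \<beta> l / ?p l"
        using Y[OF \<beta>] l unfolding solves_def by blast
      then show "c * Y \<beta> l + kernel_op I ?K (\<lambda>j. c * Y \<beta> j) l = c * \<beta> l / ?p l"
        unfolding kernel_op_scale by (metis distrib_left times_divide_eq_right)
    qed
    from unique[OF Y[OF weighted_l2_scale[OF \<beta>]] this j] show "Y (\<lambda>j. c * \<beta> j) j = c * Y \<beta> j" .
  next
    fix \<beta> m S assume m: "m \<le> k" and \<beta>: "weighted_l2 (\<lambda>j. (1 + \<bar>\<nu> j\<bar>) ^ m) I \<beta> S"
    have \<beta>1: "weighted_l2 (\<lambda>_. 1) I \<beta> (1 * S)"
      by (rule weighted_l2_weight_mono[OF \<beta>]) (auto simp: mult_le_cancel_right1 one_le_power)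
    have "weighted_l2 (\<lambda>j. (1 + \<bar>\<nu> j\<bar> / R) ^ (m + ?D)) I (Y \<beta>) (2 * (1 / c0 * S))"
      by (rule Yb[OF \<beta>1 K bound_b[OF \<beta>]]) (use m in simp)
    then have "weighted_l2 (\<lambda>j. (1 + \<bar>\<nu> j\<bar>) ^ (m + ?D)) I (Y \<beta>) (R ^ (k + ?D) * (2 * (1 / c0 * S)))"
    proof (rule weighted_l2_weight_mono, intro conjI)
      fix j
      show "0 \<le> (1 + \<bar>\<nu> j\<bar>) ^ (m + ?D) * norm (Y \<beta> j)" by simp
      have "1 + \<bar>\<nu> j\<bar> \<le> R * (1 + \<bar>\<nu> j\<bar> / R)" using R by (simp add: distrib_left)
      then have "(1 + \<bar>\<nu> j\<bar>) ^ (m + ?D) \<le> (R * (1 + \<bar>\<nu> j\<bar> / R)) ^ (m + ?D)" by (intro power_mono) auto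
      also have "\<dots> \<le> R ^ (k + ?D) * (1 + \<bar>\<nu> j\<bar> / R) ^ (m + ?D)"
        unfolding power_mult_distrib using R m by (intro mult_right_mono power_increasing) auto
      finally show "(1 + \<bar>\<nu> j\<bar>) ^ (m + ?D) * norm (Y \<beta> j) \<le> R ^ (k + ?D) * ((1 + \<bar>\<nu> j\<bar> / R) ^ (m + ?D) * norm (Y \<beta> j))"
        unfolding mult.assoc[symmetric] by (intro mult_right_mono) auto
    qed (use R in simp)
    then show "weighted_l2 (\<lambda>j. (1 + \<bar>\<nu> j\<bar>) ^ (m + ?D)) I (Y \<beta>) (R ^ (k + ?D) * (2 / c0) * S)"
      by (simp add: mult.assoc)
  next
    fix \<beta> S l assume \<beta>: "weighted_l2 (\<lambda>_. 1) I \<beta> S" and l: "l \<in> I"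
    obtain A where A: "weighted_l2 (\<lambda>_. 1) I (Y \<beta>) A"
      using Y[OF \<beta>] unfolding solves_def by blast
    have eq: "Y \<beta> l + kernel_op I ?K (Y \<beta>) l = \<beta> l / ?p l" using Y[OF \<beta>] l unfolding solves_def by blast
    have summand: "Y \<beta> j * fourier T (shift_list \<mu>s (modulate_jet (\<nu> j) X) 0) (\<nu> l)
        = ?p l * ((if j = l then Y \<beta> l else 0) + ?K l j * Y \<beta> j)" for j
      unfolding fourier_shift_list[OF T supported_jet_modulate[OF X]] fourier_modulate gram_kernel_def
      using X1 by auto
    have lim1: "(\<lambda>M. \<Sum>j\<in>I \<inter> {- int M..int M}. ?K l j * Y \<beta> j) \<longlonglongrightarrow> kernel_op I ?K (Y \<beta>) l"
      unfolding kernel_op_def by (rule LIMSEQ_sum_window[OF kernel_summable[OF K1 A l]])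
    have lim2: "(\<lambda>M. \<Sum>j\<in>I \<inter> {- int M..int M}. if j = l then Y \<beta> l else 0) \<longlonglongrightarrow> Y \<beta> l"
    proof (rule tendsto_eventually, rule eventually_mono[OF eventually_ge_at_top[of "nat \<bar>l\<bar>"]])
      fix M assume "nat \<bar>l\<bar> \<le> M"
      then have "l \<in> I \<inter> {- int M..int M}" using l by auto
      then show "(\<Sum>j\<in>I \<inter> {- int M..int M}. if j = l then Y \<beta> l else 0) = Y \<beta> l"
        by (subst sum.delta) auto
    qed
    have "(\<lambda>M. ?p l * ((\<Sum>j\<in>I \<inter> {- int M..int M}. if j = l then Y \<beta> l else 0)
        + (\<Sum>j\<in>I \<inter> {- int M..int M}. ?K l j * Y \<beta> j))) \<longlonglongrightarrow> ?p l * (Y \<beta> l + kernel_op I ?K (Y \<beta>) l)"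
      by (intro tendsto_intros lim1 lim2)
    moreover have "?p l * (Y \<beta> l + kernel_op I ?K (Y \<beta>) l) = \<beta> l" using eq p0[OF l] by simp
    ultimately show "(\<lambda>M. \<Sum>j\<in>I \<inter> {- int M..int M}. Y \<beta> j * fourier T (shift_list \<mu>s (modulate_jet (\<nu> j) X) 0) (\<nu> l)) \<longlonglongrightarrow> \<beta> l"
      unfolding summand sum_distrib_left[symmetric] sum.distrib by simp
  qed
qed

section \<open>Dual families for the low-frequency and polynomial moments\<close>

text \<open>
  Inverts a triangular matrix by bordering: the new column annihilates the old rows, so the old inverse
  only has to be corrected in the new row.
\<close>

lemma triangular_dual:
  fixes A :: "nat \<Rightarrow> nat \<Rightarrow> 'a::field"
  assumes "\<And>p q. p < q \<Longrightarrow> q \<le> n \<Longrightarrow> A p q = 0" "\<And>q. q \<le> n \<Longrightarrow> A q q \<noteq> 0"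
  shows "\<exists>B. \<forall>p\<le>n. \<forall>q\<le>n. (\<Sum>r\<le>n. B q r * A p r) = (if p = q then 1 else 0)"
  using assms
proof (induction n)
  case 0
  then show ?case by (intro exI[of _ "\<lambda>_ _. 1 / A 0 0"]) auto
next
  case (Suc n)
  obtain B where B: "\<And>p q. p \<le> n \<Longrightarrow> q \<le> n \<Longrightarrow> (\<Sum>r\<le>n. B q r * A p r) = (if p = q then 1 else 0)"
  proof -
    have "\<exists>B. \<forall>p\<le>n. \<forall>q\<le>n. (\<Sum>r\<le>n. B q r * A p r) = (if p = q then 1 else 0)"
      using Suc.IH Suc.prems by simp
    then show ?thesis using that by blast
  qed
  let ?a = "A (Suc n) (Suc n)"
  define B' where "B' q r = (if q \<le> n then if r \<le> n then B q r else - (\<Sum>r\<le>n. B q r * A (Suc n) r) / ?a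
    else if r \<le> n then 0 else 1 / ?a)" for q r
  have a: "?a \<noteq> 0" using Suc.prems(2) by simp
  have z: "A p (Suc n) = 0" if "p \<le> n" for p using Suc.prems(1)[of p "Suc n"] that by simp
  have s: "(\<Sum>r\<le>n. B' q r * A p r) = (if q \<le> n then \<Sum>r\<le>n. B q r * A p r else 0)" for p q
    by (auto simp: B'_def)
  have "(\<Sum>r\<le>Suc n. B' q r * A p r) = (if p = q then 1 else 0)" if "p \<le> Suc n" "q \<le> Suc n" for p q
  proof (cases "p \<le> n")
    case True
    then show ?thesis using s[of q p] B[of p q] z[of p] that by auto
  next
    case False
    then have "p = Suc n" using that by simp
    then show ?thesis using s[of q p] a that by (auto simp: B'_def)
  qed
  then show ?case by blast
qed

lemma fourier_sum:
  assumes "\<And>i. i \<in> A \<Longrightarrow> continuous_on UNIV (h i)"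
  shows "fourier T (\<lambda>t. \<Sum>i\<in>A. c i * h i t) z = (\<Sum>i\<in>A. c i * fourier T (h i) z)"
proof -
  have "fourier T (\<lambda>t. \<Sum>i\<in>A. c i * h i t) z = (\<integral>t. (\<Sum>i\<in>A. c i * (h i t * exp (\<i> * of_real (z * t)))) \<partial>leb T)"
    unfolding fourier_def by (simp add: sum_distrib_right mult.assoc)
  also have "\<dots> = (\<Sum>i\<in>A. \<integral>t. c i * (h i t * exp (\<i> * of_real (z * t))) \<partial>leb T)"
    by (intro Bochner_Integration.integral_sum integrable_mult_right integrable_leb_continuous
        continuous_intros assms)
  finally show ?thesis by (simp only: fourier_def integral_mult_right_zero)
qed

lemma power_moment_sum:
  assumes "\<And>i. i \<in> A \<Longrightarrow> continuous_on UNIV (h i)"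
  shows "power_moment T (\<lambda>t. \<Sum>i\<in>A. c i * h i t) q = (\<Sum>i\<in>A. c i * power_moment T (h i) q)"
proof -
  have "power_moment T (\<lambda>t. \<Sum>i\<in>A. c i * h i t) q = (\<integral>t. (\<Sum>i\<in>A. c i * (h i t * of_real (t ^ q))) \<partial>leb T)"
    unfolding power_moment_def by (simp add: sum_distrib_right mult.assoc)
  also have "\<dots> = (\<Sum>i\<in>A. \<integral>t. c i * (h i t * of_real (t ^ q)) \<partial>leb T)"
    by (intro Bochner_Integration.integral_sum integrable_mult_right integrable_leb_continuous
        continuous_intros assms)
  finally show ?thesis by (simp only: power_moment_def integral_mult_right_zero)
qed

lemma fourier_add:
  assumes "continuous_on UNIV f" "continuous_on UNIV g"
  shows "fourier T (\<lambda>t. f t + g t) z = fourier T f z + fourier T g z"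
  unfolding fourier_def distrib_right
  by (intro Bochner_Integration.integral_add integrable_leb_continuous continuous_intros assms)

lemma power_moment_add:
  assumes "continuous_on UNIV f" "continuous_on UNIV g"
  shows "power_moment T (\<lambda>t. f t + g t) q = power_moment T f q + power_moment T g q"
  unfolding power_moment_def distrib_right
  by (intro Bochner_Integration.integral_add integrable_leb_continuous continuous_intros assms)

lemma supported_jet_sum_mult:
  fixes h :: "'i \<Rightarrow> nat \<Rightarrow> real \<Rightarrow> complex"
  assumes "T > 0" "\<And>i. i \<in> A \<Longrightarrow> supported_jet T (h i)"
  shows "supported_jet T (\<lambda>m t. \<Sum>i\<in>A. c i * h i m t)"
  by (intro supported_jet_sum assms(1) supported_jet_mult_left assms(2))

text \<open>
  The zeros of the list act first. They raise the order of the first nonvanishing power moment to \<open>r\<close>, and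
  the remaining shifts multiply that moment by their symbol at \<open>0\<close>.
\<close>

lemma annihilator_moments:
  assumes T: "T > 0" and X: "supported_jet T X"
  shows "z \<in> set \<mu>s \<Longrightarrow> fourier T (shift_list (\<mu>s @ replicate r 0) X 0) z = 0"
    and "q < r \<Longrightarrow> power_moment T (shift_list (\<mu>s @ replicate r 0) X 0) q = 0"
    and "power_moment T (shift_list (\<mu>s @ replicate r 0) X 0) r
      = symbol \<mu>s 0 * ((- 1) ^ r * fact r * fourier T (X 0) 0)"
proof -
  have eq: "shift_list (\<mu>s @ replicate r 0) X = shift_list \<mu>s ((shift_jet 0 ^^ r) X)"
    by simp
  note s = supported_jet_shift_funpow[OF X, where \<mu>=0 and n=r]
  show "z \<in> set \<mu>s \<Longrightarrow> fourier T (shift_list (\<mu>s @ replicate r 0) X 0) z = 0"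
    unfolding fourier_shift_list[OF T X] by (simp add: symbol_eq_0_iff)
  show "q < r \<Longrightarrow> power_moment T (shift_list (\<mu>s @ replicate r 0) X 0) q = 0"
    unfolding eq by (rule power_moment_shift_list_eq_0[OF T s power_moment_shift_zeros(1)[OF T X]])
  show "power_moment T (shift_list (\<mu>s @ replicate r 0) X 0) r
      = symbol \<mu>s 0 * ((- 1) ^ r * fact r * fourier T (X 0) 0)"
    unfolding eq using power_moment_shift_list[OF T s power_moment_shift_zeros(1)[OF T X], of r \<mu>s]
      power_moment_shift_zeros(2)[OF T X, of r] by simp
qed

text \<open>
  Shifts by all low frequencies and \<open>q\<close> derivatives produce a function whose first nonvanishing power
  moment has order \<open>q\<close>; these functions form a triangular system. The function dual to the moment at \<open>\<nu>\<^sub>j\<close>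
  is obtained by leaving out the factor of \<open>\<nu>\<^sub>j\<close>.
\<close>

lemma low_dual_family:
  fixes \<nu> :: "int \<Rightarrow> real"
  assumes T: "T > 0" and X: "supported_jet T X" and X1: "fourier T (X 0) 0 = 1"
    and inj: "inj \<nu>" and nu0: "\<nu> 0 = 0" and lows: "0 \<notin> set lows"
  obtains w g where "\<And>q. supported_jet T (w q)" "\<And>j. supported_jet T (g j)"
    "\<And>q l. q \<le> n \<Longrightarrow> l \<in> set lows \<Longrightarrow> fourier T (w q 0) (\<nu> l) = 0"
    "\<And>q p. q \<le> n \<Longrightarrow> p \<le> n \<Longrightarrow> power_moment T (w q 0) p = (if p = q then 1 else 0)"
    "\<And>j l. j \<in> set lows \<Longrightarrow> l \<in> set lows \<Longrightarrow> fourier T (g j 0) (\<nu> l) = (if l = j then 1 else 0)"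
    "\<And>j p. j \<in> set lows \<Longrightarrow> p \<le> n \<Longrightarrow> power_moment T (g j 0) p = 0"
proof -
  define v where "v q = shift_list (map \<nu> lows @ replicate q 0) X" for q
  have v: "supported_jet T (v q)" for q unfolding v_def by (rule supported_jet_shift_list[OF X])
  have nz: "0 \<notin> set (map \<nu> lows)"
    using inj nu0 lows by (metis (no_types, lifting) image_iff injD list.set_map)
  have "\<exists>B. \<forall>p\<le>n. \<forall>q\<le>n. (\<Sum>r\<le>n. B q r * power_moment T (v r 0) p) = (if p = q then 1 else 0)"
  proof (rule triangular_dual)
    show "power_moment T (v q 0) p = 0" if "p < q" for p q
      unfolding v_def by (rule annihilator_moments(2)[OF T X that])
    show "power_moment T (v q 0) q \<noteq> 0" for q
      unfolding v_def annihilator_moments(3)[OF T X] using nz X1 by (simp add: symbol_eq_0_iff)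
  qed
  then obtain B where B: "\<And>p q. p \<le> n \<Longrightarrow> q \<le> n \<Longrightarrow>
      (\<Sum>r\<le>n. B q r * power_moment T (v r 0) p) = (if p = q then 1 else 0)" by blast
  define w where "w q m t = (\<Sum>r\<le>n. B q r * v r m t)" for q m t
  define \<mu>s where "\<mu>s j = map \<nu> (filter (\<lambda>i. i \<noteq> j) lows) @ replicate (Suc n) 0" for j
  define g where "g j m t = 1 / symbol (\<mu>s j) (\<nu> j) * shift_list (\<mu>s j) (modulate_jet (\<nu> j) X) m t" for j m t
  have c: "continuous_on UNIV (v r m)" for r m by (rule jet_continuous[OF supported_jet_jet[OF v]])
  note mX = supported_jet_modulate[OF X]
  have fg: "fourier T (g j 0) z = 1 / symbol (\<mu>s j) (\<nu> j) * fourier T (shift_list (\<mu>s j) (modulate_jet (\<nu> j) X) 0) z" for j z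
    unfolding g_def fourier_def by (simp only: mult.assoc integral_mult_right_zero)
  show thesis
  proof (rule that[of w g])
    show "supported_jet T (w q)" for q
      unfolding w_def by (rule supported_jet_sum_mult[OF T v])
    show "supported_jet T (g j)" for j
      unfolding g_def by (rule supported_jet_mult_left[OF supported_jet_shift_list[OF mX]])
    show "fourier T (w q 0) (\<nu> l) = 0" if "l \<in> set lows" for q l
      unfolding w_def fourier_sum[OF c]
      using annihilator_moments(1)[OF T X, of "\<nu> l" "map \<nu> lows"] that by (simp add: v_def)
    show "power_moment T (w q 0) p = (if p = q then 1 else 0)" if "q \<le> n" "p \<le> n" for q p
      unfolding w_def power_moment_sum[OF c] using B[OF that(2,1)] by simp
    show "fourier T (g j 0) (\<nu> l) = (if l = j then 1 else 0)" if jl: "j \<in> set lows" "l \<in> set lows" for j l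
    proof (cases "l = j")
      case True
      have "\<nu> j \<noteq> 0" using jl(1) lows inj nu0 by (metis injD)
      then have "symbol (\<mu>s j) (\<nu> j) \<noteq> 0"
        using inj by (auto simp: symbol_eq_0_iff \<mu>s_def dest: injD)
      then show ?thesis
        using True X1 unfolding fg fourier_shift_list[OF T mX] fourier_modulate by simp
    next
      case False
      then have "\<nu> l \<in> set (\<mu>s j)" using jl by (auto simp: \<mu>s_def)
      then have "symbol (\<mu>s j) (\<nu> l) = 0" by (simp add: symbol_eq_0_iff)
      then show ?thesis using False unfolding fg fourier_shift_list[OF T mX] by simp
    qed
    show "power_moment T (g j 0) p = 0" if "p \<le> n" for j p
    proof -
      have "power_moment T (g j 0) p = 1 / symbol (\<mu>s j) (\<nu> j) * power_moment T (shift_list (\<mu>s j) (modulate_jet (\<nu> j) X) 0) p"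
        unfolding g_def power_moment_def by (simp only: mult.assoc integral_mult_right_zero)
      moreover have "p < Suc n" using that by simp
      ultimately show ?thesis using annihilator_moments(2)[OF T mX, of p "Suc n"] unfolding \<mu>s_def by simp
    qed
  qed
qed

section \<open>Approximate solutions of the complex moment problem\<close>

lemma weighted_l2_sum:
  assumes "finite A" "\<And>j. j \<in> I \<Longrightarrow> 0 \<le> \<rho> j" "\<And>i. i \<in> A \<Longrightarrow> weighted_l2 \<rho> I (y i) (S i)"
  shows "weighted_l2 \<rho> I (\<lambda>j. \<Sum>i\<in>A. y i j) (\<Sum>i\<in>A. S i)"
  using assms(1,3)
proof (induction A)
  case empty
  show ?case by (simp add: weighted_l2_def L2_set_0')
next
  case (insert i A)
  have "weighted_l2 \<rho> I (\<lambda>j. y i j + (\<Sum>i\<in>A. y i j)) (S i + (\<Sum>i\<in>A. S i))"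
    by (rule weighted_l2_add[OF assms(2)]) (use insert in auto)
  then show ?case using insert.hyps by simp
qed

lemma weighted_l2_subset: "weighted_l2 \<rho> I y S \<Longrightarrow> J \<subseteq> I \<Longrightarrow> weighted_l2 \<rho> J y S"
  unfolding weighted_l2_def by (meson order_trans)

text \<open>
  The decay of order \<open>k + 1\<close> leaves the bound \<open>C / \<bar>\<nu>\<^sub>l\<bar>\<close>, which is square summable because the frequencies
  are separated from \<open>\<nu>\<^sub>0 = 0\<close>.
\<close>

lemma fourier_weighted_l2:
  fixes \<nu> :: "int \<Rightarrow> real"
  assumes T: "T > 0" and G: "supported_jet T G" and nu0: "\<nu> 0 = 0" and \<gamma>: "\<gamma> > 0" and sep: "separated \<gamma> UNIV \<nu>"
  obtains C where "C \<ge> 0" "\<And>m. m \<le> k \<Longrightarrow>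
    weighted_l2 (\<lambda>l. (1 + \<bar>\<nu> l\<bar>) ^ m) (- {0}) (\<lambda>l. fourier T (G 0) (\<nu> l)) C"
proof -
  obtain C where C: "C \<ge> 0" "\<And>z. (1 + \<bar>z\<bar>) ^ Suc k * norm (fourier T (G 0) z) \<le> C"
    using fourier_decay[OF T G, of "Suc k" 0] by blast
  show thesis
  proof (rule that[of "C * sqrt (inv_sq_sum / \<gamma>\<^sup>2)"])
    show "0 \<le> C * sqrt (inv_sq_sum / \<gamma>\<^sup>2)" using C(1) inv_sq_sum_pos by simp
    fix m assume m: "m \<le> k"
    show "weighted_l2 (\<lambda>l. (1 + \<bar>\<nu> l\<bar>) ^ m) (- {0}) (\<lambda>l. fourier T (G 0) (\<nu> l)) (C * sqrt (inv_sq_sum / \<gamma>\<^sup>2))"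
      unfolding weighted_l2_def
    proof (intro allI impI)
      fix F :: "int set" assume F: "finite F" "F \<subseteq> - {0}"
      have "L2_set (\<lambda>l. (1 + \<bar>\<nu> l\<bar>) ^ m * norm (fourier T (G 0) (\<nu> l))) F \<le> L2_set (\<lambda>l. C * (1 / \<bar>\<nu> l\<bar>)) F"
      proof (rule L2_set_mono)
        fix l assume "l \<in> F"
        then have "0 < \<gamma> * \<bar>real_of_int (l - 0)\<bar>" using F \<gamma> by (intro mult_pos_pos) auto
        also have "\<dots> \<le> \<bar>\<nu> l - \<nu> 0\<bar>" using sep unfolding separated_def by blast
        finally have nl: "0 < \<bar>\<nu> l\<bar>" using nu0 by simp
        have "(1 + \<bar>\<nu> l\<bar>) ^ m * norm (fourier T (G 0) (\<nu> l)) \<le> (1 + \<bar>\<nu> l\<bar>) ^ k * norm (fourier T (G 0) (\<nu> l))"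
          by (intro mult_right_mono power_increasing m) auto
        moreover have "\<bar>\<nu> l\<bar> * ((1 + \<bar>\<nu> l\<bar>) ^ k * norm (fourier T (G 0) (\<nu> l))) \<le> C"
        proof -
          have "\<bar>\<nu> l\<bar> * ((1 + \<bar>\<nu> l\<bar>) ^ k * norm (fourier T (G 0) (\<nu> l)))
              \<le> (1 + \<bar>\<nu> l\<bar>) * ((1 + \<bar>\<nu> l\<bar>) ^ k * norm (fourier T (G 0) (\<nu> l)))"
            by (intro mult_right_mono) auto
          also have "\<dots> = (1 + \<bar>\<nu> l\<bar>) ^ Suc k * norm (fourier T (G 0) (\<nu> l))" by simp
          finally show ?thesis using C(2)[of "\<nu> l"] by linarith
        qed
        ultimately show "(1 + \<bar>\<nu> l\<bar>) ^ m * norm (fourier T (G 0) (\<nu> l)) \<le> C * (1 / \<bar>\<nu> l\<bar>)"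
          using nl by (simp add: pos_le_divide_eq) (smt (verit) mult.commute mult_left_mono)
      qed simp
      also have "\<dots> = C * L2_set (\<lambda>l. 1 / \<bar>\<nu> l\<bar>) F" by (simp add: L2_set_right_distrib C(1))
      also have "L2_set (\<lambda>l. 1 / \<bar>\<nu> l\<bar>) F = sqrt (\<Sum>l\<in>F - {0}. 1 / (\<nu> l - \<nu> 0)\<^sup>2)"
      proof -
        have "F - {0} = F" using F by auto
        then show ?thesis unfolding L2_set_def using nu0 by (simp add: power_divide)
      qed
      also have "C * sqrt (\<Sum>l\<in>F - {0}. 1 / (\<nu> l - \<nu> 0)\<^sup>2) \<le> C * sqrt (inv_sq_sum / \<gamma>\<^sup>2)"
        using separated_sum_le[OF \<gamma> sep F(1), of 0] C(1) by (intro mult_left_mono real_sqrt_le_mono) auto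
      finally show "L2_set (\<lambda>l. (1 + \<bar>\<nu> l\<bar>) ^ m * norm (fourier T (G 0) (\<nu> l))) F \<le> C * sqrt (inv_sq_sum / \<gamma>\<^sup>2)" .
    qed
  qed
qed

lemma sq_norm_finite_sum:
  fixes h :: "'i \<Rightarrow> real \<Rightarrow> complex"
  assumes "finite A" "\<And>i. i \<in> A \<Longrightarrow> continuous_on UNIV (h i)"
  shows "\<exists>C\<ge>0. \<forall>c. sq_norm T (\<lambda>t. \<Sum>i\<in>A. c i * h i t) \<le> C * (\<Sum>i\<in>A. norm (c i))\<^sup>2"
  using assms
proof (induction A)
  case empty
  show ?case by (intro exI[of _ 0]) (simp add: sq_norm_def)
next
  case (insert i A)
  obtain C where C: "C \<ge> 0" "\<And>c. sq_norm T (\<lambda>t. \<Sum>i\<in>A. c i * h i t) \<le> C * (\<Sum>i\<in>A. norm (c i))\<^sup>2"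
    using insert.IH insert.prems by auto
  have "sq_norm T (\<lambda>t. \<Sum>i\<in>insert i A. c i * h i t) \<le> (2 * sq_norm T (h i) + 2 * C) * (\<Sum>i\<in>insert i A. norm (c i))\<^sup>2" for c
  proof -
    let ?s = "\<Sum>i\<in>insert i A. norm (c i)"
    have s: "?s = norm (c i) + (\<Sum>i\<in>A. norm (c i))" using insert.hyps by simp
    have nn: "0 \<le> (\<Sum>i\<in>A. norm (c i))" by (intro sum_nonneg) auto
    have "sq_norm T (\<lambda>t. \<Sum>i\<in>insert i A. c i * h i t) = sq_norm T (\<lambda>t. c i * h i t + (\<Sum>i\<in>A. c i * h i t))"
      using insert.hyps by simp
    also have "\<dots> \<le> 2 * sq_norm T (\<lambda>t. c i * h i t) + 2 * sq_norm T (\<lambda>t. \<Sum>i\<in>A. c i * h i t)"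
      by (intro sq_norm_add_continuous continuous_intros insert.prems) auto
    also have "sq_norm T (\<lambda>t. c i * h i t) = (norm (c i))\<^sup>2 * sq_norm T (h i)"
      by (simp add: sq_norm_def norm_mult power_mult_distrib)
    also have "2 * ((norm (c i))\<^sup>2 * sq_norm T (h i)) + 2 * sq_norm T (\<lambda>t. \<Sum>i\<in>A. c i * h i t)
        \<le> 2 * (?s\<^sup>2 * sq_norm T (h i)) + 2 * (C * ?s\<^sup>2)"
    proof (intro add_mono mult_left_mono mult_right_mono)
      show "(norm (c i))\<^sup>2 \<le> ?s\<^sup>2" unfolding s using nn by (intro power_mono) auto
      have "(\<Sum>i\<in>A. norm (c i))\<^sup>2 \<le> ?s\<^sup>2" unfolding s using nn by (intro power_mono) auto
      then show "sq_norm T (\<lambda>t. \<Sum>i\<in>A. c i * h i t) \<le> C * ?s\<^sup>2"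
        using C(2)[of c] mult_left_mono[OF _ C(1)] by (meson order_trans)
    qed (auto simp: sq_norm_nonneg)
    finally show ?thesis by (simp add: algebra_simps)
  qed
  then show ?case using C(1) sq_norm_nonneg[of T "h i"]
    by (intro exI[of _ "2 * sq_norm T (h i) + 2 * C"]) auto
qed

text \<open>
  \<open>U \<alpha> \<delta> M\<close> is the \<open>M\<close>-th partial sum of a control with power moments \<open>\<alpha>\<close> and moments \<open>\<delta>\<close> at the nonzero
  frequencies. It consists of a fixed combination \<open>L\<close> of the dual family and of a window \<open>H\<close> of the
  high-frequency series. The latter is solved for \<open>\<beta>\<close>, the data minus the moments of \<open>L\<close>, and it does not
  disturb the low and the power moments.
\<close>

lemma moment_sections:
  fixes \<nu> :: "int \<Rightarrow> real"
  assumes T: "T > 0" and nu0: "\<nu> 0 = 0" and \<gamma>: "\<gamma> > 0" and sep: "separated \<gamma> UNIV \<nu>"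
    and abs_mono: "\<And>j l. \<bar>j\<bar> \<le> \<bar>l\<bar> \<Longrightarrow> \<bar>\<nu> j\<bar> \<le> \<bar>\<nu> l\<bar>"
    and abs_strict: "\<And>j l. \<bar>j\<bar> < \<bar>l\<bar> \<Longrightarrow> \<bar>\<nu> j\<bar> < \<bar>\<nu> l\<bar>"
    and high: "\<And>\<Gamma>. \<Gamma> > 0 \<Longrightarrow> \<exists>N::nat. N \<ge> 1 \<and> separated \<Gamma> {j. int N \<le> \<bar>j\<bar>} \<nu>"
  obtains U :: "(nat \<Rightarrow> complex) \<Rightarrow> (int \<Rightarrow> complex) \<Rightarrow> nat \<Rightarrow> nat \<Rightarrow> real \<Rightarrow> complex" and C
  where "C \<ge> 0" "\<And>\<alpha> \<delta> M. supported_jet T (U \<alpha> \<delta> M)"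
    "\<And>\<alpha> \<delta> \<alpha>' \<delta>' S S' M m t. weighted_l2 (\<lambda>_. 1) (- {0}) \<delta> S \<Longrightarrow> weighted_l2 (\<lambda>_. 1) (- {0}) \<delta>' S' \<Longrightarrow>
      U (\<lambda>q. \<alpha> q + \<alpha>' q) (\<lambda>j. \<delta> j + \<delta>' j) M m t = U \<alpha> \<delta> M m t + U \<alpha>' \<delta>' M m t"
    "\<And>\<alpha> \<delta> c S M m t. weighted_l2 (\<lambda>_. 1) (- {0}) \<delta> S \<Longrightarrow>
      U (\<lambda>q. c * \<alpha> q) (\<lambda>j. c * \<delta> j) M m t = c * U \<alpha> \<delta> M m t"
    "\<And>\<alpha> \<delta> m S M. m \<le> k \<Longrightarrow> weighted_l2 (\<lambda>j. (1 + \<bar>\<nu> j\<bar>) ^ m) (- {0}) \<delta> S \<Longrightarrow>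
      sq_norm T (U \<alpha> \<delta> M m) \<le> C * ((\<Sum>q\<le>n. norm (\<alpha> q)) + S)\<^sup>2"
    "\<And>\<alpha> \<delta> m S e. m \<le> k \<Longrightarrow> weighted_l2 (\<lambda>j. (1 + \<bar>\<nu> j\<bar>) ^ m) (- {0}) \<delta> S \<Longrightarrow> e > 0 \<Longrightarrow>
      \<exists>M0. \<forall>M\<ge>M0. \<forall>M'\<ge>M0. sq_norm T (\<lambda>t. U \<alpha> \<delta> M m t - U \<alpha> \<delta> M' m t) < e"
    "\<And>\<alpha> \<delta> S j. weighted_l2 (\<lambda>_. 1) (- {0}) \<delta> S \<Longrightarrow> j \<noteq> 0 \<Longrightarrow>
      (\<lambda>M. fourier T (U \<alpha> \<delta> M 0) (\<nu> j)) \<longlonglongrightarrow> \<delta> j"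
    "\<And>\<alpha> \<delta> M q. q \<le> n \<Longrightarrow> power_moment T (U \<alpha> \<delta> M 0) q = \<alpha> q"
proof -
  have inj: "inj \<nu>"
  proof (rule injI)
    fix j l assume "\<nu> j = \<nu> l"
    then have "\<gamma> * \<bar>real_of_int (j - l)\<bar> \<le> 0" using sep unfolding separated_def by (metis UNIV_I abs_zero diff_self)
    then show "j = l" using \<gamma> by (simp add: mult_le_0_iff)
  qed
  obtain X where X: "supported_jet T X" and X1: "fourier T (X 0) 0 = 1" by (rule normalized_bump[OF T])
  obtain \<Gamma>0 where \<Gamma>0: "\<Gamma>0 > 0"
    "\<And>q. \<exists>R\<ge>1. \<forall>\<Gamma> I \<nu> p. \<Gamma> \<ge> \<Gamma>0 \<longrightarrow> separated \<Gamma> I \<nu> \<longrightarrow> p \<le> q \<longrightarrow>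
        schur_half I (gram_kernel T \<nu> (X 0)) (\<lambda>j. (1 + \<bar>\<nu> j\<bar> / R) ^ p)"
    by (rule schur_half_gram_kernel[OF T X]) (rule that)
  obtain N :: nat where N: "N \<ge> 1" "separated \<Gamma>0 {j. int N \<le> \<bar>j\<bar>} \<nu>" using high[OF \<Gamma>0(1)] by blast
  define I where "I = {j. int N \<le> \<bar>j\<bar>}"
  define lows where "lows = filter (\<lambda>j. j \<noteq> 0) [- int N + 1..int N - 1]"
  have lows: "set lows = {j. j \<noteq> 0 \<and> \<bar>j\<bar> < int N}" by (auto simp: lows_def)
  have I0: "I \<subseteq> - {0}" and split: "\<And>j. j \<noteq> 0 \<Longrightarrow> j \<in> set lows \<or> j \<in> I"
    using N(1) by (auto simp: I_def lows)
  have low_not_I: "\<And>j. j \<in> set lows \<Longrightarrow> j \<notin> I" by (auto simp: I_def lows)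
  have zl: "0 \<notin> set lows" by (simp add: lows)
  obtain w g where w: "\<And>q. supported_jet T (w q)" and g: "\<And>j. supported_jet T (g j)"
    and wl: "\<And>q l. q \<le> n \<Longrightarrow> l \<in> set lows \<Longrightarrow> fourier T (w q 0) (\<nu> l) = 0"
    and wp: "\<And>q p. q \<le> n \<Longrightarrow> p \<le> n \<Longrightarrow> power_moment T (w q 0) p = (if p = q then 1 else 0)"
    and gl: "\<And>j l. j \<in> set lows \<Longrightarrow> l \<in> set lows \<Longrightarrow> fourier T (g j 0) (\<nu> l) = (if l = j then 1 else 0)"
    and gp: "\<And>j p. j \<in> set lows \<Longrightarrow> p \<le> n \<Longrightarrow> power_moment T (g j 0) p = 0"
    by (rule low_dual_family[OF T X X1 inj nu0 zl, where n=n]) (rule that)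
  \<comment> \<open>One factor for each low frequency, and \<open>n + 1\<close> derivatives for the powers \<open>t\<^sup>0, \<dots>, t\<^sup>n\<close>.\<close>
  define \<mu>s where "\<mu>s = map \<nu> lows @ replicate (Suc n) 0"
  define f where "f j = shift_list \<mu>s (modulate_jet (\<nu> j) X)" for j
  have f: "supported_jet T (f j)" for j
    unfolding f_def by (intro supported_jet_shift_list supported_jet_modulate X)
  have fl: "fourier T (f j 0) (\<nu> l) = 0" if "l \<in> set lows" for j l
    unfolding f_def \<mu>s_def using that by (intro annihilator_moments(1)[OF T supported_jet_modulate[OF X]]) simp
  have fp: "power_moment T (f j 0) p = 0" if "p \<le> n" for j p
    unfolding f_def \<mu>s_def using that by (intro annihilator_moments(2)[OF T supported_jet_modulate[OF X]]) simp
  have cont: "continuous_on UNIV (w q m)" "continuous_on UNIV (g j m)" "continuous_on UNIV (f j m)" for q j m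
    by (intro jet_continuous supported_jet_jet[OF w] supported_jet_jet[OF g] supported_jet_jet[OF f])+
  obtain c0 where c0: "c0 > 0" "\<And>j. j \<in> I \<Longrightarrow> c0 * (1 + \<bar>\<nu> j\<bar>) ^ length \<mu>s \<le> norm (symbol \<mu>s (\<nu> j))"
  proof (rule that)
    \<comment> \<open>The largest low frequency and the smallest high frequency.\<close>
    define a b where "a = \<bar>\<nu> (int N - 1)\<bar>" and "b = \<bar>\<nu> (int N)\<bar>"
    have "\<bar>int N - 1\<bar> < \<bar>int N\<bar>" using N(1) by simp
    then have ab: "0 \<le> a" "a < b" unfolding a_def b_def using abs_strict by simp_all
    show "((b - a) / (1 + b)) ^ length \<mu>s > 0" using ab by (intro zero_less_power divide_pos_pos) linarith+
    fix j assume "j \<in> I"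
    have "((b - a) / (1 + b) * (1 + \<bar>\<nu> j\<bar>)) ^ length \<mu>s \<le> norm (symbol \<mu>s (\<nu> j))"
    proof (rule symbol_lower_bound[OF _ ab])
      show "b \<le> \<bar>\<nu> j\<bar>" using \<open>j \<in> I\<close> unfolding b_def I_def by (intro abs_mono) simp
      fix \<mu> assume "\<mu> \<in> set \<mu>s"
      then have "\<mu> \<in> \<nu> ` set lows \<or> \<mu> = 0" unfolding \<mu>s_def by auto
      then consider l where "l \<in> set lows" "\<mu> = \<nu> l" | "\<mu> = 0" by (elim disjE imageE)
      then show "\<bar>\<mu>\<bar> \<le> a"
      proof cases
        case 1
        then have "\<bar>l\<bar> < int N" using lows by blast
        then have "\<bar>l\<bar> \<le> \<bar>int N - 1\<bar>" by linarith
        then have "\<bar>\<nu> l\<bar> \<le> a" unfolding a_def by (rule abs_mono)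
        then show ?thesis using 1(2) by simp
      qed (use ab in simp)
    qed
    then show "((b - a) / (1 + b)) ^ length \<mu>s * (1 + \<bar>\<nu> j\<bar>) ^ length \<mu>s \<le> norm (symbol \<mu>s (\<nu> j))"
      by (simp only: power_mult_distrib)
  qed
  \<comment> \<open>Here \<open>R\<close> is chosen, after the number \<open>length \<mu>s\<close> of factors is known.\<close>
  obtain R where R: "R \<ge> 1" "\<And>p. p \<le> k + length \<mu>s \<Longrightarrow>
      schur_half I (gram_kernel T \<nu> (X 0)) (\<lambda>j. (1 + \<bar>\<nu> j\<bar> / R) ^ p)"
  proof -
    obtain R where "R \<ge> 1" "\<forall>\<Gamma> I \<nu> p. \<Gamma> \<ge> \<Gamma>0 \<longrightarrow> separated \<Gamma> I \<nu> \<longrightarrow> p \<le> k + length \<mu>s \<longrightarrow>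
        schur_half I (gram_kernel T \<nu> (X 0)) (\<lambda>j. (1 + \<bar>\<nu> j\<bar> / R) ^ p)"
      using \<Gamma>0(2)[of "k + length \<mu>s"] by (elim exE conjE)
    moreover have "separated \<Gamma>0 I \<nu>" using N(2) by (simp add: I_def)
    ultimately have "schur_half I (gram_kernel T \<nu> (X 0)) (\<lambda>j. (1 + \<bar>\<nu> j\<bar> / R) ^ p)"
      if "p \<le> k + length \<mu>s" for p
      using that by (meson order_refl)
    with \<open>R \<ge> 1\<close> show ?thesis by (rule that)
  qed
  obtain Y CY where CY: "CY \<ge> 0"
    and Yadd: "\<And>\<beta> \<beta>' S S' j. weighted_l2 (\<lambda>_. 1) I \<beta> S \<Longrightarrow> weighted_l2 (\<lambda>_. 1) I \<beta>' S' \<Longrightarrow> j \<in> I \<Longrightarrow>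
      Y (\<lambda>j. \<beta> j + \<beta>' j) j = Y \<beta> j + Y \<beta>' j"
    and Yscale: "\<And>\<beta> c S j. weighted_l2 (\<lambda>_. 1) I \<beta> S \<Longrightarrow> j \<in> I \<Longrightarrow> Y (\<lambda>j. c * \<beta> j) j = c * Y \<beta> j"
    and Ybound: "\<And>\<beta> m S. m \<le> k \<Longrightarrow> weighted_l2 (\<lambda>j. (1 + \<bar>\<nu> j\<bar>) ^ m) I \<beta> S \<Longrightarrow>
      weighted_l2 (\<lambda>j. (1 + \<bar>\<nu> j\<bar>) ^ (m + length \<mu>s)) I (Y \<beta>) (CY * S)"
    and Ylim': "\<And>\<beta> S l. weighted_l2 (\<lambda>_. 1) I \<beta> S \<Longrightarrow> l \<in> I \<Longrightarrow>
      (\<lambda>M. \<Sum>j\<in>I \<inter> {- int M..int M}. Y \<beta> j * fourier T (shift_list \<mu>s (modulate_jet (\<nu> j) X) 0) (\<nu> l)) \<longlonglongrightarrow> \<beta> l"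
    by (rule gram_solver[OF T X X1 R c0]) (assumption, assumption, rule that)
  note Ylim = Ylim'[folded f_def]
  \<comment> \<open>The Fourier moments of the combination \<open>L\<close> of the dual family.\<close>
  define E where "E \<alpha> \<delta> z = (\<Sum>q\<le>n. \<alpha> q * fourier T (w q 0) z) + (\<Sum>j\<in>set lows. \<delta> j * fourier T (g j 0) z)" for \<alpha> \<delta> z
  define \<beta> where "\<beta> \<alpha> \<delta> l = \<delta> l - E \<alpha> \<delta> (\<nu> l)" for \<alpha> \<delta> l
  define W where "W M = I \<inter> {- int M..int M}" for M :: nat
  have W: "finite (W M)" "W M \<subseteq> I" for M by (auto simp: W_def)
  define H where "H \<alpha> \<delta> M m t = (\<Sum>j\<in>W M. Y (\<beta> \<alpha> \<delta>) j * f j m t)" for \<alpha> \<delta> M m t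
  define L where "L \<alpha> \<delta> m t = (\<Sum>q\<le>n. \<alpha> q * w q m t) + (\<Sum>j\<in>set lows. \<delta> j * g j m t)" for \<alpha> \<delta> m t
  define U where "U \<alpha> \<delta> M m t = L \<alpha> \<delta> m t + H \<alpha> \<delta> M m t" for \<alpha> \<delta> M m t
  have Lc: "continuous_on UNIV (L \<alpha> \<delta> m)" for \<alpha> \<delta> m
    unfolding L_def by (intro continuous_intros cont)
  have Hc: "continuous_on UNIV (H \<alpha> \<delta> M m)" for \<alpha> \<delta> M m
    unfolding H_def by (intro continuous_intros cont)

  \<comment> \<open>The dual family contributes rapidly decaying moments, so the remaining data are as good as the given ones.\<close>
  obtain CE where CE: "CE \<ge> 0" "\<And>m \<alpha> \<delta> S. m \<le> k \<Longrightarrow> weighted_l2 (\<lambda>j. (1 + \<bar>\<nu> j\<bar>) ^ m) (- {0}) \<delta> S \<Longrightarrow>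
      weighted_l2 (\<lambda>j. (1 + \<bar>\<nu> j\<bar>) ^ m) I (\<beta> \<alpha> \<delta>) (CE * ((\<Sum>q\<le>n. norm (\<alpha> q)) + S))"
  proof -
    have "\<exists>C\<ge>0. \<forall>m\<le>k. weighted_l2 (\<lambda>l. (1 + \<bar>\<nu> l\<bar>) ^ m) (- {0}) (\<lambda>l. fourier T (G 0) (\<nu> l)) C"
      if "supported_jet T G" for G
      by (rule fourier_weighted_l2[OF T that nu0 \<gamma> sep, of k]) blast
    with w g have "\<forall>q. \<exists>C\<ge>0. \<forall>m\<le>k. weighted_l2 (\<lambda>l. (1 + \<bar>\<nu> l\<bar>) ^ m) (- {0}) (\<lambda>l. fourier T (w q 0) (\<nu> l)) C"
      "\<forall>j. \<exists>C\<ge>0. \<forall>m\<le>k. weighted_l2 (\<lambda>l. (1 + \<bar>\<nu> l\<bar>) ^ m) (- {0}) (\<lambda>l. fourier T (g j 0) (\<nu> l)) C"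
      by blast+
    then obtain Cw Cg where Cw: "\<And>q. Cw q \<ge> 0" "\<And>q m. m \<le> k \<Longrightarrow> weighted_l2 (\<lambda>l. (1 + \<bar>\<nu> l\<bar>) ^ m) (- {0}) (\<lambda>l. fourier T (w q 0) (\<nu> l)) (Cw q)"
      and Cg: "\<And>j. Cg j \<ge> 0" "\<And>j m. m \<le> k \<Longrightarrow> weighted_l2 (\<lambda>l. (1 + \<bar>\<nu> l\<bar>) ^ m) (- {0}) (\<lambda>l. fourier T (g j 0) (\<nu> l)) (Cg j)"
      by metis
    define B where "B = (\<Sum>q\<le>n. Cw q) + (\<Sum>j\<in>set lows. Cg j)"
    have sums: "0 \<le> (\<Sum>q\<le>n. Cw q)" "0 \<le> (\<Sum>j\<in>set lows. Cg j)" using Cw(1) Cg(1) by (auto intro: sum_nonneg)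
    have B0: "0 \<le> B" using sums by (simp add: B_def)
    show thesis
    proof (rule that[of "1 + B"])
      show "0 \<le> 1 + B" using B0 by simp
      fix m and \<alpha> :: "nat \<Rightarrow> complex" and \<delta> :: "int \<Rightarrow> complex" and S assume m: "m \<le> k" and \<delta>: "weighted_l2 (\<lambda>j. (1 + \<bar>\<nu> j\<bar>) ^ m) (- {0}) \<delta> S"
      let ?\<rho> = "\<lambda>j. (1 + \<bar>\<nu> j\<bar>) ^ m" and ?A = "\<Sum>q\<le>n. norm (\<alpha> q)"
      have S0: "0 \<le> S" by (rule weighted_l2_nonneg[OF \<delta>])
      have A0: "0 \<le> ?A" by (intro sum_nonneg) auto
      have 1: "weighted_l2 ?\<rho> (- {0}) (\<lambda>l. \<Sum>q\<le>n. \<alpha> q * fourier T (w q 0) (\<nu> l)) (\<Sum>q\<le>n. norm (\<alpha> q) * Cw q)"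
        by (intro weighted_l2_sum weighted_l2_scale Cw m) auto
      have 2: "weighted_l2 ?\<rho> (- {0}) (\<lambda>l. \<Sum>j\<in>set lows. \<delta> j * fourier T (g j 0) (\<nu> l)) (\<Sum>j\<in>set lows. norm (\<delta> j) * Cg j)"
        by (intro weighted_l2_sum weighted_l2_scale Cg m) auto
      have "weighted_l2 ?\<rho> (- {0}) (\<lambda>l. \<delta> l + - ((\<Sum>q\<le>n. \<alpha> q * fourier T (w q 0) (\<nu> l))
          + (\<Sum>j\<in>set lows. \<delta> j * fourier T (g j 0) (\<nu> l))))
          (S + ((\<Sum>q\<le>n. norm (\<alpha> q) * Cw q) + (\<Sum>j\<in>set lows. norm (\<delta> j) * Cg j)))"
        by (intro weighted_l2_add \<delta> weighted_l2_uminus[THEN iffD2] 1 2) auto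
      then have *: "weighted_l2 ?\<rho> I (\<beta> \<alpha> \<delta>) (S + ((\<Sum>q\<le>n. norm (\<alpha> q) * Cw q) + (\<Sum>j\<in>set lows. norm (\<delta> j) * Cg j)))"
        unfolding \<beta>_def E_def diff_conv_add_uminus by (rule weighted_l2_subset[OF _ I0])
      have "(\<Sum>q\<le>n. norm (\<alpha> q) * Cw q) \<le> (\<Sum>q\<le>n. norm (\<alpha> q) * (\<Sum>q\<le>n. Cw q))"
        using Cw(1) by (intro sum_mono mult_left_mono member_le_sum) auto
      then have 3: "(\<Sum>q\<le>n. norm (\<alpha> q) * Cw q) \<le> ?A * (\<Sum>q\<le>n. Cw q)" by (simp add: sum_distrib_right)
      have "norm (\<delta> j) \<le> S" if "j \<in> set lows" for j
      proof -
        have "1 * norm (\<delta> j) \<le> ?\<rho> j * norm (\<delta> j)" by (intro mult_right_mono one_le_power) auto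
        also have "\<dots> \<le> S" by (rule weighted_l2_pointwise[OF \<delta>]) (use that lows in auto)
        finally show ?thesis by simp
      qed
      then have "(\<Sum>j\<in>set lows. norm (\<delta> j) * Cg j) \<le> (\<Sum>j\<in>set lows. S * Cg j)"
        using Cg(1) by (intro sum_mono mult_right_mono) auto
      then have 4: "(\<Sum>j\<in>set lows. norm (\<delta> j) * Cg j) \<le> S * (\<Sum>j\<in>set lows. Cg j)" by (simp add: sum_distrib_left)
      have "0 \<le> ?A * (\<Sum>j\<in>set lows. Cg j)" "0 \<le> S * (\<Sum>q\<le>n. Cw q)" using A0 S0 sums by auto
      then have "S + ((\<Sum>q\<le>n. norm (\<alpha> q) * Cw q) + (\<Sum>j\<in>set lows. norm (\<delta> j) * Cg j)) \<le> (1 + B) * (?A + S)"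
      proof -
        have "(1 + (u + v)) * (x + y) = x + y + x * u + x * v + y * u + y * v" for u v x y :: real
          by (simp add: algebra_simps)
        from this[of "\<Sum>q\<le>n. Cw q" "\<Sum>j\<in>set lows. Cg j" ?A S] show ?thesis
          using 3 4 A0 \<open>0 \<le> ?A * _\<close> \<open>0 \<le> S * _\<close> unfolding B_def by linarith
      qed
      then show "weighted_l2 ?\<rho> I (\<beta> \<alpha> \<delta>) ((1 + B) * (?A + S))" by (rule weighted_l2_mono[OF *])
    qed
  qed
  have \<beta>1: "weighted_l2 (\<lambda>_. 1) I (\<beta> \<alpha> \<delta>) (CE * ((\<Sum>q\<le>n. norm (\<alpha> q)) + S))"
    if "weighted_l2 (\<lambda>_. 1) (- {0}) \<delta> S" for \<alpha> \<delta> S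
    using CE(2)[of 0 \<delta> S \<alpha>] that by simp

  have "\<forall>m. \<exists>C\<ge>0. \<forall>F c. finite F \<longrightarrow> F \<subseteq> I \<longrightarrow>
     sq_norm T (\<lambda>t. \<Sum>j\<in>F. c j * f j m t) \<le> C * (\<Sum>j\<in>F. (norm (c j) * (1 + \<bar>\<nu> j\<bar>) ^ (m + length \<mu>s))\<^sup>2)"
  proof -
    have "separated \<Gamma>0 I \<nu>" using N(2) by (simp add: I_def)
    from bessel_family_shift_list[OF T X \<Gamma>0(1) this, of \<mu>s]
    show ?thesis unfolding bessel_family_def f_def .
  qed
  from choice[OF this] obtain CB where CB': "\<forall>m. CB m \<ge> 0 \<and> (\<forall>F c. finite F \<longrightarrow> F \<subseteq> I \<longrightarrow>
     sq_norm T (\<lambda>t. \<Sum>j\<in>F. c j * f j m t) \<le> CB m * (\<Sum>j\<in>F. (norm (c j) * (1 + \<bar>\<nu> j\<bar>) ^ (m + length \<mu>s))\<^sup>2))" ..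
  have CB: "CB m \<ge> 0" "finite F \<Longrightarrow> F \<subseteq> I \<Longrightarrow>
     sq_norm T (\<lambda>t. \<Sum>j\<in>F. c j * f j m t) \<le> CB m * (\<Sum>j\<in>F. (norm (c j) * (1 + \<bar>\<nu> j\<bar>) ^ (m + length \<mu>s))\<^sup>2)" for m F c
    by (rule CB'[rule_format, THEN conjunct1]) (rule CB'[rule_format, THEN conjunct2, rule_format])
  define a where "a \<alpha> \<delta> m j = (norm (Y (\<beta> \<alpha> \<delta>) j) * (1 + \<bar>\<nu> j\<bar>) ^ (m + length \<mu>s))\<^sup>2" for \<alpha> \<delta> m j
  have a0: "0 \<le> a \<alpha> \<delta> m j" for \<alpha> \<delta> m j by (simp add: a_def)
  have a_sum: "(\<Sum>j\<in>F. a \<alpha> \<delta> m j) \<le> (CY * (CE * ((\<Sum>q\<le>n. norm (\<alpha> q)) + S)))\<^sup>2"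
    if m: "m \<le> k" and \<delta>: "weighted_l2 (\<lambda>j. (1 + \<bar>\<nu> j\<bar>) ^ m) (- {0}) \<delta> S" and F: "finite F" "F \<subseteq> I" for \<alpha> :: "nat \<Rightarrow> complex" and \<delta> :: "int \<Rightarrow> complex" and m S F
  proof -
    have "L2_set (\<lambda>j. (1 + \<bar>\<nu> j\<bar>) ^ (m + length \<mu>s) * norm (Y (\<beta> \<alpha> \<delta>) j)) F \<le> CY * (CE * ((\<Sum>q\<le>n. norm (\<alpha> q)) + S))"
      by (rule weighted_l2D[OF Ybound[OF m CE(2)[OF m \<delta>]] F])
    then have "(L2_set (\<lambda>j. (1 + \<bar>\<nu> j\<bar>) ^ (m + length \<mu>s) * norm (Y (\<beta> \<alpha> \<delta>) j)) F)\<^sup>2 \<le> (CY * (CE * ((\<Sum>q\<le>n. norm (\<alpha> q)) + S)))\<^sup>2"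
      by (intro power_mono) auto
    then show ?thesis by (simp add: L2_set_def sum_nonneg a_def mult.commute)
  qed

  have "\<forall>m. \<exists>C\<ge>0. \<forall>c. sq_norm T (\<lambda>t. \<Sum>q\<le>n. c q * w q m t) \<le> C * (\<Sum>q\<le>n. norm (c q))\<^sup>2"
    by (intro allI sq_norm_finite_sum cont) simp
  then obtain Dw where Dw: "\<And>m. Dw m \<ge> 0" "\<And>m c. sq_norm T (\<lambda>t. \<Sum>q\<le>n. c q * w q m t) \<le> Dw m * (\<Sum>q\<le>n. norm (c q))\<^sup>2" by metis
  have "\<forall>m. \<exists>C\<ge>0. \<forall>c. sq_norm T (\<lambda>t. \<Sum>j\<in>set lows. c j * g j m t) \<le> C * (\<Sum>j\<in>set lows. norm (c j))\<^sup>2"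
    by (intro allI sq_norm_finite_sum cont) simp
  then obtain Dg where Dg: "\<And>m. Dg m \<ge> 0" "\<And>m c. sq_norm T (\<lambda>t. \<Sum>j\<in>set lows. c j * g j m t) \<le> Dg m * (\<Sum>j\<in>set lows. norm (c j))\<^sup>2" by metis
  define CU where "CU m = 4 * Dw m + 4 * Dg m * (real (length lows))\<^sup>2 + 2 * CB m * (CY * CE)\<^sup>2" for m
  have CU0: "0 \<le> CU m" for m using Dw(1) Dg(1) CB(1) by (simp add: CU_def)
  have Ubound: "sq_norm T (U \<alpha> \<delta> M m) \<le> CU m * ((\<Sum>q\<le>n. norm (\<alpha> q)) + S)\<^sup>2"
    if m: "m \<le> k" and \<delta>: "weighted_l2 (\<lambda>j. (1 + \<bar>\<nu> j\<bar>) ^ m) (- {0}) \<delta> S" for \<alpha> :: "nat \<Rightarrow> complex" and \<delta> :: "int \<Rightarrow> complex" and m S M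
  proof -
    let ?A = "\<Sum>q\<le>n. norm (\<alpha> q)"
    have S0: "0 \<le> S" by (rule weighted_l2_nonneg[OF \<delta>])
    have A0: "0 \<le> ?A" by (intro sum_nonneg) auto
    have "norm (\<delta> j) \<le> S" if "j \<in> set lows" for j
    proof -
      have "1 * norm (\<delta> j) \<le> (1 + \<bar>\<nu> j\<bar>) ^ m * norm (\<delta> j)" by (intro mult_right_mono one_le_power) auto
      also have "\<dots> \<le> S" by (rule weighted_l2_pointwise[OF \<delta>]) (use that lows in auto)
      finally show ?thesis by simp
    qed
    then have "(\<Sum>j\<in>set lows. norm (\<delta> j)) \<le> real (card (set lows)) * S" by (rule sum_bounded_above)
    also have "\<dots> \<le> real (length lows) * S" using card_length[of lows] S0 by (intro mult_right_mono) auto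
    also have "\<dots> \<le> real (length lows) * (?A + S)" using A0 by (intro mult_left_mono) auto
    finally have dl: "(\<Sum>j\<in>set lows. norm (\<delta> j))\<^sup>2 \<le> (real (length lows) * (?A + S))\<^sup>2"
      by (intro power_mono sum_nonneg) auto
    have al: "?A\<^sup>2 \<le> (?A + S)\<^sup>2" using A0 S0 by (intro power_mono) auto
    have b1: "sq_norm T (\<lambda>t. \<Sum>q\<le>n. \<alpha> q * w q m t) \<le> Dw m * (?A + S)\<^sup>2"
      by (rule order_trans[OF Dw(2) mult_left_mono[OF al Dw(1)]])
    have b2: "sq_norm T (\<lambda>t. \<Sum>j\<in>set lows. \<delta> j * g j m t) \<le> Dg m * (real (length lows) * (?A + S))\<^sup>2"
      by (rule order_trans[OF Dg(2) mult_left_mono[OF dl Dg(1)]])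
    have b3: "sq_norm T (H \<alpha> \<delta> M m) \<le> CB m * (CY * (CE * (?A + S)))\<^sup>2"
      unfolding H_def
      using CB(2)[OF W(1)[of M] W(2)[of M], where m=m and c="Y (\<beta> \<alpha> \<delta>)"]
        mult_left_mono[OF a_sum[OF m \<delta> W(1)[of M] W(2)[of M], where \<alpha>=\<alpha>] CB(1)[of m]]
      unfolding a_def by (rule order_trans)
    have "sq_norm T (L \<alpha> \<delta> m) \<le> 2 * sq_norm T (\<lambda>t. \<Sum>q\<le>n. \<alpha> q * w q m t)
        + 2 * sq_norm T (\<lambda>t. \<Sum>j\<in>set lows. \<delta> j * g j m t)"
      unfolding L_def by (rule sq_norm_add_continuous) (intro continuous_intros cont)+
    moreover have "sq_norm T (U \<alpha> \<delta> M m) \<le> 2 * sq_norm T (L \<alpha> \<delta> m) + 2 * sq_norm T (H \<alpha> \<delta> M m)"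
      unfolding U_def by (rule sq_norm_add_continuous[OF Lc Hc])
    moreover have "u \<le> 2 * (2 * p' + 2 * q') + 2 * h'"
      if "l \<le> 2 * p + 2 * q" "u \<le> 2 * l + 2 * h" "p \<le> p'" "q \<le> q'" "h \<le> h'" for u l p q h p' q' h' :: real
      using that by argo
    ultimately have "sq_norm T (U \<alpha> \<delta> M m) \<le> 2 * (2 * (Dw m * (?A + S)\<^sup>2) + 2 * (Dg m * (real (length lows) * (?A + S))\<^sup>2))
        + 2 * (CB m * (CY * (CE * (?A + S)))\<^sup>2)" using b1 b2 b3 by blast
    also have "\<dots> = CU m * (?A + S)\<^sup>2"
    proof -
      have "2 * (2 * (u * x) + 2 * (v * (p * x))) + 2 * (z * (y * (r * x))) = (4 * u + 4 * v * p + 2 * z * (y * r)) * x"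
        for u v x p z y r :: real by (simp add: algebra_simps)
      then show ?thesis unfolding CU_def power_mult_distrib .
    qed
    finally show ?thesis .
  qed

  have Ucauchy: "\<exists>M0. \<forall>M\<ge>M0. \<forall>M'\<ge>M0. sq_norm T (\<lambda>t. U \<alpha> \<delta> M m t - U \<alpha> \<delta> M' m t) < e"
    if m: "m \<le> k" and \<delta>: "weighted_l2 (\<lambda>j. (1 + \<bar>\<nu> j\<bar>) ^ m) (- {0}) \<delta> S" and e: "e > 0" for \<alpha> \<delta> m S e
  proof -
    \<comment> \<open>The difference of two partial sums is governed by the tail of a convergent series with nonnegative terms.\<close>
    define s where "s M = (\<Sum>j\<in>W M. a \<alpha> \<delta> m j)" for M
    have Wmono: "W M' \<subseteq> W M" if "M' \<le> M" for M M' using that by (auto simp: W_def)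
    have diff: "sq_norm T (\<lambda>t. U \<alpha> \<delta> M m t - U \<alpha> \<delta> M' m t) \<le> CB m * (s M - s M')" if "M' \<le> M" for M M'
    proof -
      have "U \<alpha> \<delta> M m t - U \<alpha> \<delta> M' m t = (\<Sum>j\<in>W M - W M'. Y (\<beta> \<alpha> \<delta>) j * f j m t)" for t
        unfolding U_def H_def sum_diff[OF W(1) Wmono[OF that]] by simp
      moreover have "s M - s M' = (\<Sum>j\<in>W M - W M'. a \<alpha> \<delta> m j)"
        unfolding s_def sum_diff[OF W(1) Wmono[OF that]] ..
      moreover have "finite (W M - W M')" "W M - W M' \<subseteq> I" using W[of M] by auto
      note CB(2)[OF this, where m=m and c="Y (\<beta> \<alpha> \<delta>)"]
      ultimately show ?thesis unfolding a_def by (simp only:)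
    qed
    have inc: "incseq s" unfolding s_def by (intro incseq_SucI sum_mono2 W a0 Wmono) simp
    have "\<forall>M. s M \<le> (CY * (CE * ((\<Sum>q\<le>n. norm (\<alpha> q)) + S)))\<^sup>2"
      unfolding s_def by (intro allI a_sum[OF m \<delta> W])
    from incseq_convergent[OF inc this] have "Cauchy s" by (metis LIMSEQ_imp_Cauchy)
    moreover have "0 < e / (CB m + 1)" using e CB(1)[of m] by simp
    ultimately have "\<exists>M0. \<forall>M\<ge>M0. \<forall>M'\<ge>M0. norm (s M - s M') < e / (CB m + 1)" by (rule CauchyD)
    then obtain M0 where M0: "\<And>M M'. M \<ge> M0 \<Longrightarrow> M' \<ge> M0 \<Longrightarrow> norm (s M - s M') < e / (CB m + 1)"
      by blast
    have main: "sq_norm T (\<lambda>t. U \<alpha> \<delta> M m t - U \<alpha> \<delta> M' m t) < e" if "M \<ge> M0" "M' \<ge> M0" "M' \<le> M" for M M'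
    proof -
      have "CB m * (s M - s M') \<le> (CB m + 1) * norm (s M - s M')"
        using CB(1)[of m] incseqD[OF inc that(3)] by (intro mult_mono) auto
      also have "\<dots> < (CB m + 1) * (e / (CB m + 1))" using CB(1)[of m] by (intro mult_strict_left_mono M0 that) auto
      also have "\<dots> = e" using CB(1)[of m] by simp
      finally show ?thesis using diff[OF that(3)] by linarith
    qed
    have "sq_norm T (\<lambda>t. U \<alpha> \<delta> M m t - U \<alpha> \<delta> M' m t) < e" if "M \<ge> M0" "M' \<ge> M0" for M M'
    proof (cases "M' \<le> M")
      case True
      then show ?thesis by (rule main[OF that])
    next
      case False
      then have "M \<le> M'" by simp
      from main[OF that(2,1) this] show ?thesis by (subst sq_norm_minus_commute)
    qed
    then show ?thesis by blast
  qed

  show thesis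
  proof (rule that[of "\<Sum>m\<le>k. CU m" U])
    show "0 \<le> (\<Sum>m\<le>k. CU m)" by (intro sum_nonneg CU0)
    show "supported_jet T (U \<alpha> \<delta> M)" for \<alpha> \<delta> M
      unfolding U_def L_def H_def by (intro supported_jet_add supported_jet_sum_mult T w g f)
    show "U (\<lambda>q. \<alpha> q + \<alpha>' q) (\<lambda>j. \<delta> j + \<delta>' j) M m t = U \<alpha> \<delta> M m t + U \<alpha>' \<delta>' M m t"
      if d1: "weighted_l2 (\<lambda>_. 1) (- {0}) \<delta> S" and d2: "weighted_l2 (\<lambda>_. 1) (- {0}) \<delta>' S'" for \<alpha> \<delta> \<alpha>' \<delta>' S S' M m t
    proof -
      have "\<beta> (\<lambda>q. \<alpha> q + \<alpha>' q) (\<lambda>j. \<delta> j + \<delta>' j) = (\<lambda>l. \<beta> \<alpha> \<delta> l + \<beta> \<alpha>' \<delta>' l)"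
        by (rule ext) (simp add: \<beta>_def E_def distrib_right sum.distrib)
      then have "Y (\<beta> (\<lambda>q. \<alpha> q + \<alpha>' q) (\<lambda>j. \<delta> j + \<delta>' j)) j = Y (\<beta> \<alpha> \<delta>) j + Y (\<beta> \<alpha>' \<delta>') j" if "j \<in> W M" for j
        using Yadd[OF \<beta>1[OF d1] \<beta>1[OF d2] subsetD[OF W(2) that]] by simp
      then have "H (\<lambda>q. \<alpha> q + \<alpha>' q) (\<lambda>j. \<delta> j + \<delta>' j) M m t = H \<alpha> \<delta> M m t + H \<alpha>' \<delta>' M m t"
        by (simp add: H_def distrib_right sum.distrib)
      then show ?thesis by (simp add: U_def L_def distrib_right sum.distrib)
    qed
    show "U (\<lambda>q. c * \<alpha> q) (\<lambda>j. c * \<delta> j) M m t = c * U \<alpha> \<delta> M m t"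
      if d1: "weighted_l2 (\<lambda>_. 1) (- {0}) \<delta> S" for \<alpha> \<delta> c S M m t
    proof -
      have "\<beta> (\<lambda>q. c * \<alpha> q) (\<lambda>j. c * \<delta> j) = (\<lambda>l. c * \<beta> \<alpha> \<delta> l)"
        by (rule ext) (simp add: \<beta>_def E_def distrib_left right_diff_distrib sum_distrib_left mult.assoc)
      then have "Y (\<beta> (\<lambda>q. c * \<alpha> q) (\<lambda>j. c * \<delta> j)) j = c * Y (\<beta> \<alpha> \<delta>) j" if "j \<in> W M" for j
        using Yscale[OF \<beta>1[OF d1] subsetD[OF W(2) that]] by simp
      then have "H (\<lambda>q. c * \<alpha> q) (\<lambda>j. c * \<delta> j) M m t = c * H \<alpha> \<delta> M m t"
        by (simp add: H_def sum_distrib_left mult.assoc)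
      then show ?thesis by (simp add: U_def L_def sum_distrib_left mult.assoc distrib_left)
    qed
    show "sq_norm T (U \<alpha> \<delta> M m) \<le> (\<Sum>m\<le>k. CU m) * ((\<Sum>q\<le>n. norm (\<alpha> q)) + S)\<^sup>2"
      if "m \<le> k" "weighted_l2 (\<lambda>j. (1 + \<bar>\<nu> j\<bar>) ^ m) (- {0}) \<delta> S" for \<alpha> :: "nat \<Rightarrow> complex" and \<delta> :: "int \<Rightarrow> complex" and m S M
    proof -
      have "CU m \<le> (\<Sum>m\<le>k. CU m)" using that(1) CU0 by (intro member_le_sum) auto
      then show ?thesis using Ubound[OF that, of \<alpha> M] mult_right_mono[of "CU m" "\<Sum>m\<le>k. CU m" "((\<Sum>q\<le>n. norm (\<alpha> q)) + S)\<^sup>2"]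
        by (meson order_trans zero_le_power2)
    qed
    show "\<exists>M0. \<forall>M\<ge>M0. \<forall>M'\<ge>M0. sq_norm T (\<lambda>t. U \<alpha> \<delta> M m t - U \<alpha> \<delta> M' m t) < e"
      if "m \<le> k" "weighted_l2 (\<lambda>j. (1 + \<bar>\<nu> j\<bar>) ^ m) (- {0}) \<delta> S" "e > 0" for \<alpha> \<delta> m S e
      by (rule Ucauchy[OF that])
    show "(\<lambda>M. fourier T (U \<alpha> \<delta> M 0) (\<nu> j)) \<longlonglongrightarrow> \<delta> j"
      if \<delta>: "weighted_l2 (\<lambda>_. 1) (- {0}) \<delta> S" and j: "j \<noteq> 0" for \<alpha> \<delta> S j
    proof -
      have FL: "fourier T (L \<alpha> \<delta> 0) z = E \<alpha> \<delta> z" for z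
        unfolding L_def E_def by (subst fourier_add) (auto intro!: continuous_intros cont simp: fourier_sum cont)
      have FU: "fourier T (U \<alpha> \<delta> M 0) z = E \<alpha> \<delta> z + (\<Sum>i\<in>W M. Y (\<beta> \<alpha> \<delta>) i * fourier T (f i 0) z)" for M z
        unfolding U_def fourier_add[OF Lc Hc] FL unfolding H_def by (simp add: fourier_sum cont)
      show ?thesis
      proof (cases "j \<in> set lows")
        case True
        have "(\<Sum>i\<in>set lows. \<delta> i * fourier T (g i 0) (\<nu> j)) = (\<Sum>i\<in>set lows. if j = i then \<delta> i else 0)"
          by (intro sum.cong refl) (simp add: gl True)
        then have "E \<alpha> \<delta> (\<nu> j) = \<delta> j" using True by (simp add: E_def wl)
        then show ?thesis unfolding FU using True by (simp add: fl)
      next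
        case False
        then have jI: "j \<in> I" using split[OF j] by blast
        have "(\<lambda>M. E \<alpha> \<delta> (\<nu> j) + (\<Sum>i\<in>W M. Y (\<beta> \<alpha> \<delta>) i * fourier T (f i 0) (\<nu> j))) \<longlonglongrightarrow> E \<alpha> \<delta> (\<nu> j) + \<beta> \<alpha> \<delta> j"
          unfolding W_def by (intro tendsto_intros Ylim[OF \<beta>1[OF \<delta>] jI])
        then show ?thesis unfolding FU by (simp add: \<beta>_def)
      qed
    qed
    show "power_moment T (U \<alpha> \<delta> M 0) q = \<alpha> q" if "q \<le> n" for \<alpha> \<delta> M q
    proof -
      have PL: "power_moment T (L \<alpha> \<delta> 0) q = (\<Sum>p\<le>n. \<alpha> p * power_moment T (w p 0) q) + (\<Sum>j\<in>set lows. \<delta> j * power_moment T (g j 0) q)"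
        unfolding L_def by (subst power_moment_add) (auto intro!: continuous_intros cont simp: power_moment_sum cont)
      have PH: "power_moment T (H \<alpha> \<delta> M 0) q = 0"
        unfolding H_def using that by (simp add: power_moment_sum cont fp)
      have "(\<Sum>p\<le>n. \<alpha> p * power_moment T (w p 0) q) = (\<Sum>p\<le>n. if q = p then \<alpha> p else 0)"
        using that by (intro sum.cong refl) (simp add: wp)
      then have "(\<Sum>p\<le>n. \<alpha> p * power_moment T (w p 0) q) = \<alpha> q" using that by simp
      then show ?thesis
        unfolding U_def power_moment_add[OF Lc Hc] PL PH using that by (simp add: gp)
    qed
  qed
qed

section \<open>From the moment data to the control\<close>

text \<open>
  Since \<open>\<omega>\<^sub>0 = 0\<close>, the moment of index \<open>0\<close> is a power moment. It is real for data in the moment space.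
\<close>

definition poly_data :: "moments \<Rightarrow> nat \<Rightarrow> complex" where
  "poly_data x q = (if q = 0 then of_real (Re (snd x 0)) else of_real (fst x q))"

text \<open>
  The moments of a real function at opposite frequencies are conjugate.
\<close>

definition exp_data :: "moments \<Rightarrow> int \<Rightarrow> complex" where
  "exp_data x j = (if 0 \<le> j then snd x (nat j) else cnj (snd x (nat (- j))))"

text \<open>
  The summands on the right-hand side of the size estimates.
\<close>

definition data_term :: "(nat \<Rightarrow> real) \<Rightarrow> nat \<Rightarrow> moments \<Rightarrow> int \<Rightarrow> real" where
  "data_term \<omega> m x j = (cmod (of_real (of_bool (j = 0) + omega_ext \<omega> j ^ m) * moment_seq x j))\<^sup>2"

definition data_norm :: "nat \<Rightarrow> (nat \<Rightarrow> real) \<Rightarrow> nat \<Rightarrow> moments \<Rightarrow> real" where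
  "data_norm n \<omega> m x = sqrt (\<Sum>\<^sub>\<infinity>j\<in>{- int n..}. data_term \<omega> m x j)"

lemma data_term_nonneg: "0 \<le> data_term \<omega> m x j"
  by (simp add: data_term_def)

text \<open>
  For \<open>m \<le> k\<close> one has \<open>\<omega>\<^sub>j\<^sup>m \<le> 1 + \<omega>\<^sub>j\<^sup>k\<close>.
\<close>

lemma h_space_summable:
  assumes "\<And>j. \<omega> j \<ge> 0" "d \<in> h_space k \<omega>" "m \<le> k"
  shows "summable (\<lambda>j. (cmod (of_real (of_bool (j = 0) + \<omega> j ^ m) * d j))\<^sup>2)"
proof (rule summable_comparison_test)
  show "summable (\<lambda>j. 2 * (cmod (d j))\<^sup>2 + 2 * (cmod (of_real (of_bool (j = 0) + \<omega> j ^ k) * d j))\<^sup>2)"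
    using assms(2) unfolding h_space_def by (intro summable_add summable_mult) auto
  have "(cmod (of_real (of_bool (j = 0) + \<omega> j ^ m) * d j))\<^sup>2
      \<le> 2 * (cmod (d j))\<^sup>2 + 2 * (cmod (of_real (of_bool (j = 0) + \<omega> j ^ k) * d j))\<^sup>2" for j
  proof -
    let ?b = "of_bool (j = 0) :: real"
    have "\<omega> j ^ m \<le> 1 + \<omega> j ^ k"
    proof (cases "\<omega> j \<le> 1")
      case True
      then have "\<omega> j ^ m \<le> 1" using assms(1) by (intro power_le_one) auto
      then show ?thesis using assms(1)[of j] by (simp add: add_increasing2)
    next
      case False
      then have "\<omega> j ^ m \<le> \<omega> j ^ k" using assms(3) by (intro power_increasing) auto
      then show ?thesis by simp
    qed
    then have "\<bar>?b + \<omega> j ^ m\<bar> \<le> 1 + (?b + \<omega> j ^ k)" using assms(1)[of j] by simp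
    then have "cmod (of_real (?b + \<omega> j ^ m) * d j) \<le> (1 + (?b + \<omega> j ^ k)) * cmod (d j)"
      unfolding norm_mult norm_of_real by (intro mult_right_mono) auto
    also have "\<dots> = cmod (d j) + cmod (of_real (?b + \<omega> j ^ k) * d j)"
    proof -
      have "\<bar>?b + \<omega> j ^ k\<bar> = ?b + \<omega> j ^ k" using assms(1)[of j] by simp
      then show ?thesis unfolding norm_mult norm_of_real by (simp add: distrib_right)
    qed
    finally have "(cmod (of_real (?b + \<omega> j ^ m) * d j))\<^sup>2
        \<le> (cmod (d j) + cmod (of_real (?b + \<omega> j ^ k) * d j))\<^sup>2" by (rule power_mono) simp
    also have "\<dots> \<le> 2 * (cmod (d j))\<^sup>2 + 2 * (cmod (of_real (?b + \<omega> j ^ k) * d j))\<^sup>2"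
      using norm_add_sq[of "cmod (d j)" "cmod (of_real (?b + \<omega> j ^ k) * d j)"] by simp
    finally show ?thesis .
  qed
  then show "\<exists>N. \<forall>j\<ge>N. norm ((cmod (of_real (of_bool (j = 0) + \<omega> j ^ m) * d j))\<^sup>2)
      \<le> 2 * (cmod (d j))\<^sup>2 + 2 * (cmod (of_real (of_bool (j = 0) + \<omega> j ^ k) * d j))\<^sup>2" by auto
qed

lemma data_term_has_sum:
  assumes "\<And>j. \<omega> j \<ge> 0" "x \<in> moment_space n k \<omega>" "m \<le> k"
  shows "(data_term \<omega> m x has_sum ((\<Sum>q=1..n. (\<omega> q ^ m * fst x q)\<^sup>2) + (h_norm m \<omega> (snd x))\<^sup>2)) {- int n..}"
proof -
  let ?f = "\<lambda>j. (cmod (of_real (of_bool (j = 0) + \<omega> j ^ m) * snd x j))\<^sup>2"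
  have sm: "summable ?f"
    by (rule h_space_summable[OF assms(1) _ assms(3)]) (use assms(2) in \<open>auto simp: moment_space_def\<close>)
  have "(?f has_sum suminf ?f) UNIV"
    by (rule norm_summable_imp_has_sum) (use sm in \<open>auto simp: summable_sums\<close>)
  moreover have "suminf ?f = (h_norm m \<omega> (snd x))\<^sup>2"
    unfolding h_norm_def using suminf_nonneg[OF sm] by simp
  moreover have "?f = data_term \<omega> m x \<circ> int"
    by (auto simp: data_term_def omega_ext_def moment_seq_def fun_eq_iff)
  ultimately have 1: "(data_term \<omega> m x has_sum (h_norm m \<omega> (snd x))\<^sup>2) (range int)"
    by (subst has_sum_reindex) (auto simp: inj_on_def)
  have inj: "inj_on (\<lambda>q. - int q) {1..n}" by (auto simp: inj_on_def)
  have "(\<Sum>q=1..n. (\<omega> q ^ m * fst x q)\<^sup>2) = sum (data_term \<omega> m x) ((\<lambda>q. - int q) ` {1..n})"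
  proof (subst sum.reindex[OF inj], rule sum.cong[OF refl])
    fix q assume q: "q \<in> {1..n}"
    have "(cmod (of_real ((- \<omega> q) ^ m) * of_real (fst x q)))\<^sup>2 = (\<omega> q ^ m * fst x q)\<^sup>2"
      by (simp add: norm_mult norm_power power_mult_distrib power_even_abs flip: power_mult)
    then show "(\<omega> q ^ m * fst x q)\<^sup>2 = (data_term \<omega> m x \<circ> (\<lambda>q. - int q)) q"
      using q by (simp add: data_term_def omega_ext_def moment_seq_def)
  qed
  then have 2: "(data_term \<omega> m x has_sum (\<Sum>q=1..n. (\<omega> q ^ m * fst x q)\<^sup>2)) ((\<lambda>q. - int q) ` {1..n})"
    by (simp add: has_sum_finite)
  have "(\<lambda>q. - int q) ` {1..n} \<union> range int = {- int n..}"
  proof (intro equalityI subsetI)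
    fix j assume j: "j \<in> {- int n..}"
    show "j \<in> (\<lambda>q. - int q) ` {1..n} \<union> range int"
    proof (cases "0 \<le> j")
      case True
      then show ?thesis by (metis UnI2 nonneg_int_cases rangeI)
    next
      case False
      then have "j = - int (nat (- j))" "nat (- j) \<in> {1..n}" using j by auto
      then show ?thesis by blast
    qed
  qed auto
  moreover have "(\<lambda>q. - int q) ` {1..n} \<inter> range int = {}" by auto
  ultimately show ?thesis using has_sum_Un_disjoint[OF 2 1] by simp
qed

lemma data_norm_sq:
  assumes "\<And>j. \<omega> j \<ge> 0" "x \<in> moment_space n k \<omega>" "m \<le> k"
  shows "(data_norm n \<omega> m x)\<^sup>2 = (\<Sum>q=1..n. (\<omega> q ^ m * fst x q)\<^sup>2) + (h_norm m \<omega> (snd x))\<^sup>2"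
  using data_term_has_sum[OF assms] unfolding data_norm_def
  by (simp add: infsumI sum_nonneg add_nonneg_nonneg)

lemma data_norm_nonneg: "0 \<le> data_norm n \<omega> m x"
  by (simp add: data_norm_def infsum_nonneg data_term_nonneg)

lemma data_term_sum_le:
  assumes "\<And>j. \<omega> j \<ge> 0" "x \<in> moment_space n k \<omega>" "m \<le> k" "finite F" "F \<subseteq> {- int n..}"
  shows "(\<Sum>j\<in>F. data_term \<omega> m x j) \<le> (data_norm n \<omega> m x)\<^sup>2"
proof -
  have "(\<Sum>j\<in>F. data_term \<omega> m x j) \<le> (\<Sum>\<^sub>\<infinity>j\<in>{- int n..}. data_term \<omega> m x j)"
    using data_term_has_sum[OF assms(1-3)] assms(4,5)
    by (intro finite_sum_le_infsum) (auto simp: summable_on_def data_term_nonneg)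
  then show ?thesis by (simp add: data_norm_def infsum_nonneg data_term_nonneg)
qed

text \<open>
  The two norms differ in the weights \<open>\<omega>\<^sub>q\<^sup>k\<close> of the finitely many power moments.
\<close>

lemma data_norm_le_moment_norm:
  assumes "strict_mono \<omega>" "\<And>j. \<omega> j \<ge> 0" "x \<in> moment_space n k \<omega>"
  shows "data_norm n \<omega> k x \<le> (1 + \<omega> n ^ k) * moment_norm n k \<omega> x"
proof (rule power2_le_imp_le)
  have c: "1 \<le> (1 + \<omega> n ^ k)\<^sup>2" using assms(2)[of n] by (intro one_le_power) simp
  have "(\<Sum>q=1..n. (\<omega> q ^ k * fst x q)\<^sup>2) \<le> (\<Sum>q=1..n. (1 + \<omega> n ^ k)\<^sup>2 * (fst x q)\<^sup>2)"
  proof (rule sum_mono)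
    fix q assume "q \<in> {1..n}"
    then have "\<omega> q \<le> \<omega> n" using assms(1) by (simp add: strict_mono_less_eq)
    then have "\<omega> q ^ k \<le> \<omega> n ^ k" using assms(2) by (intro power_mono) auto
    then have "(\<omega> q ^ k)\<^sup>2 \<le> (1 + \<omega> n ^ k)\<^sup>2" using assms(2)[of q] by (intro power_mono) auto
    then show "(\<omega> q ^ k * fst x q)\<^sup>2 \<le> (1 + \<omega> n ^ k)\<^sup>2 * (fst x q)\<^sup>2"
      unfolding power_mult_distrib by (intro mult_right_mono) auto
  qed
  moreover have "(h_norm k \<omega> (snd x))\<^sup>2 \<le> (1 + \<omega> n ^ k)\<^sup>2 * (h_norm k \<omega> (snd x))\<^sup>2"
    using mult_right_mono[OF c, of "(h_norm k \<omega> (snd x))\<^sup>2"] by simp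
  ultimately show "(data_norm n \<omega> k x)\<^sup>2 \<le> ((1 + \<omega> n ^ k) * moment_norm n k \<omega> x)\<^sup>2"
    unfolding data_norm_sq[OF assms(2,3) order_refl] moment_norm_def power_mult_distrib
    by (simp add: sum_nonneg distrib_left sum_distrib_left)
  show "0 \<le> (1 + \<omega> n ^ k) * moment_norm n k \<omega> x"
    using assms(2)[of n] by (auto simp: moment_norm_def intro!: mult_nonneg_nonneg add_nonneg_nonneg sum_nonneg)
qed

lemma omega_ext_abs:
  assumes "\<And>j. \<omega> j \<ge> 0"
  shows "\<bar>omega_ext \<omega> j\<bar> = \<omega> (nat \<bar>j\<bar>)"
  using assms by (auto simp: omega_ext_def)

text \<open>
  \<open>\<omega>\<^sub>1\<close> is the smallest positive frequency, and \<open>x \<mapsto> (1 + x) / x\<close> decreases.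
\<close>

lemma weight_comparison:
  fixes \<omega> :: "nat \<Rightarrow> real"
  assumes "strict_mono \<omega>" "\<And>j. \<omega> j \<ge> 0" "j \<ge> 1" "m \<le> k"
  shows "(1 + \<omega> j) ^ m \<le> ((1 + \<omega> 1) / \<omega> 1) ^ k * \<omega> j ^ m"
proof -
  have w1: "0 < \<omega> 1" using strict_monoD[OF assms(1), of 0 1] assms(2)[of 0] by simp
  have wj: "\<omega> 1 \<le> \<omega> j" using assms(1,3) by (simp add: strict_mono_less_eq)
  have "1 + \<omega> j \<le> (1 + \<omega> 1) / \<omega> 1 * \<omega> j"
    using w1 wj by (simp add: field_simps)
  then have "(1 + \<omega> j) ^ m \<le> ((1 + \<omega> 1) / \<omega> 1 * \<omega> j) ^ m"
    using assms(2)[of j] by (intro power_mono) auto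
  also have "\<dots> \<le> ((1 + \<omega> 1) / \<omega> 1) ^ k * \<omega> j ^ m"
    unfolding power_mult_distrib using assms(2)[of j] assms(4) w1
    by (intro mult_right_mono power_increasing) (auto simp: field_simps)
  finally show ?thesis .
qed

text \<open>
  Each datum of positive index occurs twice, once for each sign of the frequency.
\<close>

lemma exp_data_bound:
  assumes "strict_mono \<omega>" "\<And>j. \<omega> j \<ge> 0" "x \<in> moment_space n k \<omega>" "m \<le> k"
  shows "weighted_l2 (\<lambda>j. (1 + \<bar>omega_ext \<omega> j\<bar>) ^ m) (- {0}) (exp_data x)
    (2 * ((1 + \<omega> 1) / \<omega> 1) ^ k * data_norm n \<omega> m x)"
  unfolding weighted_l2_def
proof (intro allI impI)
  fix F :: "int set" assume F: "finite F" "F \<subseteq> - {0}"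
  define K where "K = ((1 + \<omega> 1) / \<omega> 1) ^ k"
  define N where "N = data_norm n \<omega> m x"
  define a where "a j = ((1 + \<bar>omega_ext \<omega> j\<bar>) ^ m * norm (exp_data x j))\<^sup>2" for j
  have w1: "0 < \<omega> 1" using strict_monoD[OF assms(1), of 0 1] assms(2)[of 0] by simp
  have K0: "0 \<le> K" using w1 by (simp add: K_def)
  have N0: "0 \<le> N" by (simp add: N_def data_norm_nonneg)
  have a_le: "a j \<le> K\<^sup>2 * data_term \<omega> m x \<bar>j\<bar>" if "j \<noteq> 0" for j
  proof -
    define i where "i = nat \<bar>j\<bar>"
    have i: "i \<ge> 1" "\<bar>j\<bar> = int i" using that by (auto simp: i_def)
    have n: "norm (exp_data x j) = norm (snd x i)" by (auto simp: exp_data_def i_def)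
    have "(1 + \<bar>omega_ext \<omega> j\<bar>) ^ m * norm (exp_data x j) \<le> K * \<omega> i ^ m * norm (snd x i)"
      unfolding n omega_ext_abs[OF assms(2)] K_def i_def[symmetric]
      by (intro mult_right_mono weight_comparison assms i) auto
    then have "a j \<le> (K * \<omega> i ^ m * norm (snd x i))\<^sup>2" unfolding a_def by (intro power_mono) auto
    also have "\<dots> = K\<^sup>2 * data_term \<omega> m x \<bar>j\<bar>"
      using i(1) assms(2)[of i] unfolding i(2) data_term_def
      by (simp add: omega_ext_def moment_seq_def norm_mult power_mult_distrib norm_power)
    finally show ?thesis .
  qed
  have half: "(\<Sum>j\<in>G. a j) \<le> K\<^sup>2 * N\<^sup>2" if G: "finite G" "G \<subseteq> - {0}" "inj_on abs G" for G
  proof -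
    have "(\<Sum>j\<in>G. a j) \<le> (\<Sum>j\<in>G. K\<^sup>2 * data_term \<omega> m x \<bar>j\<bar>)" using G by (intro sum_mono a_le) auto
    also have "\<dots> = K\<^sup>2 * (\<Sum>j\<in>abs ` G. data_term \<omega> m x j)"
      by (simp add: sum.reindex[OF G(3)] sum_distrib_left)
    also have "\<dots> \<le> K\<^sup>2 * N\<^sup>2"
      unfolding N_def using G by (intro mult_left_mono data_term_sum_le[OF assms(2-4)]) auto
    finally show ?thesis .
  qed
  have "(\<Sum>j\<in>F. a j) = (\<Sum>j\<in>{j\<in>F. 0 < j} \<union> {j\<in>F. j < 0}. a j)"
  proof (intro sum.cong refl equalityI subsetI)
    fix j assume "j \<in> F"
    moreover from this have "j \<noteq> 0" using F by auto
    ultimately show "j \<in> {j\<in>F. 0 < j} \<union> {j\<in>F. j < 0}" by (auto simp: neq_iff)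
  qed auto
  also have "\<dots> = (\<Sum>j\<in>{j\<in>F. 0 < j}. a j) + (\<Sum>j\<in>{j\<in>F. j < 0}. a j)"
    using F by (intro sum.union_disjoint) auto
  also have "\<dots> \<le> K\<^sup>2 * N\<^sup>2 + K\<^sup>2 * N\<^sup>2"
    using F by (intro add_mono half) (auto simp: inj_on_def)
  also have "\<dots> \<le> (2 * K * N)\<^sup>2" by (simp add: power_mult_distrib)
  finally have "sqrt (\<Sum>j\<in>F. a j) \<le> sqrt ((2 * K * N)\<^sup>2)" by (rule real_sqrt_le_mono)
  then show "L2_set (\<lambda>j. (1 + \<bar>omega_ext \<omega> j\<bar>) ^ m * norm (exp_data x j)) F \<le> 2 * K * N"
    using K0 N0 by (simp add: L2_set_def a_def)
qed

lemma poly_data_bound: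
  assumes "strict_mono \<omega>" "\<And>j. \<omega> j \<ge> 0" "x \<in> moment_space n k \<omega>" "m \<le> k"
  shows "(\<Sum>q\<le>n. norm (poly_data x q)) \<le> real (Suc n) * (((1 + \<omega> 1) / \<omega> 1) ^ k * data_norm n \<omega> m x)"
proof -
  define K where "K = ((1 + \<omega> 1) / \<omega> 1) ^ k"
  define N where "N = data_norm n \<omega> m x"
  have w1: "0 < \<omega> 1" using strict_monoD[OF assms(1), of 0 1] assms(2)[of 0] by simp
  have K1: "1 \<le> K" using w1 unfolding K_def by (intro one_le_power) (simp add: field_simps)
  have N0: "0 \<le> N" by (simp add: N_def data_norm_nonneg)
  have term_le: "sqrt (data_term \<omega> m x j) \<le> N" if "- int n \<le> j" for j
  proof -
    have "data_term \<omega> m x j \<le> N\<^sup>2"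
      using data_term_sum_le[OF assms(2-4), of "{j}"] that by (simp add: N_def)
    then show ?thesis using N0 by (simp add: real_le_lsqrt)
  qed
  have "norm (poly_data x q) \<le> K * N" if "q \<le> n" for q
  proof (cases "q = 0")
    case True
    have "norm (poly_data x 0) \<le> 1 * norm (snd x 0)" by (simp add: poly_data_def abs_Re_le_cmod)
    also have "\<dots> \<le> (1 + \<omega> 0 ^ m) * norm (snd x 0)" using assms(2)[of 0] by (intro mult_right_mono) auto
    also have "\<dots> = sqrt (data_term \<omega> m x 0)"
    proof -
      have "\<bar>1 + \<omega> 0 ^ m\<bar> = 1 + \<omega> 0 ^ m" using assms(2)[of 0] by simp
      then show ?thesis unfolding data_term_def real_sqrt_abs abs_norm_cancel norm_mult norm_of_real
        by (simp add: omega_ext_def moment_seq_def)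
    qed
    also have "\<dots> \<le> N" by (rule term_le) simp
    also have "\<dots> \<le> K * N" using mult_right_mono[OF K1 N0] by simp
    finally show ?thesis using True by simp
  next
    case False
    have "norm (poly_data x q) \<le> (1 + \<omega> q) ^ m * norm (fst x q)"
      using False assms(2)[of q] mult_right_mono[of 1 "(1 + \<omega> q) ^ m" "\<bar>fst x q\<bar>"]
      by (simp add: poly_data_def one_le_power)
    also have "\<dots> \<le> K * \<omega> q ^ m * norm (fst x q)"
      unfolding K_def using False by (intro mult_right_mono weight_comparison assms) auto
    also have "\<dots> = K * sqrt (data_term \<omega> m x (- int q))"
    proof -
      have "\<omega> q ^ m * norm (fst x q) = sqrt (data_term \<omega> m x (- int q))"
        using False assms(2)[of q] unfolding data_term_def real_sqrt_abs abs_norm_cancel norm_mult norm_of_real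
        by (simp add: omega_ext_def moment_seq_def power_abs)
      then show ?thesis by (simp only: mult.assoc)
    qed
    also have "\<dots> \<le> K * N" using that K1 by (intro mult_left_mono term_le) auto
    finally show ?thesis .
  qed
  then have "(\<Sum>q\<le>n. norm (poly_data x q)) \<le> (\<Sum>q\<le>n. K * N)" by (intro sum_mono) simp
  then show ?thesis by (simp add: K_def N_def)
qed

lemma moment_space_diff:
  assumes "x \<in> moment_space n k \<omega>" "y \<in> moment_space n k \<omega>"
  shows "moment_diff y x \<in> moment_space n k \<omega>"
proof -
  have s: "summable (\<lambda>j. (cmod (w j * (d j - d' j)))\<^sup>2)"
    if "summable (\<lambda>j. (cmod (w j * d j))\<^sup>2)" "summable (\<lambda>j. (cmod (w j * d' j))\<^sup>2)" for w d d' :: "nat \<Rightarrow> complex"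
  proof (rule summable_comparison_test)
    show "summable (\<lambda>j. 2 * (cmod (w j * d j))\<^sup>2 + 2 * (cmod (w j * d' j))\<^sup>2)"
      by (intro summable_add summable_mult that)
    show "\<exists>N. \<forall>j\<ge>N. norm ((cmod (w j * (d j - d' j)))\<^sup>2) \<le> 2 * (cmod (w j * d j))\<^sup>2 + 2 * (cmod (w j * d' j))\<^sup>2"
      using norm_add_sq[of "w j * d j" "- (w j * d' j)" for j] by (simp add: right_diff_distrib)
  qed
  show ?thesis
    using assms s[of "\<lambda>_. 1" "snd y" "snd x"]
      s[of "\<lambda>j. of_real (of_bool (j = 0) + \<omega> j ^ k)" "snd y" "snd x"]
    by (auto simp: moment_space_def moment_diff_def Rn_def h_space_def)
qed

text \<open>
  Taking real parts averages the moments at \<open>z\<close> and \<open>- z\<close>, the latter conjugated. For conjugate data both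
  agree, so nothing is lost.
\<close>

lemma fourier_Re:
  assumes "continuous_on UNIV f"
  shows "fourier T (\<lambda>t. of_real (Re (f t))) z = (fourier T f z + cnj (fourier T f (- z))) / 2"
proof -
  have i: "integrable (leb T) (\<lambda>t. f t * exp (\<i> * of_real (z * t)))" for z
    by (intro integrable_leb_continuous continuous_intros assms)
  have "complex_of_real (Re (f t)) * exp (\<i> * of_real (z * t))
      = (f t * exp (\<i> * of_real (z * t)) + cnj (f t * exp (\<i> * of_real (- z * t)))) / 2" for t
  proof -
    have "cnj (exp (\<i> * of_real (- z * t))) = exp (\<i> * of_real (z * t))" by (simp add: exp_cnj)
    moreover have "complex_of_real (Re w) = (w + cnj w) / 2" for w by (simp add: complex_add_cnj)
    ultimately show ?thesis by (simp add: distrib_right add_divide_distrib)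
  qed
  then have "fourier T (\<lambda>t. of_real (Re (f t))) z
      = (\<integral>t. (f t * exp (\<i> * of_real (z * t)) + cnj (f t * exp (\<i> * of_real (- z * t)))) / 2 \<partial>leb T)"
    unfolding fourier_def by (simp only:)
  also have "\<dots> = ((\<integral>t. f t * exp (\<i> * of_real (z * t)) \<partial>leb T) + (\<integral>t. cnj (f t * exp (\<i> * of_real (- z * t))) \<partial>leb T)) / 2"
    using i[of z] i[of "- z"] by (subst integral_divide_zero, subst Bochner_Integration.integral_add) (simp_all only: integrable_cnj)
  finally show ?thesis unfolding fourier_def Bochner_Integration.integral_cnj .
qed

lemma sq_norm_Re:
  assumes "continuous_on UNIV f"
  shows "sq_norm T (\<lambda>t. Re (f t)) \<le> sq_norm T f"
  unfolding sq_norm_def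
proof (rule integral_mono)
  show "integrable (leb T) (\<lambda>t. (norm (Re (f t)))\<^sup>2)" "integrable (leb T) (\<lambda>t. (norm (f t))\<^sup>2)"
    by (intro integrable_leb_continuous continuous_intros assms)+
  show "(norm (Re (f t)))\<^sup>2 \<le> (norm (f t))\<^sup>2" for t
    by (intro power_mono) (simp_all add: abs_Re_le_cmod)
qed

lemma real_sections:
  fixes T :: real and k n :: nat and \<omega> :: "nat \<Rightarrow> real"
  assumes T: "T > 0" and mono: "strict_mono \<omega>" and nonneg: "\<And>j. \<omega> j \<ge> 0" and zero: "\<omega> 0 = 0"
    and gap: "\<exists>\<epsilon>>0. \<exists>N\<^sub>0::nat. \<exists>c>0. \<forall>j\<ge>N\<^sub>0. \<omega> (Suc j) - \<omega> j \<ge> c * real j powr \<epsilon>"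
  obtains s :: "moments \<Rightarrow> nat \<Rightarrow> nat \<Rightarrow> real \<Rightarrow> real" and C
  where "C \<ge> 0" "\<And>x M. supported_jet T (s x M)"
    "\<And>x y M m t. x \<in> moment_space n k \<omega> \<Longrightarrow> y \<in> moment_space n k \<omega> \<Longrightarrow>
      s (moment_add x y) M m t = s x M m t + s y M m t"
    "\<And>x r M m t. x \<in> moment_space n k \<omega> \<Longrightarrow> s (moment_scale r x) M m t = r * s x M m t"
    "\<And>x M m. x \<in> moment_space n k \<omega> \<Longrightarrow> m \<le> k \<Longrightarrow> sq_norm T (s x M m) \<le> C * (data_norm n \<omega> m x)\<^sup>2"
    "\<And>x m e. x \<in> moment_space n k \<omega> \<Longrightarrow> m \<le> k \<Longrightarrow> e > 0 \<Longrightarrow>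
      \<exists>M0. \<forall>M\<ge>M0. \<forall>M'\<ge>M0. sq_norm T (\<lambda>t. s x M m t - s x M' m t) < e"
    "\<And>x j. x \<in> moment_space n k \<omega> \<Longrightarrow> (\<lambda>M. fourier T (\<lambda>t. of_real (s x M 0 t)) (\<omega> j)) \<longlonglongrightarrow> snd x j"
    "\<And>x M q. q \<in> {1..n} \<Longrightarrow> (\<integral>t. s x M 0 t * t ^ q \<partial>leb T) = fst x q"
proof -
  let ?\<nu> = "omega_ext \<omega>"
  have nu0: "?\<nu> 0 = 0" by (simp add: omega_ext_def zero)
  have nu_neg: "?\<nu> (- j) = - ?\<nu> j" for j by (simp add: omega_ext_def zero)
  obtain \<gamma> where \<gamma>: "\<gamma> > 0" "separated \<gamma> UNIV ?\<nu>"
    by (rule omega_ext_separated_UNIV[OF mono zero gap]) (rule that)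
  have am: "\<bar>?\<nu> j\<bar> \<le> \<bar>?\<nu> l\<bar>" if "\<bar>j\<bar> \<le> \<bar>l\<bar>" for j l
    using that mono by (simp add: omega_ext_abs[OF nonneg] strict_mono_less_eq)
  have as: "\<bar>?\<nu> j\<bar> < \<bar>?\<nu> l\<bar>" if "\<bar>j\<bar> < \<bar>l\<bar>" for j l
    using that mono by (simp add: omega_ext_abs[OF nonneg] strict_mono_less)
  have high: "\<exists>N::nat. N \<ge> 1 \<and> separated \<Gamma> {j. int N \<le> \<bar>j\<bar>} ?\<nu>" if "\<Gamma> > 0" for \<Gamma>
    by (rule omega_ext_separated_high[OF nonneg gap that]) blast
  obtain U :: "(nat \<Rightarrow> complex) \<Rightarrow> (int \<Rightarrow> complex) \<Rightarrow> nat \<Rightarrow> nat \<Rightarrow> real \<Rightarrow> complex" and C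
    where C: "C \<ge> 0" and U: "\<And>\<alpha> \<delta> M. supported_jet T (U \<alpha> \<delta> M)"
    and Uadd: "\<And>\<alpha> \<delta> \<alpha>' \<delta>' S S' M m t. weighted_l2 (\<lambda>_. 1) (- {0}) \<delta> S \<Longrightarrow> weighted_l2 (\<lambda>_. 1) (- {0}) \<delta>' S' \<Longrightarrow>
      U (\<lambda>q. \<alpha> q + \<alpha>' q) (\<lambda>j. \<delta> j + \<delta>' j) M m t = U \<alpha> \<delta> M m t + U \<alpha>' \<delta>' M m t"
    and Uscale: "\<And>\<alpha> \<delta> c S M m t. weighted_l2 (\<lambda>_. 1) (- {0}) \<delta> S \<Longrightarrow>
      U (\<lambda>q. c * \<alpha> q) (\<lambda>j. c * \<delta> j) M m t = c * U \<alpha> \<delta> M m t"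
    and Ubound: "\<And>\<alpha> \<delta> m S M. m \<le> k \<Longrightarrow> weighted_l2 (\<lambda>j. (1 + \<bar>?\<nu> j\<bar>) ^ m) (- {0}) \<delta> S \<Longrightarrow>
      sq_norm T (U \<alpha> \<delta> M m) \<le> C * ((\<Sum>q\<le>n. norm (\<alpha> q)) + S)\<^sup>2"
    and Ucauchy: "\<And>\<alpha> \<delta> m S e. m \<le> k \<Longrightarrow> weighted_l2 (\<lambda>j. (1 + \<bar>?\<nu> j\<bar>) ^ m) (- {0}) \<delta> S \<Longrightarrow> e > 0 \<Longrightarrow>
      \<exists>M0. \<forall>M\<ge>M0. \<forall>M'\<ge>M0. sq_norm T (\<lambda>t. U \<alpha> \<delta> M m t - U \<alpha> \<delta> M' m t) < e"
    and Ulim: "\<And>\<alpha> \<delta> S j. weighted_l2 (\<lambda>_. 1) (- {0}) \<delta> S \<Longrightarrow> j \<noteq> 0 \<Longrightarrow>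
      (\<lambda>M. fourier T (U \<alpha> \<delta> M 0) (?\<nu> j)) \<longlonglongrightarrow> \<delta> j"
    and Upow: "\<And>\<alpha> \<delta> M q. q \<le> n \<Longrightarrow> power_moment T (U \<alpha> \<delta> M 0) q = \<alpha> q"
    by (rule moment_sections[OF T nu0 \<gamma> am as high, where n=n and k=k]) (assumption, assumption, assumption, rule that)
  have Uc: "continuous_on UNIV (U \<alpha> \<delta> M m)" for \<alpha> \<delta> M m
    by (rule jet_continuous[OF supported_jet_jet[OF U]])
  define K where "K = ((1 + \<omega> 1) / \<omega> 1) ^ k"
  have db: "weighted_l2 (\<lambda>j. (1 + \<bar>?\<nu> j\<bar>) ^ m) (- {0}) (exp_data x) (2 * K * data_norm n \<omega> m x)"
    if "x \<in> moment_space n k \<omega>" "m \<le> k" for x m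
    unfolding K_def by (rule exp_data_bound[OF mono nonneg that])
  have db1: "weighted_l2 (\<lambda>_. 1) (- {0}) (exp_data x) (2 * K * data_norm n \<omega> 0 x)"
    if "x \<in> moment_space n k \<omega>" for x
    using db[OF that, of 0] by simp
  define s where "s x M m t = Re (U (poly_data x) (exp_data x) M m t)" for x M m t
  show thesis
  proof (rule that[of "C * ((real (Suc n) + 2) * K)\<^sup>2" s])
    show "0 \<le> C * ((real (Suc n) + 2) * K)\<^sup>2" using C by simp
    show "supported_jet T (s x M)" for x M
      unfolding s_def by (rule supported_jet_map[OF U bounded_linear_Re])
    show "s (moment_add x y) M m t = s x M m t + s y M m t"
      if "x \<in> moment_space n k \<omega>" "y \<in> moment_space n k \<omega>" for x y M m t
    proof -
      have "poly_data (moment_add x y) = (\<lambda>q. poly_data x q + poly_data y q)"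
        "exp_data (moment_add x y) = (\<lambda>j. exp_data x j + exp_data y j)"
        by (auto simp: poly_data_def exp_data_def moment_add_def fun_eq_iff)
      then show ?thesis unfolding s_def using Uadd[OF db1[OF that(1)] db1[OF that(2)]] by simp
    qed
    show "s (moment_scale r x) M m t = r * s x M m t" if "x \<in> moment_space n k \<omega>" for x r M m t
    proof -
      have "poly_data (moment_scale r x) = (\<lambda>q. of_real r * poly_data x q)"
        "exp_data (moment_scale r x) = (\<lambda>j. of_real r * exp_data x j)"
        by (auto simp: poly_data_def exp_data_def moment_scale_def fun_eq_iff)
      then show ?thesis unfolding s_def using Uscale[OF db1[OF that]] by simp
    qed
    show "sq_norm T (s x M m) \<le> C * ((real (Suc n) + 2) * K)\<^sup>2 * (data_norm n \<omega> m x)\<^sup>2"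
      if "x \<in> moment_space n k \<omega>" "m \<le> k" for x M m
    proof -
      have "sq_norm T (s x M m) \<le> sq_norm T (U (poly_data x) (exp_data x) M m)"
        unfolding s_def by (rule sq_norm_Re[OF Uc])
      also have "\<dots> \<le> C * ((\<Sum>q\<le>n. norm (poly_data x q)) + 2 * K * data_norm n \<omega> m x)\<^sup>2"
        by (rule Ubound[OF that(2) db[OF that]])
      also have "\<dots> \<le> C * ((real (Suc n) + 2) * K * data_norm n \<omega> m x)\<^sup>2"
      proof (intro mult_left_mono power_mono C)
        have "(\<Sum>q\<le>n. norm (poly_data x q)) \<le> real (Suc n) * (K * data_norm n \<omega> m x)"
          unfolding K_def by (rule poly_data_bound[OF mono nonneg that])
        then show "(\<Sum>q\<le>n. norm (poly_data x q)) + 2 * K * data_norm n \<omega> m x \<le> (real (Suc n) + 2) * K * data_norm n \<omega> m x"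
          by (simp add: distrib_right mult.assoc)
        show "0 \<le> (\<Sum>q\<le>n. norm (poly_data x q)) + 2 * K * data_norm n \<omega> m x"
          by (intro add_nonneg_nonneg sum_nonneg weighted_l2_nonneg[OF db[OF that]]) auto
      qed
      finally show ?thesis by (simp only: power_mult_distrib mult.assoc)
    qed
    show "\<exists>M0. \<forall>M\<ge>M0. \<forall>M'\<ge>M0. sq_norm T (\<lambda>t. s x M m t - s x M' m t) < e"
      if "x \<in> moment_space n k \<omega>" "m \<le> k" "e > 0" for x m e
    proof -
      have "sq_norm T (\<lambda>t. s x M m t - s x M' m t)
          \<le> sq_norm T (\<lambda>t. U (poly_data x) (exp_data x) M m t - U (poly_data x) (exp_data x) M' m t)" for M M'
        unfolding s_def minus_complex.simps(1)[symmetric] by (intro sq_norm_Re continuous_on_diff Uc)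
      then show ?thesis using Ucauchy[OF that(2) db[OF that(1,2)] that(3), of "poly_data x"] by (meson le_less_trans)
    qed
    show "(\<lambda>M. fourier T (\<lambda>t. of_real (s x M 0 t)) (\<omega> j)) \<longlonglongrightarrow> snd x j"
      if x: "x \<in> moment_space n k \<omega>" for x j
    proof -
      let ?F = "\<lambda>M z. fourier T (U (poly_data x) (exp_data x) M 0) z"
      have eq: "fourier T (\<lambda>t. of_real (s x M 0 t)) (\<omega> j) = (?F M (\<omega> j) + cnj (?F M (- \<omega> j))) / 2" for M
        unfolding s_def by (rule fourier_Re[OF Uc])
      show ?thesis
      proof (cases "j = 0")
        case True
        have "?F M 0 = poly_data x 0" for M using Upow[of 0 "poly_data x" "exp_data x" M] by (simp add: power_moment_0)
        moreover obtain r where "snd x 0 = of_real r"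
          using x by (auto simp: moment_space_def h_space_def elim: Reals_cases)
        ultimately show ?thesis unfolding eq using True by (simp add: zero poly_data_def)
      next
        case False
        have "(\<lambda>M. ?F M (?\<nu> (int j))) \<longlonglongrightarrow> exp_data x (int j)" "(\<lambda>M. ?F M (?\<nu> (- int j))) \<longlonglongrightarrow> exp_data x (- int j)"
          by (rule Ulim[OF db1[OF x]], use False in simp)+
        then have l: "(\<lambda>M. ?F M (\<omega> j)) \<longlonglongrightarrow> snd x j" "(\<lambda>M. ?F M (- \<omega> j)) \<longlonglongrightarrow> cnj (snd x j)"
          using False by (simp_all add: omega_ext_def exp_data_def)
        have "(\<lambda>M. (?F M (\<omega> j) + cnj (?F M (- \<omega> j))) / 2) \<longlonglongrightarrow> (snd x j + cnj (cnj (snd x j))) / 2"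
          by (intro tendsto_intros l) simp
        then show ?thesis unfolding eq by simp
      qed
    qed
    show "(\<integral>t. s x M 0 t * t ^ q \<partial>leb T) = fst x q" if q: "q \<in> {1..n}" for x M q
    proof -
      have i: "integrable (leb T) (\<lambda>t. U (poly_data x) (exp_data x) M 0 t * of_real (t ^ q))"
        by (intro integrable_leb_continuous continuous_intros Uc)
      have "(\<integral>t. s x M 0 t * t ^ q \<partial>leb T) = (\<integral>t. Re (U (poly_data x) (exp_data x) M 0 t * of_real (t ^ q)) \<partial>leb T)"
        by (simp add: s_def del: of_real_power)
      also have "\<dots> = Re (power_moment T (U (poly_data x) (exp_data x) M 0) q)"
        unfolding power_moment_def by (rule integral_Re[OF i])
      also have "\<dots> = fst x q" using q by (simp add: Upow poly_data_def)
      finally show ?thesis .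
    qed
  qed
qed

theorem theorem3p9:
  fixes T :: real and k n :: nat and \<omega> :: "nat \<Rightarrow> real"
  assumes "T > 0" and "n \<ge> 1"
    and "strict_mono \<omega>" and "\<And>j. \<omega> j \<ge> 0" and "\<omega> 0 = 0"
    and "\<exists>\<epsilon>>0. \<exists>N\<^sub>0::nat. \<exists>c>0. \<forall>j\<ge>N\<^sub>0. \<omega> (Suc j) - \<omega> j \<ge> c * real j powr \<epsilon>"
  shows "\<exists>C>0. \<exists>L :: (nat \<Rightarrow> real) \<times> (nat \<Rightarrow> complex) \<Rightarrow> real \<Rightarrow> real.
    linear_H0 n k \<omega> T L \<and> continuous_H0 n k \<omega> T L \<and>
    (\<forall>a\<in>Rn n. \<forall>d\<in>h_space k \<omega>.
       (\<forall>j. (\<integral>t. complex_of_real (L (a, d) t) * exp (\<i> * of_real (\<omega> j * t)) \<partial>leb T) = d j) \<and>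
       (\<forall>q\<in>{1..n}. (\<integral>t. t ^ q * L (a, d) t \<partial>leb T) = a q) \<and>
       (\<forall>m\<le>k. H0_norm m T (L (a, d)) \<le>
          C * sqrt (\<Sum>\<^sub>\<infinity>j\<in>{- int n..}.
            (cmod (of_real (of_bool (j = 0) + omega_ext \<omega> j ^ m) * moment_seq (a, d) j))\<^sup>2)))"
proof -
  note T = assms(1) and nonneg = assms(4)
  obtain s :: "moments \<Rightarrow> nat \<Rightarrow> nat \<Rightarrow> real \<Rightarrow> real" and C where C: "C \<ge> 0"
    and s: "\<And>x M. supported_jet T (s x M)"
    and s_add: "\<And>x y M m t. x \<in> moment_space n k \<omega> \<Longrightarrow> y \<in> moment_space n k \<omega> \<Longrightarrow>
      s (moment_add x y) M m t = s x M m t + s y M m t"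
    and s_scale: "\<And>x r M m t. x \<in> moment_space n k \<omega> \<Longrightarrow> s (moment_scale r x) M m t = r * s x M m t"
    and s_bound: "\<And>x M m. x \<in> moment_space n k \<omega> \<Longrightarrow> m \<le> k \<Longrightarrow> sq_norm T (s x M m) \<le> C * (data_norm n \<omega> m x)\<^sup>2"
    and s_cauchy: "\<And>x m e. x \<in> moment_space n k \<omega> \<Longrightarrow> m \<le> k \<Longrightarrow> e > 0 \<Longrightarrow>
      \<exists>M0. \<forall>M\<ge>M0. \<forall>M'\<ge>M0. sq_norm T (\<lambda>t. s x M m t - s x M' m t) < e"
    and s_exp: "\<And>x j. x \<in> moment_space n k \<omega> \<Longrightarrow> (\<lambda>M. fourier T (\<lambda>t. of_real (s x M 0 t)) (\<omega> j)) \<longlonglongrightarrow> snd x j"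
    and s_pow: "\<And>x M q. q \<in> {1..n} \<Longrightarrow> (\<integral>t. s x M 0 t * t ^ q \<partial>leb T) = fst x q"
    by (rule real_sections[OF T assms(3) nonneg assms(5,6), where n=n and k=k]) (rule that)
  have sL: "s x M m \<in> L2_space T" for x M m
    by (rule L2_space_continuous[OF jet_continuous[OF supported_jet_jet[OF s]]])
  \<comment> \<open>An \<open>L\<^sup>2\<close> limit is unique up to null sets, so any choice of it is linear almost everywhere.\<close>
  define limit where "limit x u \<longleftrightarrow> u \<in> L2_space T \<and> (\<lambda>M. sq_norm T (\<lambda>t. s x M 0 t - u t)) \<longlonglongrightarrow> 0" for x u
  define L where "L x = (SOME u. limit x u)" for x
  have limit_unique: "AE t in leb T. u t = v t" if "limit x u" "limit x v" for x u v
    using sq_norm_limit_unique[of "\<lambda>M. s x M 0", OF sL] that unfolding limit_def by blast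
  have L_some: "limit x (L x)" if "limit x u" for x u
    unfolding L_def by (rule someI[of "limit x", OF that])
  have L: "limit x (L x)" if x: "x \<in> moment_space n k \<omega>" for x
  proof -
    obtain u where "u \<in> L2_space T" "(\<lambda>M. sq_norm T (\<lambda>t. s x M 0 t - u t)) \<longlonglongrightarrow> 0"
      by (rule L2_complete[of "\<lambda>M. s x M 0", OF sL s_cauchy[OF x]]) auto
    then show ?thesis by (intro L_some) (simp add: limit_def)
  qed
  have LL: "L x \<in> L2_space T" if "x \<in> moment_space n k \<omega>" for x using L[OF that] by (simp add: limit_def)
  have Llim: "(\<lambda>M. sq_norm T (\<lambda>t. s x M 0 t - L x t)) \<longlonglongrightarrow> 0" if "x \<in> moment_space n k \<omega>" for x
    using L[OF that] by (simp add: limit_def)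
  have L_H0: "L x \<in> H0 k T" if x: "x \<in> moment_space n k \<omega>" for x
    by (rule H0_limit(1)[of T "s x", OF T s s_cauchy[OF x] LL[OF x] Llim[OF x]])
  have L_bound: "H0_norm m T (L x) \<le> sqrt (2 * C) * data_norm n \<omega> m x"
    if x: "x \<in> moment_space n k \<omega>" and m: "m \<le> k" for x m
  proof -
    have "H0_norm m T (L x) \<le> sqrt (2 * (C * (data_norm n \<omega> m x)\<^sup>2))"
      by (rule H0_limit(2)[of T "s x", OF T s s_cauchy[OF x] LL[OF x] Llim[OF x] m s_bound[OF x m]])
    also have "\<dots> = sqrt (2 * C) * data_norm n \<omega> m x"
      using data_norm_nonneg[of n \<omega> m x] by (simp add: real_sqrt_mult)
    finally show ?thesis .
  qed
  have L_add: "AE t in leb T. L (moment_add x y) t = L x t + L y t"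
    if x: "x \<in> moment_space n k \<omega>" and y: "y \<in> moment_space n k \<omega>" for x y
  proof -
    have "limit (moment_add x y) (\<lambda>t. L x t + L y t)"
      unfolding limit_def
    proof (intro conjI L2_space_add LL x y)
      have le: "sq_norm T (\<lambda>t. s (moment_add x y) M 0 t - (L x t + L y t))
          \<le> 2 * sq_norm T (\<lambda>t. s x M 0 t - L x t) + 2 * sq_norm T (\<lambda>t. s y M 0 t - L y t)" for M
        using sq_norm_add[OF L2_space_diff[OF sL LL[OF x]] L2_space_diff[OF sL LL[OF y]], of x M 0 y M 0]
        by (simp add: s_add[OF x y] algebra_simps)
      have "(\<lambda>M. 2 * sq_norm T (\<lambda>t. s x M 0 t - L x t) + 2 * sq_norm T (\<lambda>t. s y M 0 t - L y t)) \<longlonglongrightarrow> 2 * 0 + 2 * 0"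
        by (intro tendsto_intros Llim x y)
      then have lim: "(\<lambda>M. 2 * sq_norm T (\<lambda>t. s x M 0 t - L x t) + 2 * sq_norm T (\<lambda>t. s y M 0 t - L y t)) \<longlonglongrightarrow> 0" by simp
      show "(\<lambda>M. sq_norm T (\<lambda>t. s (moment_add x y) M 0 t - (L x t + L y t))) \<longlonglongrightarrow> 0"
        by (rule tendsto_sandwich[OF _ _ tendsto_const lim]) (auto simp: sq_norm_nonneg le)
    qed
    from limit_unique[OF L_some[OF this] this] show ?thesis .
  qed
  have L_scale: "AE t in leb T. L (moment_scale r x) t = r * L x t"
    if x: "x \<in> moment_space n k \<omega>" for r x
  proof -
    have "limit (moment_scale r x) (\<lambda>t. r * L x t)"
      unfolding limit_def
    proof (intro conjI L2_space_scale LL x)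
      have "sq_norm T (\<lambda>t. s (moment_scale r x) M 0 t - r * L x t) = r\<^sup>2 * sq_norm T (\<lambda>t. s x M 0 t - L x t)" for M
        by (simp add: s_scale[OF x] sq_norm_def power_mult_distrib flip: right_diff_distrib)
      then show "(\<lambda>M. sq_norm T (\<lambda>t. s (moment_scale r x) M 0 t - r * L x t)) \<longlonglongrightarrow> 0"
        using tendsto_mult_right_zero[OF Llim[OF x], of "r\<^sup>2"] by simp
    qed
    from limit_unique[OF L_some[OF this] this] show ?thesis .
  qed
  have "linear_H0 n k \<omega> T L"
    unfolding linear_H0_def using L_H0 L_add L_scale by blast
  moreover have "continuous_H0 n k \<omega> T L"
    unfolding continuous_H0_def
  proof (intro ballI allI impI)
    fix x and e :: real assume x: "x \<in> moment_space n k \<omega>" and e: "e > 0"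
    \<comment> \<open>By linearity \<open>L y - L x\<close> is \<open>L (y - x)\<close>, to which the size estimate with \<open>m = k\<close> applies.\<close>
    define B where "B = sqrt (2 * C) * (1 + \<omega> n ^ k) + 1"
    have B: "B > 0" using C nonneg[of n] by (simp add: B_def add_nonneg_pos)
    have "H0_norm k T (\<lambda>t. L y t - L x t) < e"
      if y: "y \<in> moment_space n k \<omega>" and close: "moment_norm n k \<omega> (moment_diff y x) < e / B" for y
    proof -
      have z: "moment_diff y x \<in> moment_space n k \<omega>" by (rule moment_space_diff[OF x y])
      have "moment_add (moment_diff y x) x = y"
        by (simp add: moment_add_def moment_diff_def)
      with L_add[OF z x] have "AE t in leb T. L y t = L (moment_diff y x) t + L x t" by simp
      then have ae: "AE t in leb T. L y t - L x t = L (moment_diff y x) t" by eventually_elim simp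
      have "H0_norm k T (\<lambda>t. L y t - L x t) = H0_norm k T (L (moment_diff y x))"
        by (rule H0_norm_cong_AE[OF L2_space_diff[OF LL[OF y] LL[OF x]] LL[OF z] ae])
      also have "\<dots> \<le> sqrt (2 * C) * data_norm n \<omega> k (moment_diff y x)" by (rule L_bound[OF z order_refl])
      also have "\<dots> \<le> sqrt (2 * C) * ((1 + \<omega> n ^ k) * moment_norm n k \<omega> (moment_diff y x))"
        using C by (intro mult_left_mono data_norm_le_moment_norm[OF assms(3) nonneg z]) auto
      also have "\<dots> \<le> B * moment_norm n k \<omega> (moment_diff y x)"
      proof -
        have "0 \<le> moment_norm n k \<omega> (moment_diff y x)"
          unfolding moment_norm_def by (auto intro!: add_nonneg_nonneg sum_nonneg)
        then show ?thesis by (simp add: B_def distrib_right mult.assoc)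
      qed
      also have "\<dots> < B * (e / B)" by (rule mult_strict_left_mono[OF close B])
      also have "\<dots> = e" using B by simp
      finally show ?thesis .
    qed
    then show "\<exists>\<delta>>0. \<forall>y\<in>moment_space n k \<omega>. moment_norm n k \<omega> (moment_diff y x) < \<delta> \<longrightarrow>
        H0_norm k T (\<lambda>t. L y t - L x t) < e"
      using e B by (intro exI[of _ "e / B"]) auto
  qed
  moreover have "(\<forall>j. (\<integral>t. complex_of_real (L (a, d) t) * exp (\<i> * of_real (\<omega> j * t)) \<partial>leb T) = d j) \<and>
       (\<forall>q\<in>{1..n}. (\<integral>t. t ^ q * L (a, d) t \<partial>leb T) = a q) \<and>
       (\<forall>m\<le>k. H0_norm m T (L (a, d)) \<le> (sqrt (2 * C) + 1) * sqrt (\<Sum>\<^sub>\<infinity>j\<in>{- int n..}.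
            (cmod (of_real (of_bool (j = 0) + omega_ext \<omega> j ^ m) * moment_seq (a, d) j))\<^sup>2))"
    if "a \<in> Rn n" "d \<in> h_space k \<omega>" for a d
  proof -
    have x: "(a, d) \<in> moment_space n k \<omega>" using that by (simp add: moment_space_def)
    note conv = integral_L2_tendsto[of T "\<lambda>M. s (a, d) M 0", OF T sL LL[OF x] _ Llim[OF x]]
    show ?thesis
    proof (intro conjI allI ballI impI)
      fix j
      have "(\<lambda>M. \<integral>t. s (a, d) M 0 t *\<^sub>R exp (\<i> * of_real (\<omega> j * t)) \<partial>leb T)
          \<longlonglongrightarrow> (\<integral>t. L (a, d) t *\<^sub>R exp (\<i> * of_real (\<omega> j * t)) \<partial>leb T)"
        by (rule conv) (intro continuous_intros)
      from LIMSEQ_unique[OF this] s_exp[OF x, of j]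
      show "(\<integral>t. complex_of_real (L (a, d) t) * exp (\<i> * of_real (\<omega> j * t)) \<partial>leb T) = d j"
        by (simp add: fourier_def scaleR_conv_of_real)
    next
      fix q assume q: "q \<in> {1..n}"
      have "(\<lambda>M. \<integral>t. s (a, d) M 0 t *\<^sub>R t ^ q \<partial>leb T) \<longlonglongrightarrow> (\<integral>t. L (a, d) t *\<^sub>R t ^ q \<partial>leb T)"
        by (rule conv) (intro continuous_intros)
      then have "(\<integral>t. L (a, d) t * t ^ q \<partial>leb T) = a q"
        by (simp only: real_scaleR_def s_pow[OF q] LIMSEQ_const_iff fst_conv)
      then show "(\<integral>t. t ^ q * L (a, d) t \<partial>leb T) = a q" by (simp only: mult.commute)
    next
      fix m assume m: "m \<le> k"
      have "H0_norm m T (L (a, d)) \<le> sqrt (2 * C) * data_norm n \<omega> m (a, d)" by (rule L_bound[OF x m])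
      also have "\<dots> \<le> (sqrt (2 * C) + 1) * data_norm n \<omega> m (a, d)"
        by (intro mult_right_mono data_norm_nonneg) simp
      finally show "H0_norm m T (L (a, d)) \<le> (sqrt (2 * C) + 1) * sqrt (\<Sum>\<^sub>\<infinity>j\<in>{- int n..}.
            (cmod (of_real (of_bool (j = 0) + omega_ext \<omega> j ^ m) * moment_seq (a, d) j))\<^sup>2)"
        unfolding data_norm_def data_term_def .
    qed
  qed
  moreover have "sqrt (2 * C) + 1 > 0" using C by (simp add: add_nonneg_pos)
  ultimately show ?thesis by blast
qed

end
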